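(* Let $$\mathfrak{A}:=\Big\{f\in\mathfrak{C}:\ \exists\text{ a bounded sequence }\{x_n\}_{n\in\mathbb{N}}\subset\mathbb{R}^d\text{ and }t_n\to\infty\text{ such that }d_{\mathfrak{C}}(\mathcal{T}_{t_n}id_{x_n},f)\to0\text{ as }n\to\infty\Big\}.$$ Then $\mathfrak{A}$ is the $\mathcal{D}$-attractor of the Volterra semiflow $\{\mathcal{T}_t\}_{t\ge0}$ in $\mathfrak{C}$, with the following properties: (i) $\mathfrak{A}$ is precompact (in $(\mathfrak{C},d_{\mathfrak{C}})$); (ii) $\mathfrak{A}$ is invariant under the semiflow, i.e. $\mathcal{T}_t\mathfrak{A}=\mathfrak{A}$ for all $t\ge0$; (iii) $\mathfrak{A}$ is $\mathcal{D}$-attracting, i.e. for any $\mathfrak{D}\in\mathcal{D}$, $\lim_{t\to\infty}\mathrm{dist}_{\mathfrak{C}}(\mathcal{T}_t\mathfrak{D},\mathfrak{A})=0$; (iv) $\mathfrak{A}$ is the minimal set in $\mathfrak{C}$ which is $\mathcal{D}$-attracting, that is, if $\mathfrak{A}'\subset\mathfrak{C}$ is also $\mathcal{D}$-attracting then $\mathfrak{A}\subset\mathfrak{A}'$.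
   Context: Let $d\in\mathbb{N}$, $\alpha\in(0,1)$, and let $\langle\cdot,\cdot\rangle$, $\|\cdot\|$ be the standard inner product and norm of $\mathbb{R}^d$. Let $g:\mathbb{R}^d\to\mathbb{R}^d$ be locally Lipschitz and satisfy $\langle x,g(x)\rangle\le a-b\|x\|^2$ for all $x\in\mathbb{R}^d$, for some constants $a,b>0$. $\Gamma$ is the Gamma function. Let $\mathfrak{C}:=C([0,\infty),\mathbb{R}^d)$ be the space of continuous functions $f:[0,\infty)\to\mathbb{R}^d$, with the metric $$d_{\mathfrak{C}}(f,h):=\|f(0)-h(0)\|+\sum_{k=1}^\infty\frac1{2^k}\frac{\sup_{\theta\in[0,k]}\|f(\theta)-h(\theta)\|}{1+\sup_{\theta\in[0,k]}\|f(\theta)-h(\theta)\|}.$$ For sets $A,B\subset\mathfrak{C}$, $\mathrm{dist}_{\mathfrak{C}}(A,B):=\sup_{u\in A}\inf_{v\in B}d_{\mathfrak{C}}(u,v)$ is the Hausdorff semimetric. For $f\in\mathfrak{C}$ let $x_f\in\mathfrak{C}$ denote the solution of the Volterra integral equation $x_f(t)=f(t)+\frac1{\Gamma(\alpha)}\int_0^t(t-s)^{\alpha-1}g(x_f(s))\,ds$, $t\ge0$, and define for $t\ge0$ $$(\mathcal{T}_tf)(\theta):=f(t+\theta)+\frac1{\Gamma(\alpha)}\int_0^t(t+\theta-s)^{\alpha-1}g(x_f(s))\,ds,\quad\theta\ge0.$$ It is taken as known that $\{\mathcal{T}_t\}_{t\ge0}$ is a semiflow of continuous operators on $\mathfrak{C}$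 (with the compact-open topology); it is called the Volterra semiflow. For $x_0\in\mathbb{R}^d$ let $id_{x_0}\in\mathfrak{C}$ be the constant function $id_{x_0}(\theta)\equiv x_0$. Let $\mathcal{D}$ (the attraction universe) be the collection of all sets of the form $\mathfrak{D}=\{id_{x_0}:x_0\in D_0\}$ with $D_0$ a bounded subset of $\mathbb{R}^d$. That $\mathfrak{A}$ is the $\mathcal{D}$-attractor means that it has the properties (i)-(iv) listed in the claim.
   Formalization: In (iv) minimality is stated only among closed D-attracting sets 𝔄'; for arbitrary 𝔄' it is false, since ℭ minus one point of 𝔄 is still D-attracting but does not contain 𝔄. *)

theory Defs
  imports "HOL-Analysis.Analysis"
begin

text \<open>Functions on \<open>[0,\<infinity>)\<close> are total functions on the reals that take the dummy value
  \<^term>\<open>undefined\<close> at negative arguments, so that equality of such functions is equality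
  on \<open>[0,\<infinity>)\<close>.\<close>

definition path_space :: "(real \<Rightarrow> real ^ 'd) set" where
  "path_space = {f. continuous_on {0..} f \<and> f \<in> extensional {0..}}"

definition sup_dist :: "real \<Rightarrow> (real \<Rightarrow> real ^ 'd) \<Rightarrow> (real \<Rightarrow> real ^ 'd) \<Rightarrow> real" where
  "sup_dist T f h = (SUP \<theta>\<in>{0..T}. norm (f \<theta> - h \<theta>))"

text \<open>The locale \<^locale>\<open>Metric_space\<close> requires non-negativity and symmetry for all arguments,
  hence the dummy value when an argument is not in the space; it is positive, so that nothing
  outside the space is close to a point of it.\<close>

definition path_dist :: "(real \<Rightarrow> real ^ 'd) \<Rightarrow> (real \<Rightarrow> real ^ 'd) \<Rightarrow> real" where
  "path_dist f h = (if f \<in> path_space \<and> h \<in> path_space then norm (f 0 - h 0)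
     + (\<Sum>n. let k = Suc n in 1 / 2 ^ k * (sup_dist (real k) f h / (1 + sup_dist (real k) f h)))
     else 1)"

abbreviation path_topology :: "(real \<Rightarrow> real ^ 'd) topology" where
  "path_topology \<equiv> Metric_space.mtopology path_space path_dist"

text \<open>The Hausdorff semimetric is valued in \<open>[0,\<infinity>]\<close>, where \<open>sup {} = 0\<close> and \<open>inf {} = \<infinity>\<close>.\<close>

definition hausdorff_semidist ::
  "(real \<Rightarrow> real ^ 'd) set \<Rightarrow> (real \<Rightarrow> real ^ 'd) set \<Rightarrow> ennreal" where
  "hausdorff_semidist A B = (SUP u\<in>A. INF v\<in>B. ennreal (path_dist u v))"

definition precompact_in :: "'a topology \<Rightarrow> 'a set \<Rightarrow> bool" where
  "precompact_in X A \<longleftrightarrow> A \<subseteq> topspace X \<and> compactin X (X closure_of A)"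

definition is_volterra_solution ::
  "real \<Rightarrow> (real ^ 'd \<Rightarrow> real ^ 'd) \<Rightarrow> (real \<Rightarrow> real ^ 'd) \<Rightarrow> (real \<Rightarrow> real ^ 'd) \<Rightarrow> bool" where
  "is_volterra_solution \<alpha> g f x \<longleftrightarrow> x \<in> path_space \<and>
     (\<forall>t\<ge>0. x t = f t + (1 / Gamma \<alpha>) *\<^sub>R
        integral {0..t} (\<lambda>s. ((t - s) powr (\<alpha> - 1)) *\<^sub>R g (x s)))"

definition volterra_solution ::
  "real \<Rightarrow> (real ^ 'd \<Rightarrow> real ^ 'd) \<Rightarrow> (real \<Rightarrow> real ^ 'd) \<Rightarrow> (real \<Rightarrow> real ^ 'd)" where
  "volterra_solution \<alpha> g f = (THE x. is_volterra_solution \<alpha> g f x)"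

definition volterra_semiflow ::
  "real \<Rightarrow> (real ^ 'd \<Rightarrow> real ^ 'd) \<Rightarrow> real \<Rightarrow> (real \<Rightarrow> real ^ 'd) \<Rightarrow> (real \<Rightarrow> real ^ 'd)" where
  "volterra_semiflow \<alpha> g t f = (\<lambda>\<theta>\<in>{0..}. f (t + \<theta>) + (1 / Gamma \<alpha>) *\<^sub>R
     integral {0..t} (\<lambda>s. ((t + \<theta> - s) powr (\<alpha> - 1)) *\<^sub>R g (volterra_solution \<alpha> g f s)))"

definition const_path :: "real ^ 'd \<Rightarrow> (real \<Rightarrow> real ^ 'd)" where
  "const_path x\<^sub>0 = (\<lambda>\<theta>\<in>{0..}. x\<^sub>0)"

definition attraction_universe :: "(real \<Rightarrow> real ^ 'd) set set" where
  "attraction_universe = {const_path ` D\<^sub>0 | D\<^sub>0. bounded D\<^sub>0}"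

definition attracts_universe ::
  "real \<Rightarrow> (real ^ 'd \<Rightarrow> real ^ 'd) \<Rightarrow> (real \<Rightarrow> real ^ 'd) set \<Rightarrow> bool" where
  "attracts_universe \<alpha> g A \<longleftrightarrow> (\<forall>D\<in>attraction_universe.
     ((\<lambda>t. hausdorff_semidist (volterra_semiflow \<alpha> g t ` D) A) \<longlongrightarrow> 0) at_top)"

definition volterra_attractor ::
  "real \<Rightarrow> (real ^ 'd \<Rightarrow> real ^ 'd) \<Rightarrow> (real \<Rightarrow> real ^ 'd) set" where
  "volterra_attractor \<alpha> g = {f \<in> path_space. \<exists>(x :: nat \<Rightarrow> real ^ 'd) (\<tau> :: nat \<Rightarrow> real).
     bounded (range x) \<and> (\<forall>n. 0 \<le> \<tau> n) \<and> filterlim \<tau> at_top sequentially \<and>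
     (\<lambda>n. path_dist (volterra_semiflow \<alpha> g (\<tau> n) (const_path (x n))) f) \<longlonglongrightarrow> 0}"

text \<open>The Hausdorff semidistance to a set depends only on the closure of that set, so minimality
  of an attracting set can only be meant among the closed ones: deleting one point of the
  attractor from the whole (perfect) space leaves an attracting set, which is not closed.
  The attractor itself is not asserted to be closed, only to lie in every closed attracting set.\<close>

lemma sup_dist_bdd:
  assumes "f \<in> path_space" "h \<in> path_space"
  shows "bdd_above ((\<lambda>\<theta>. norm (f \<theta> - h \<theta>)) ` {0..T})"
proof -
  have "continuous_on {0..T} (\<lambda>\<theta>. norm (f \<theta> - h \<theta>))"
    using assms unfolding path_space_def
    by (intro continuous_intros) (auto elim: continuous_on_subset)
  then have "compact ((\<lambda>\<theta>. norm (f \<theta> - h \<theta>)) ` {0..T})"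
    by (rule compact_continuous_image) simp
  then show ?thesis by (intro bounded_imp_bdd_above compact_imp_bounded)
qed

lemma sup_dist_upper:
  assumes "f \<in> path_space" "h \<in> path_space" "0 \<le> \<theta>" "\<theta> \<le> T"
  shows "norm (f \<theta> - h \<theta>) \<le> sup_dist T f h"
  unfolding sup_dist_def using assms by (intro cSUP_upper sup_dist_bdd) auto

lemma sup_dist_nonneg:
  assumes "f \<in> path_space" "h \<in> path_space" "0 \<le> T"
  shows "0 \<le> sup_dist T f h"
  using sup_dist_upper[OF assms(1,2), of 0 T] assms(3) norm_ge_zero order_trans by blast

lemma sup_dist_triangle:
  assumes "f \<in> path_space" "h \<in> path_space" "k \<in> path_space" "0 \<le> T"
  shows "sup_dist T f k \<le> sup_dist T f h + sup_dist T h k"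
  unfolding sup_dist_def[of T f k]
proof (rule cSUP_least)
  show "{0..T} \<noteq> {}" using assms by auto
next
  fix \<theta> assume "\<theta> \<in> {0..T}"
  then have "norm (f \<theta> - h \<theta>) \<le> sup_dist T f h" "norm (h \<theta> - k \<theta>) \<le> sup_dist T h k"
    using assms by (auto intro: sup_dist_upper)
  then show "norm (f \<theta> - k \<theta>) \<le> sup_dist T f h + sup_dist T h k"
    using norm_triangle_ineq[of "f \<theta> - h \<theta>" "h \<theta> - k \<theta>"] by simp
qed

lemma sup_dist_commute: "sup_dist T f h = sup_dist T h f"
  unfolding sup_dist_def by (simp add: norm_minus_commute)

lemma frac_mono:
  fixes a b :: real
  assumes "0 \<le> a" "a \<le> b"
  shows "a / (1 + a) \<le> b / (1 + b)"
  using assms by (simp add: field_simps)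

lemma frac_subadd:
  fixes a b :: real
  assumes "0 \<le> a" "0 \<le> b"
  shows "(a + b) / (1 + (a + b)) \<le> a / (1 + a) + b / (1 + b)"
proof -
  have "a / (1 + (a + b)) \<le> a / (1 + a)" "b / (1 + (a + b)) \<le> b / (1 + b)"
    using assms by (auto intro!: divide_left_mono)
  then show ?thesis by (simp add: add_divide_distrib)
qed

definition path_dist_term :: "(real \<Rightarrow> real ^ 'd) \<Rightarrow> (real \<Rightarrow> real ^ 'd) \<Rightarrow> nat \<Rightarrow> real" where
  "path_dist_term f h n =
     1 / 2 ^ Suc n * (sup_dist (real (Suc n)) f h / (1 + sup_dist (real (Suc n)) f h))"

lemma path_dist_alt:
  assumes "f \<in> path_space" "h \<in> path_space"
  shows "path_dist f h = norm (f 0 - h 0) + (\<Sum>n. path_dist_term f h n)"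
  using assms unfolding path_dist_def path_dist_term_def Let_def by simp

lemma path_dist_term_nonneg:
  assumes "f \<in> path_space" "h \<in> path_space"
  shows "0 \<le> path_dist_term f h n"
  unfolding path_dist_term_def using sup_dist_nonneg[OF assms, of "real (Suc n)"] by simp

lemma path_dist_term_summable:
  assumes "f \<in> path_space" "h \<in> path_space"
  shows "summable (path_dist_term f h)"
proof (rule summable_comparison_test')
  show "summable (\<lambda>n. (1 / 2 :: real) ^ Suc n)"
    by (subst summable_Suc_iff) (simp add: summable_geometric)
  fix n :: nat
  let ?s = "sup_dist (real (Suc n)) f h"
  have "0 \<le> ?s" using sup_dist_nonneg[OF assms, of "real (Suc n)"] by simp
  then have "?s / (1 + ?s) \<le> 1" by (simp add: field_simps)
  then have "path_dist_term f h n \<le> 1 / 2 ^ Suc n * 1"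
    unfolding path_dist_term_def by (intro mult_left_mono) auto
  then show "norm (path_dist_term f h n) \<le> (1 / 2) ^ Suc n"
    using path_dist_term_nonneg[OF assms, of n] by (simp add: power_one_over)
qed

lemma Metric_space_path: "Metric_space path_space path_dist"
proof
  fix f h :: "real \<Rightarrow> real ^ 'd"
  show "path_dist f h = path_dist h f"
    unfolding path_dist_def by (simp only: sup_dist_commute[of _ f h] norm_minus_commute[of "f 0"] conj_commute)
  show "0 \<le> path_dist f h"
  proof (cases "f \<in> path_space \<and> h \<in> path_space")
    case True
    then show ?thesis
      by (simp add: path_dist_alt suminf_nonneg path_dist_term_summable path_dist_term_nonneg)
  qed (auto simp: path_dist_def)
next
  fix f h :: "real \<Rightarrow> real ^ 'd"
  assume fh: "f \<in> path_space" "h \<in> path_space"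
  show "path_dist f h = 0 \<longleftrightarrow> f = h"
  proof
    assume "path_dist f h = 0"
    moreover have "0 \<le> (\<Sum>n. path_dist_term f h n)"
      by (simp add: fh suminf_nonneg path_dist_term_summable path_dist_term_nonneg)
    ultimately have "(\<Sum>n. path_dist_term f h n) = 0"
      using path_dist_alt[OF fh] norm_ge_zero[of "f 0 - h 0"] by linarith
    then have *: "path_dist_term f h n = 0" for n
      using suminf_eq_zero_iff[OF path_dist_term_summable[OF fh]] path_dist_term_nonneg[OF fh]
      by blast
    have "f \<theta> = h \<theta>" if "0 \<le> \<theta>" for \<theta>
    proof -
      obtain m where "\<theta> \<le> real m" using real_arch_simple by blast
      then have n: "\<theta> \<le> real (Suc m)" by simp
      have "0 \<le> sup_dist (real (Suc m)) f h" by (intro sup_dist_nonneg fh) simp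
      then have "sup_dist (real (Suc m)) f h = 0"
        using *[of m] by (auto simp: path_dist_term_def)
      then show ?thesis using sup_dist_upper[OF fh that n] by simp
    qed
    then show "f = h"
      using fh by (intro extensionalityI[of f "{0..}" h]) (auto simp: path_space_def)
  next
    assume "f = h"
    moreover have "sup_dist (real (Suc n)) h h = 0" for n
      by (simp add: sup_dist_def)
    ultimately show "path_dist f h = 0" using fh by (simp add: path_dist_def Let_def)
  qed
next
  fix f h k :: "real \<Rightarrow> real ^ 'd"
  assume A: "f \<in> path_space" "h \<in> path_space" "k \<in> path_space"
  have "path_dist_term f k n \<le> path_dist_term f h n + path_dist_term h k n" for n
  proof -
    let ?s = "sup_dist (real (Suc n))"
    have nn: "0 \<le> ?s f k" "0 \<le> ?s f h" "0 \<le> ?s h k"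
      by (intro sup_dist_nonneg A; simp)+
    have "?s f k / (1 + ?s f k) \<le> (?s f h + ?s h k) / (1 + (?s f h + ?s h k))"
      by (intro frac_mono nn sup_dist_triangle A) simp
    also have "\<dots> \<le> ?s f h / (1 + ?s f h) + ?s h k / (1 + ?s h k)"
      by (intro frac_subadd nn)
    finally have "1 / 2 ^ Suc n * (?s f k / (1 + ?s f k))
        \<le> 1 / 2 ^ Suc n * (?s f h / (1 + ?s f h) + ?s h k / (1 + ?s h k))"
      by (intro mult_left_mono) auto
    then show ?thesis unfolding path_dist_term_def by (simp only: distrib_left)
  qed
  then have "(\<Sum>n. path_dist_term f k n) \<le> (\<Sum>n. path_dist_term f h n + path_dist_term h k n)"
    by (intro suminf_le summable_add path_dist_term_summable A)
  also have "\<dots> = (\<Sum>n. path_dist_term f h n) + (\<Sum>n. path_dist_term h k n)"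
    by (intro suminf_add[symmetric] path_dist_term_summable A)
  finally show "path_dist f k \<le> path_dist f h + path_dist h k"
    using norm_triangle_ineq[of "f 0 - h 0" "h 0 - k 0"] by (simp add: path_dist_alt A)
qed

end

theory Submission
  imports Defs "HOL-Complex_Analysis.Great_Picard" "HOL-Library.Diagonal_Subsequence"
begin

text \<open>
  Write \<open>k(u) = u powr (\<alpha> - 1)\<close> and let \<open>x\<close> be the solution that starts from a constant path
  \<open>x\<^sub>0\<close>, so that \<open>x(t) = x\<^sub>0 + 1/\<Gamma>(\<alpha>) \<integral> k(t - s) g(x(s)) ds\<close> over \<open>[0,t]\<close>. The whole theorem rests
  on two facts about such solutions. Bounded sets of initial values give bounded trajectories, and
  after a time that depends only on the bounded set the trajectories lie in one fixed ball.

  The equation has memory, so a Lyapunov function cannot simply be differentiated along solutions.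
  Its replacement is an averaging identity. For every \<open>h > 0\<close> there is an explicit probability
  density \<open>q\<close> on \<open>[0,\<infinity>)\<close> (\<open>prediction_density\<close>) such that, with \<open>W = t - h \<ge> 0\<close>,

    \<open>x(t) = (1 - Q) x\<^sub>0 + \<integral>\<^sub>0\<^sup>W q(W - \<tau>) x(\<tau>) d\<tau> + 1/\<Gamma>(\<alpha>) \<integral>\<^sub>W\<^sup>t k(t - s) g(x(s)) ds\<close>,

  where \<open>Q\<close> is the mass of \<open>q\<close> on \<open>[0,W]\<close>: the current value is an average of past values plus
  the drift of the last \<open>h\<close> units of time. It holds because \<open>q\<close> carries the kernel at distance
  \<open>w\<close> into the kernel at distance \<open>w + h\<close>, which is a Beta integral
  (\<open>prediction_density_kernel\<close>), and because the order of integration can be exchanged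
  (\<open>prediction_fubini\<close>). Pairing the identity with \<open>x(t)\<close> and using
  \<open>2 v \<bullet> w \<le> |v|\<^sup>2 + |w|\<^sup>2\<close> gives \<open>fractional_energy_inequality\<close>. It plays the role of
  \<open>(|x|\<^sup>2)' = 2 x \<bullet> g(x)\<close>: at a maximum of \<open>|x|\<close> the drift cannot point inward
  (\<open>inward_field_norm_bound\<close>), and since \<open>Q\<close> tends to \<open>1\<close> as \<open>t\<close> grows, the initial value and
  any early part of the history are forgotten (\<open>ultimate_bound\<close>).

  The maximum principle also gives global existence: the field is truncated outside a ball that
  traps the solution, the truncated equation is solved by Banach's fixed point theorem in an
  exponentially weighted norm, and its solution never feels the truncation.

  The rest is compactness. Convergence in the metric is locally uniform convergence
  (\<open>path_dist_tendsto_iff\<close>), and the paths that start in a ball and are Holder continuous with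
  exponent \<open>\<alpha>\<close> and a fixed constant form a compact set (\<open>compactin_holder_paths\<close>). The images of
  \<open>{id\<^sub>x\<^sub>0 : |x\<^sub>0| \<le> R}\<close> under all \<open>\<T>\<^sub>t\<close> lie in such a set (\<open>orbit_holder\<close>), so every
  sequence \<open>\<T>\<^sub>t\<^sub>n id\<^sub>x\<^sub>n\<close> with bounded \<open>x\<^sub>n\<close> and \<open>t\<^sub>n \<rightarrow> \<infinity>\<close> has a limit point in the attractor
  (\<open>orbit_subsequence\<close>); attraction follows by contradiction. Ultimate boundedness puts the whole
  attractor into one such compact set, with constants independent of the initial values
  (\<open>attractor_subset_holder_paths\<close>), which is precompactness. Invariance holds because
  \<open>\<T>\<^sub>t\<close> is continuous along sequences with uniformly bounded solutions (\<open>semiflow_limit\<close>), and to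
  find a preimage of a limit of \<open>\<T>\<^sub>t\<^sub>n id\<^sub>x\<^sub>n\<close> one takes a limit point of \<open>\<T>\<^sub>t\<^sub>n\<^sub>-\<^sub>t id\<^sub>x\<^sub>n\<close>.
  Minimality is immediate: the points of the attractor are limits of sequences that approach any
  attracting set, and therefore lie in it if it is closed.
\<close>

section \<open>The weakly singular kernel\<close>

text \<open>Dividing by \<open>x + y\<close> reduces the claim to \<open>z \<le> z powr \<alpha>\<close> on \<open>[0,1]\<close>.\<close>

lemma powr_subadditive:
  fixes x y \<alpha> :: real
  assumes "0 \<le> x" "0 \<le> y" "0 < \<alpha>" "\<alpha> \<le> 1"
  shows "(x + y) powr \<alpha> \<le> x powr \<alpha> + y powr \<alpha>"
proof (cases "x + y = 0")
  case False
  define s where "s = x + y"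
  have s: "s > 0" using False assms by (simp add: s_def)
  have le: "z / s \<le> (z / s) powr \<alpha>" if "0 \<le> z" "z \<le> s" for z
  proof (cases "z = 0")
    case False
    have "(z / s) powr 1 \<le> (z / s) powr \<alpha>"
      using that s False assms by (intro powr_mono') auto
    then show ?thesis using that s False by simp
  qed auto
  have "1 = x / s + y / s" using s by (simp add: s_def add_divide_distrib[symmetric])
  also have "\<dots> \<le> (x / s) powr \<alpha> + (y / s) powr \<alpha>"
    using le[of x] le[of y] assms by (simp add: s_def)
  also have "\<dots> = (x powr \<alpha> + y powr \<alpha>) / s powr \<alpha>"
    using assms s by (simp add: powr_divide add_divide_distrib)
  finally show ?thesis using s by (simp add: s_def field_simps)
qed (use assms in auto)

lemma kernel_has_integral:
  fixes \<alpha> c d t :: real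
  assumes "0 < \<alpha>" "c \<le> d" "d \<le> t"
  shows "((\<lambda>s. (t - s) powr (\<alpha> - 1)) has_integral ((t - c) powr \<alpha> - (t - d) powr \<alpha>) / \<alpha>) {c..d}"
proof -
  let ?F = "\<lambda>s. - ((t - s) powr \<alpha>) / \<alpha>"
  have "((\<lambda>s. (t - s) powr (\<alpha> - 1)) has_integral ?F d - ?F c) {c..d}"
  proof (rule fundamental_theorem_of_calculus_interior)
    show "continuous_on {c..d} ?F"
      using assms by (intro continuous_intros continuous_on_powr') auto
    show "(?F has_vector_derivative (t - s) powr (\<alpha> - 1)) (at s)" if "s \<in> {c<..<d}" for s
      unfolding has_real_derivative_iff_has_vector_derivative[symmetric]
      using that assms by (auto intro!: derivative_eq_intros simp: field_simps)
  qed (use assms in auto)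
  then show ?thesis by (simp add: diff_divide_distrib)
qed

lemma kernel_absolutely_integrable:
  fixes \<alpha> c d t :: real
  assumes "0 < \<alpha>" "d \<le> t"
  shows "(\<lambda>s. (t - s) powr (\<alpha> - 1)) absolutely_integrable_on {c..d}"
proof (cases "c \<le> d")
  case True
  then show ?thesis
    using kernel_has_integral[OF assms(1) True assms(2)]
    by (intro nonnegative_absolutely_integrable_1) (auto simp: integrable_on_def)
qed auto

lemma abs_integrable_scaleR_continuous:
  fixes y :: "real \<Rightarrow> 'b::euclidean_space"
  assumes "k absolutely_integrable_on {c..d}" "continuous_on {c..d} y"
  shows "(\<lambda>s. k s *\<^sub>R y s) absolutely_integrable_on {c..d}"
proof (rule absolutely_integrable_bounded_measurable_product[where h = "\<lambda>v k. k *\<^sub>R v"])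
  show "bilinear (\<lambda>(v::'b) (k::real). k *\<^sub>R v)"
    by (auto simp: bilinear_def linear_iff algebra_simps)
  show "bounded (y ` {c..d})"
    using assms by (intro compact_imp_bounded compact_continuous_image) auto
  show "y \<in> borel_measurable (lebesgue_on {c..d})"
    using assms by (intro continuous_imp_measurable_on_sets_lebesgue) auto
qed (use assms in auto)

lemma kernel_scaleR_absolutely_integrable:
  fixes y :: "real \<Rightarrow> 'b::euclidean_space"
  assumes "0 < \<alpha>" "d \<le> t" "continuous_on {c..d} y"
  shows "(\<lambda>s. ((t - s) powr (\<alpha> - 1)) *\<^sub>R y s) absolutely_integrable_on {c..d}"
  by (intro abs_integrable_scaleR_continuous kernel_absolutely_integrable assms)

lemmas kernel_scaleR_integrable =
  set_lebesgue_integral_eq_integral(1)[OF kernel_scaleR_absolutely_integrable]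

text \<open>With \<open>c = 0\<close> and \<open>d = t\<close> this is the Riemann--Liouville integral of order \<open>\<alpha>\<close> up to the factor
  \<open>1/\<Gamma>(\<alpha>)\<close>. The evaluation time \<open>t\<close> is kept apart from the end \<open>d\<close> of the integration interval
  because the semiflow evaluates at later times the kernel integral over a past interval.\<close>

abbreviation kernel_integral ::
  "real \<Rightarrow> real \<Rightarrow> real \<Rightarrow> (real \<Rightarrow> 'b::euclidean_space) \<Rightarrow> real \<Rightarrow> 'b" where
  "kernel_integral \<alpha> c d y t \<equiv> integral {c..d} (\<lambda>s. ((t - s) powr (\<alpha> - 1)) *\<^sub>R y s)"

lemma kernel_integral_bound:
  fixes y :: "real \<Rightarrow> 'b::euclidean_space"
  assumes "0 < \<alpha>" "c \<le> d" "d \<le> t" "continuous_on {c..d} y"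
    and "\<And>s. s \<in> {c..d} \<Longrightarrow> norm (y s) \<le> G"
  shows "norm (kernel_integral \<alpha> c d y t)
           \<le> G * (((t - c) powr \<alpha> - (t - d) powr \<alpha>) / \<alpha>)"
proof -
  have I: "((\<lambda>s. G * (t - s) powr (\<alpha> - 1)) has_integral
      G * (((t - c) powr \<alpha> - (t - d) powr \<alpha>) / \<alpha>)) {c..d}"
    by (intro has_integral_mult_right kernel_has_integral assms)
  have "norm (kernel_integral \<alpha> c d y t)
      \<le> integral {c..d} (\<lambda>s. G * (t - s) powr (\<alpha> - 1))"
  proof (rule integral_norm_bound_integral)
    show "(\<lambda>s. ((t - s) powr (\<alpha> - 1)) *\<^sub>R y s) integrable_on {c..d}"
      by (rule kernel_scaleR_integrable[OF assms(1,3,4)])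
    show "(\<lambda>s. G * (t - s) powr (\<alpha> - 1)) integrable_on {c..d}" using I by (auto simp: integrable_on_def)
    show "norm (((t - s) powr (\<alpha> - 1)) *\<^sub>R y s) \<le> G * (t - s) powr (\<alpha> - 1)" if "s \<in> {c..d}" for s
      using assms(5)[OF that] by (simp add: mult.commute[of "norm _"] mult.commute[of G] mult_left_mono)
  qed
  then show ?thesis using integral_unique[OF I] by simp
qed

lemma powr_diff_le:
  fixes x y \<alpha> :: real
  assumes "0 \<le> x" "x \<le> y" "0 < \<alpha>" "\<alpha> \<le> 1"
  shows "y powr \<alpha> - x powr \<alpha> \<le> (y - x) powr \<alpha>"
  using powr_subadditive[of "y - x" x \<alpha>] assms by simp

text \<open>The kernel decreases in \<open>t\<close>, so the increment is at most \<open>G\<close> times the decrease of the integral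
  of the kernel, and that integral is a difference of powers to which subadditivity of
  \<open>u powr \<alpha>\<close> applies. The bound does not depend on the length of the interval \<open>[c,d]\<close>; this is why
  the paths \<open>\<T>\<^sub>t f\<close> are equicontinuous uniformly in \<open>t\<close>.\<close>

lemma kernel_increment_bound:
  fixes y :: "real \<Rightarrow> 'b::euclidean_space"
  assumes "0 < \<alpha>" "\<alpha> < 1" "c \<le> d" "d \<le> t" "t \<le> t'" "continuous_on {c..d} y"
    and "\<And>s. s \<in> {c..d} \<Longrightarrow> norm (y s) \<le> G"
  shows "norm (kernel_integral \<alpha> c d y t'
             - kernel_integral \<alpha> c d y t) \<le> G * ((t' - t) powr \<alpha> / \<alpha>)"
proof -
  have G: "0 \<le> G" using order_trans[OF norm_ge_zero assms(7)[of c]] assms(3) by simp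
  let ?K = "\<lambda>t s. (t - s) powr (\<alpha> - 1)"
  let ?I = "((t - c) powr \<alpha> - (t - d) powr \<alpha>) / \<alpha> - ((t' - c) powr \<alpha> - (t' - d) powr \<alpha>) / \<alpha>"
  have i: "(\<lambda>s. ?K t' s *\<^sub>R y s) integrable_on {c..d}" "(\<lambda>s. ?K t s *\<^sub>R y s) integrable_on {c..d}"
    using assms by (auto intro!: kernel_scaleR_integrable)
  have I0: "((\<lambda>s. G * (?K t s - ?K t' s)) has_integral G * ?I) {c..d}"
    using assms by (intro has_integral_mult_right has_integral_diff kernel_has_integral) auto
  \<comment> \<open>At \<open>s = d = t\<close> the kernel has the default value \<open>0 powr _ = 0\<close>, which breaks its
     monotonicity in \<open>t\<close>, so the dominating function is changed at that one point.\<close>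
  define \<phi> where "\<phi> s = (if s = d then G * (?K t s + ?K t' s) else G * (?K t s - ?K t' s))" for s
  have I: "(\<phi> has_integral G * ?I) {c..d}"
    by (rule has_integral_spike[OF _ _ I0, of "{d}"]) (auto simp: \<phi>_def)
  have "norm (integral {c..d} (\<lambda>s. ?K t' s *\<^sub>R y s - ?K t s *\<^sub>R y s)) \<le> integral {c..d} \<phi>"
  proof (rule integral_norm_bound_integral)
    show "\<phi> integrable_on {c..d}" using I by (auto simp: integrable_on_def)
    show "(\<lambda>s. ?K t' s *\<^sub>R y s - ?K t s *\<^sub>R y s) integrable_on {c..d}"
      using i by (rule integrable_diff)
    fix s assume s: "s \<in> {c..d}"
    have "norm ((?K t' s - ?K t s) *\<^sub>R y s) \<le> \<bar>?K t' s - ?K t s\<bar> * G"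
      using assms(7)[OF s] by (simp add: mult_left_mono)
    also have "\<dots> \<le> \<phi> s"
    proof (cases "s = d")
      case True
      have "\<bar>?K t' s - ?K t s\<bar> \<le> ?K t s + ?K t' s" by (rule abs_leI) auto
      then show ?thesis using True G by (simp add: \<phi>_def mult.commute[of _ G] mult_left_mono)
    next
      case False
      then have "?K t' s \<le> ?K t s" using s assms by (intro powr_mono2') auto
      then show ?thesis using False by (simp add: \<phi>_def mult.commute)
    qed
    finally show "norm (?K t' s *\<^sub>R y s - ?K t s *\<^sub>R y s) \<le> \<phi> s"
      by (simp add: scaleR_left_diff_distrib)
  qed
  also have "\<dots> = G * ?I" using I by (rule integral_unique)
  also have "\<dots> \<le> G * ((t' - t) powr \<alpha> / \<alpha>)"
  proof (intro mult_left_mono G)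
    have "(t' - d) powr \<alpha> - (t - d) powr \<alpha> \<le> (t' - t) powr \<alpha>"
      using powr_diff_le[of "t - d" "t' - d" \<alpha>] assms by simp
    moreover have "(t - c) powr \<alpha> \<le> (t' - c) powr \<alpha>"
      using assms by (intro powr_mono2) auto
    ultimately have "(t - c) powr \<alpha> - (t - d) powr \<alpha> - ((t' - c) powr \<alpha> - (t' - d) powr \<alpha>)
        \<le> (t' - t) powr \<alpha>" by linarith
    then show "?I \<le> (t' - t) powr \<alpha> / \<alpha>"
      using assms by (simp add: diff_divide_distrib[symmetric] divide_right_mono)
  qed
  finally show ?thesis using i by (simp add: integral_diff)
qed

text \<open>The increment splits into the change of the kernel on the old interval and the contribution of
  the new interval; each costs \<open>G (t' - t) powr \<alpha> / \<alpha>\<close>.\<close>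

lemma fractional_integral_holder:
  fixes y :: "real \<Rightarrow> 'b::euclidean_space"
  assumes "0 < \<alpha>" "\<alpha> < 1" "0 \<le> t" "t \<le> t'" "continuous_on {0..t'} y"
    and "\<And>s. s \<in> {0..t'} \<Longrightarrow> norm (y s) \<le> G"
  shows "norm (kernel_integral \<alpha> 0 t' y t'
             - kernel_integral \<alpha> 0 t y t) \<le> 2 * G * ((t' - t) powr \<alpha> / \<alpha>)"
proof -
  let ?J = "\<lambda>c d t. kernel_integral \<alpha> c d y t"
  have split: "?J 0 t' t' = ?J 0 t t' + ?J t t' t'"
    using assms by (intro Henstock_Kurzweil_Integration.integral_combine[symmetric] kernel_scaleR_integrable) auto
  have "norm (?J 0 t t' - ?J 0 t t) \<le> G * ((t' - t) powr \<alpha> / \<alpha>)"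
    using assms by (intro kernel_increment_bound) (auto intro: continuous_on_subset)
  moreover have "norm (?J t t' t') \<le> G * ((t' - t) powr \<alpha> / \<alpha>)"
    using kernel_integral_bound[of \<alpha> t t' t' y G] continuous_on_subset[OF assms(5), of "{t..t'}"] assms
    by auto
  ultimately show ?thesis unfolding split
    using norm_triangle_ineq[of "?J 0 t t' - ?J 0 t t" "?J t t' t'"]
    by (simp add: add_diff_eq diff_add_eq)
qed

lemma kernel_integral_diff:
  fixes y z :: "real \<Rightarrow> 'b::euclidean_space"
  assumes "0 < \<alpha>" "d \<le> t" "continuous_on {c..d} y" "continuous_on {c..d} z"
  shows "kernel_integral \<alpha> c d y t - kernel_integral \<alpha> c d z t = kernel_integral \<alpha> c d (\<lambda>s. y s - z s) t"
  using assms by (simp add: scaleR_diff_right integral_diff kernel_scaleR_integrable)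

lemma kernel_integral_shift:
  fixes y :: "real \<Rightarrow> 'b::euclidean_space"
  shows "kernel_integral \<alpha> c d (\<lambda>s. y (r + s)) t = kernel_integral \<alpha> (r + c) (r + d) y (r + t)"
  using integral_shift_Icc_real[of c d "\<lambda>s. ((r + t - s) powr (\<alpha> - 1)) *\<^sub>R y s" r]
  by (simp add: o_def add.commute[of _ r])

text \<open>The mass of the kernel on \<open>[c,d]\<close> is bounded uniformly in the evaluation time, so uniform
  convergence of the integrands passes to the kernel integrals uniformly in \<open>t \<ge> d\<close>.\<close>

lemma kernel_integral_uniform_limit:
  fixes y :: "real \<Rightarrow> 'b::euclidean_space"
  assumes \<alpha>: "0 < \<alpha>" "\<alpha> < 1" and "c \<le> d"
    and cont: "\<And>n. continuous_on {c..d} (Y n)"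
    and lim: "uniform_limit {c..d} Y y sequentially"
  shows "uniform_limit {d..} (\<lambda>n. kernel_integral \<alpha> c d (Y n)) (kernel_integral \<alpha> c d y) sequentially"
proof (rule uniform_limitI)
  fix e :: real assume e: "0 < e"
  have y: "continuous_on {c..d} y"
    using cont by (intro uniform_limit_theorem[OF _ lim]) (auto intro: always_eventually)
  define m where "m = (d - c) powr \<alpha> / \<alpha>"
  have m: "0 \<le> m" using \<alpha> by (simp add: m_def)
  have "\<forall>\<^sub>F n in sequentially. \<forall>s\<in>{c..d}. dist (Y n s) (y s) < e / (m + 1)"
    using e m by (intro uniform_limitD[OF lim]) auto
  then show "\<forall>\<^sub>F n in sequentially. \<forall>t\<in>{d..}.
      dist (kernel_integral \<alpha> c d (Y n) t) (kernel_integral \<alpha> c d y t) < e"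
  proof eventually_elim
    case (elim n)
    show ?case
    proof
      fix t assume "t \<in> {d..}"
      then have t: "d \<le> t" by simp
      have "norm (kernel_integral \<alpha> c d (\<lambda>s. Y n s - y s) t)
          \<le> e / (m + 1) * (((t - c) powr \<alpha> - (t - d) powr \<alpha>) / \<alpha>)"
        using elim t assms y by (intro kernel_integral_bound continuous_intros) (auto simp: dist_norm less_imp_le)
      also have "\<dots> \<le> e / (m + 1) * m"
        using e m t assms powr_diff_le[of "t - d" "t - c" \<alpha>] unfolding m_def
        by (intro mult_left_mono divide_right_mono) auto
      also have "\<dots> < e" using e m by (simp add: field_simps)
      finally show "dist (kernel_integral \<alpha> c d (Y n) t) (kernel_integral \<alpha> c d y t) < e"
        using kernel_integral_diff[OF \<alpha>(1) t cont y] by (simp add: dist_norm)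
    qed
  qed
qed

lemma holder_imp_continuous_on:
  fixes z :: "real \<Rightarrow> 'b::real_normed_vector"
  assumes "0 < \<alpha>" and h: "\<And>s t. s \<in> A \<Longrightarrow> t \<in> A \<Longrightarrow> s \<le> t \<Longrightarrow> norm (z t - z s) \<le> C * (t - s) powr \<alpha>"
  shows "continuous_on A z"
  unfolding continuous_on_def
proof
  fix t assume t: "t \<in> A"
  have b: "norm (z s - z t) \<le> C * \<bar>s - t\<bar> powr \<alpha>" if "s \<in> A" for s
  proof (cases "s \<le> t")
    case True
    then show ?thesis using h[OF that t] by (simp add: norm_minus_commute abs_minus_commute)
  qed (use h[OF t that] in auto)
  have "((\<lambda>s. C * \<bar>s - t\<bar> powr \<alpha>) \<longlongrightarrow> C * \<bar>t - t\<bar> powr \<alpha>) (at t within A)"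
    using assms by (intro tendsto_intros tendsto_powr') auto
  then have "((\<lambda>s. C * \<bar>s - t\<bar> powr \<alpha>) \<longlongrightarrow> 0) (at t within A)" using assms by simp
  then have "((\<lambda>s. z s - z t) \<longlongrightarrow> 0) (at t within A)"
    by (rule Lim_null_comparison[rotated]) (auto simp: eventually_at_filter b)
  then show "(z \<longlongrightarrow> z t) (at t within A)" by (simp add: LIM_zero_iff)
qed

lemma kernel_integral_le:
  fixes f :: "real \<Rightarrow> real"
  assumes "0 < \<alpha>" "c \<le> t" "continuous_on {c..t} f" "\<And>s. s \<in> {c..t} \<Longrightarrow> f s \<le> m"
  shows "integral {c..t} (\<lambda>s. (t - s) powr (\<alpha> - 1) * f s) \<le> m * ((t - c) powr \<alpha> / \<alpha>)"
proof -
  have I1: "((\<lambda>s. (t - s) powr (\<alpha> - 1) * m) has_integral ((t - c) powr \<alpha> - (t - t) powr \<alpha>) / \<alpha> * m) {c..t}"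
    by (intro has_integral_mult_left kernel_has_integral assms order_refl)
  have I2: "((\<lambda>s. (t - s) powr (\<alpha> - 1) * f s) has_integral
      integral {c..t} (\<lambda>s. (t - s) powr (\<alpha> - 1) * f s)) {c..t}"
    using kernel_scaleR_integrable[OF assms(1) order_refl assms(3)] by (simp add: integrable_integral)
  have "integral {c..t} (\<lambda>s. (t - s) powr (\<alpha> - 1) * f s)
      \<le> ((t - c) powr \<alpha> - (t - t) powr \<alpha>) / \<alpha> * m"
    by (rule has_integral_le[OF I2 I1]) (rule mult_left_mono[OF assms(4)], simp_all)
  then show ?thesis using assms by (simp add: mult.commute)
qed

lemma kernel_integral_continuous:
  fixes y :: "real \<Rightarrow> 'b::euclidean_space"
  assumes \<alpha>: "0 < \<alpha>" "\<alpha> < 1" and y: "continuous_on {0..T} y"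
  shows "continuous_on {0..T} (\<lambda>t. kernel_integral \<alpha> 0 t y t)"
proof -
  obtain G where "\<forall>v\<in>y ` {0..T}. norm v \<le> G"
    using compact_imp_bounded[OF compact_continuous_image[OF y compact_Icc]] unfolding bounded_iff by blast
  then have G: "\<And>s. s \<in> {0..T} \<Longrightarrow> norm (y s) \<le> G" by blast
  show ?thesis
  proof (rule holder_imp_continuous_on[OF \<alpha>(1), where C = "2 * G / \<alpha>"])
    fix s t :: real assume st: "s \<in> {0..T}" "t \<in> {0..T}" "s \<le> t"
    have "norm (kernel_integral \<alpha> 0 t y t - kernel_integral \<alpha> 0 s y s) \<le> 2 * G * ((t - s) powr \<alpha> / \<alpha>)"
      using st by (intro fractional_integral_holder \<alpha> continuous_on_subset[OF y] G) auto
    then show "norm (kernel_integral \<alpha> 0 t y t - kernel_integral \<alpha> 0 s y s) \<le> 2 * G / \<alpha> * (t - s) powr \<alpha>"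
      by simp
  qed
qed

section \<open>A singular Gronwall inequality\<close>

text \<open>Substituting \<open>u = l (t - s)\<close> turns the integral into a part of the Gamma integral. The bound
  tends to \<open>0\<close> as \<open>l\<close> grows, uniformly in \<open>t\<close>, which makes an exponentially weighted norm useful for
  singular kernels.\<close>

lemma exp_kernel_bound:
  fixes \<alpha> l t :: real
  assumes "0 < \<alpha>" "0 < l" "0 \<le> t"
  shows "(\<lambda>s. (t - s) powr (\<alpha> - 1) * exp (- l * (t - s))) integrable_on {0..t}"
    and "integral {0..t} (\<lambda>s. (t - s) powr (\<alpha> - 1) * exp (- l * (t - s))) \<le> Gamma \<alpha> / l powr \<alpha>"
proof -
  let ?f = "\<lambda>u::real. u powr (\<alpha> - 1) / exp u"
  let ?h = "\<lambda>s. (t - s) powr (\<alpha> - 1) * exp (- l * (t - s))"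
  have G: "(?f has_integral Gamma \<alpha>) {0..}"
    by (rule Gamma_integral_real[OF assms(1)])
  have fi: "?f integrable_on {0..l * t}"
    using G absolutely_integrable_on_subinterval nonnegative_absolutely_integrable_1
    by (intro integrable_on_subinterval[of ?f "{0..}"]) (auto simp: integrable_on_def)
  have le: "integral {0..l * t} ?f \<le> Gamma \<alpha>"
    unfolding integral_unique[OF G, symmetric]
    using G fi by (intro integral_subset_le) (auto simp: integrable_on_def)
  have "((\<lambda>s. ?f (- l *\<^sub>R s + l * t)) has_integral (1 / \<bar>- l\<bar> ^ DIM(real)) *\<^sub>R integral {0..l * t} ?f)
     ((\<lambda>x. (1 / - l) *\<^sub>R x + - ((1 / - l) *\<^sub>R (l * t))) ` cbox 0 (l * t))"
    using assms fi by (intro has_integral_affinity) (auto intro: integrable_integral)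
  also have "(\<lambda>x. (1 / - l) *\<^sub>R x + - ((1 / - l) *\<^sub>R (l * t))) ` cbox 0 (l * t) = {0..t}"
    using assms image_affinity_atLeastAtMost[of "1 / - l" t 0 "l * t"] by simp
  finally have I1: "((\<lambda>s. ?f (- l * s + l * t)) has_integral (1 / l) * integral {0..l * t} ?f) {0..t}"
    using assms by simp
  have eq: "?f (- l * s + l * t) = l powr (\<alpha> - 1) * ?h s" if "s \<in> {0..t}" for s
  proof -
    have "- l * s + l * t = l * (t - s)" by (simp add: algebra_simps)
    then show ?thesis using assms that
      unfolding minus_mult_left[symmetric] exp_minus by (simp add: powr_mult divide_inverse)
  qed
  have "((\<lambda>s. l powr (\<alpha> - 1) * ?h s) has_integral (1 / l) * integral {0..l * t} ?f) {0..t}"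
    using I1 eq by (rule has_integral_eq[rotated]) 
  then have "((\<lambda>s. l powr (1 - \<alpha>) * (l powr (\<alpha> - 1) * ?h s)) has_integral
      l powr (1 - \<alpha>) * ((1 / l) * integral {0..l * t} ?f)) {0..t}"
    by (rule has_integral_mult_right)
  also have "(\<lambda>s. l powr (1 - \<alpha>) * (l powr (\<alpha> - 1) * ?h s)) = ?h"
    using assms by (auto simp: mult.assoc[symmetric] powr_add[symmetric])
  also have "l powr (1 - \<alpha>) * ((1 / l) * integral {0..l * t} ?f) = integral {0..l * t} ?f / l powr \<alpha>"
    using assms by (simp add: powr_diff)
  finally have I: "(?h has_integral integral {0..l * t} ?f / l powr \<alpha>) {0..t}" .
  show "?h integrable_on {0..t}" using I by (auto simp: integrable_on_def)
  show "integral {0..t} ?h \<le> Gamma \<alpha> / l powr \<alpha>"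
    unfolding integral_unique[OF I] using le assms by (intro divide_right_mono) auto
qed

lemma weighted_kernel_bound:
  fixes u :: "real \<Rightarrow> 'b::euclidean_space"
  assumes \<alpha>: "0 < \<alpha>" and l: "0 < l" and t: "0 \<le> t" and u: "continuous_on {0..t} u"
    and D: "\<And>s. s \<in> {0..t} \<Longrightarrow> norm (u s) \<le> D * exp (l * s)"
  shows "exp (- l * t) * norm (kernel_integral \<alpha> 0 t u t) \<le> D * (Gamma \<alpha> / l powr \<alpha>)"
proof -
  let ?e = "\<lambda>s. (t - s) powr (\<alpha> - 1) * exp (- l * (t - s))"
  have D0: "0 \<le> D" using order_trans[OF norm_ge_zero D[of 0]] t by simp
  note ek = exp_kernel_bound[OF \<alpha> l t]
  have "norm (kernel_integral \<alpha> 0 t u t) \<le> integral {0..t} (\<lambda>s. (D * exp (l * t)) * ?e s)"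
  proof (rule integral_norm_bound_integral)
    show "(\<lambda>s. ((t - s) powr (\<alpha> - 1)) *\<^sub>R u s) integrable_on {0..t}"
      by (rule kernel_scaleR_integrable[OF \<alpha> order_refl u])
    show "(\<lambda>s. (D * exp (l * t)) * ?e s) integrable_on {0..t}"
      by (rule integrable_on_mult_right[OF ek(1)])
    fix s assume s: "s \<in> {0..t}"
    have "norm (((t - s) powr (\<alpha> - 1)) *\<^sub>R u s) \<le> (t - s) powr (\<alpha> - 1) * (D * exp (l * s))"
      using D[OF s] by (simp add: mult_left_mono)
    also have "exp (l * s) = exp (l * t) * exp (- l * (t - s))"
      by (simp add: exp_add[symmetric] algebra_simps)
    finally show "norm (((t - s) powr (\<alpha> - 1)) *\<^sub>R u s) \<le> (D * exp (l * t)) * ?e s" by (simp add: mult_ac)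
  qed
  also have "\<dots> = (D * exp (l * t)) * integral {0..t} ?e" by (rule integral_mult_right)
  also have "\<dots> \<le> (D * exp (l * t)) * (Gamma \<alpha> / l powr \<alpha>)"
    using D0 by (intro mult_left_mono ek) auto
  finally have "exp (- l * t) * norm (kernel_integral \<alpha> 0 t u t)
      \<le> exp (- l * t) * ((D * exp (l * t)) * (Gamma \<alpha> / l powr \<alpha>))"
    by (rule mult_left_mono) simp
  also have "\<dots> = (exp (- l * t) * exp (l * t)) * (D * (Gamma \<alpha> / l powr \<alpha>))" by (simp only: mult_ac)
  also have "exp (- l * t) * exp (l * t) = 1" by (simp add: exp_add[symmetric])
  finally show ?thesis by simp
qed

text \<open>At the maximum point of \<open>exp (- l t) u(t)\<close> the kernel term is at most half of that maximum once
  \<open>l\<close> is large enough, and can be absorbed into the left side. The constant \<open>K\<close> serves all \<open>u\<close> and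
  \<open>\<epsilon>\<close> simultaneously, as is needed for uniqueness and for Cauchy estimates.\<close>

lemma singular_gronwall:
  fixes C \<alpha> T :: real
  assumes \<alpha>: "0 < \<alpha>" and C: "0 \<le> C"
  shows "\<exists>K\<ge>0. \<forall>u \<epsilon>. continuous_on {0..T} u \<and> 0 \<le> \<epsilon> \<and>
      (\<forall>t\<in>{0..T}. 0 \<le> u t \<and> u t \<le> \<epsilon> + C * integral {0..t} (\<lambda>s. (t - s) powr (\<alpha> - 1) * u s))
      \<longrightarrow> (\<forall>t\<in>{0..T}. u t \<le> K * \<epsilon>)"
proof -
  \<comment> \<open>This rate makes \<open>C \<Gamma>(\<alpha>) / l powr \<alpha>\<close> at most \<open>1/2\<close>.\<close>
  define l where "l = (2 * C * Gamma \<alpha> + 1) powr (1 / \<alpha>)"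
  have G: "0 < Gamma \<alpha>" using \<alpha> by simp
  have CG: "0 \<le> C * Gamma \<alpha>" using C G by simp
  have l: "0 < l" using CG by (simp add: l_def)
  have "l powr \<alpha> = 2 * C * Gamma \<alpha> + 1" using \<alpha> CG by (simp add: l_def powr_powr)
  then have small: "C * (Gamma \<alpha> / l powr \<alpha>) \<le> 1 / 2" using CG by (simp add: field_simps)
  have "u t \<le> 2 * exp (l * T) * \<epsilon>"
    if u: "continuous_on {0..T} u" and \<epsilon>: "0 \<le> \<epsilon>" and t: "t \<in> {0..T}"
      and ineq: "\<And>t. t \<in> {0..T} \<Longrightarrow>
        0 \<le> u t \<and> u t \<le> \<epsilon> + C * integral {0..t} (\<lambda>s. (t - s) powr (\<alpha> - 1) * u s)"
    for u :: "real \<Rightarrow> real" and \<epsilon> t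
  proof -
    have "\<exists>t\<^sub>0\<in>{0..T}. \<forall>s\<in>{0..T}. exp (- l * s) * u s \<le> exp (- l * t\<^sub>0) * u t\<^sub>0"
      using t u by (intro continuous_attains_sup continuous_intros) auto
    then obtain t\<^sub>0 where t0: "t\<^sub>0 \<in> {0..T}"
      and max: "\<And>s. s \<in> {0..T} \<Longrightarrow> exp (- l * s) * u s \<le> exp (- l * t\<^sub>0) * u t\<^sub>0" by blast
    define m where "m = exp (- l * t\<^sub>0) * u t\<^sub>0"
    have m0: "0 \<le> m" using ineq[OF t0] by (simp add: m_def)
    have le: "u s \<le> m * exp (l * s)" if "s \<in> {0..T}" for s
      using max[OF that] by (simp add: m_def exp_minus field_simps)
    have t0': "0 \<le> t\<^sub>0" using t0 by simp
    have ut0: "continuous_on {0..t\<^sub>0} u" by (rule continuous_on_subset[OF u]) (use t0 in auto)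
    let ?I = "integral {0..t\<^sub>0} (\<lambda>s. (t\<^sub>0 - s) powr (\<alpha> - 1) * u s)"
    have ubound: "norm (u s) \<le> m * exp (l * s)" if "s \<in> {0..t\<^sub>0}" for s
      using le[of s] ineq[of s] that t0 by simp
    have "exp (- l * t\<^sub>0) * ?I \<le> exp (- l * t\<^sub>0) * norm ?I" by (intro mult_left_mono) auto
    also have "\<dots> \<le> m * (Gamma \<alpha> / l powr \<alpha>)"
      using weighted_kernel_bound[OF \<alpha> l t0' ut0 ubound] by simp
    finally have "C * (exp (- l * t\<^sub>0) * ?I) \<le> C * (m * (Gamma \<alpha> / l powr \<alpha>))"
      using C by (intro mult_left_mono)
    also have "\<dots> = m * (C * (Gamma \<alpha> / l powr \<alpha>))" by simp
    also have "\<dots> \<le> m * (1 / 2)" using m0 by (intro mult_left_mono small)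
    finally have 1: "C * (exp (- l * t\<^sub>0) * ?I) \<le> m / 2" by simp
    have "m \<le> exp (- l * t\<^sub>0) * (\<epsilon> + C * ?I)"
      unfolding m_def using ineq[OF t0] by (intro mult_left_mono) auto
    also have "\<dots> = exp (- l * t\<^sub>0) * \<epsilon> + C * (exp (- l * t\<^sub>0) * ?I)" by (simp add: algebra_simps)
    also have "\<dots> \<le> 1 * \<epsilon> + m / 2" using \<epsilon> l t0' 1 by (intro add_mono mult_right_mono) auto
    finally have "m \<le> 2 * \<epsilon>" by simp
    have "u t \<le> m * exp (l * t)" by (rule le[OF t])
    also have "\<dots> \<le> 2 * \<epsilon> * exp (l * t)" using \<open>m \<le> 2 * \<epsilon>\<close> by (intro mult_right_mono) auto
    also have "\<dots> \<le> 2 * \<epsilon> * exp (l * T)" using t l \<epsilon> by (intro mult_left_mono) auto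
    finally show "u t \<le> 2 * exp (l * T) * \<epsilon>" by (simp add: mult_ac)
  qed
  then show ?thesis by (intro exI[of _ "2 * exp (l * T)"]) auto
qed

section \<open>Locally uniform convergence and compactness in the path space\<close>

lemma continuous_on_halflineI:
  fixes f :: "real \<Rightarrow> 'b::topological_space"
  assumes "\<And>T. continuous_on {0..T} f"
  shows "continuous_on {0..} f"
  unfolding continuous_on_eq_continuous_within
proof
  fix t :: real assume t: "t \<in> {0..}"
  have "continuous (at t within {0..t + 1}) f"
    using assms[of "t + 1"] t by (simp add: continuous_on_eq_continuous_within)
  moreover have "at t within {0..t + 1} = at t within {0..}"
    by (rule at_within_nhd[of t "{..<t + 1}"]) auto
  ultimately show "continuous (at t within {0..}) f" by simp
qed

lemma sup_dist_mono:
  assumes "f \<in> path_space" "h \<in> path_space" "0 \<le> S" "S \<le> T"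
  shows "sup_dist S f h \<le> sup_dist T f h"
  unfolding sup_dist_def[of S] using assms by (intro cSUP_least sup_dist_upper) auto

lemma sup_dist_le:
  assumes "0 \<le> T" "\<And>\<theta>. 0 \<le> \<theta> \<Longrightarrow> \<theta> \<le> T \<Longrightarrow> norm (f \<theta> - h \<theta>) \<le> e"
  shows "sup_dist T f h \<le> e"
  unfolding sup_dist_def using assms by (intro cSUP_least) auto

lemma path_dist_term_le:
  assumes "f \<in> path_space" "h \<in> path_space"
  shows "path_dist_term f h n \<le> (1 / 2) ^ Suc n"
    and "path_dist_term f h n \<le> (1 / 2) ^ Suc n * sup_dist (real (Suc n)) f h"
proof -
  let ?s = "sup_dist (real (Suc n)) f h"
  have s: "0 \<le> ?s" using sup_dist_nonneg[OF assms, of "real (Suc n)"] by simp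
  then have "?s / (1 + ?s) \<le> 1" "?s / (1 + ?s) \<le> ?s" by (auto simp: field_simps)
  then have "1 / 2 ^ Suc n * (?s / (1 + ?s)) \<le> 1 / 2 ^ Suc n * 1"
    "1 / 2 ^ Suc n * (?s / (1 + ?s)) \<le> 1 / 2 ^ Suc n * ?s"
    by (intro mult_left_mono; simp)+
  then show "path_dist_term f h n \<le> (1 / 2) ^ Suc n"
     "path_dist_term f h n \<le> (1 / 2) ^ Suc n * ?s"
    unfolding path_dist_term_def by (simp_all only: power_one_over mult_1_right)
qed

lemma half_powers_sum: "(\<lambda>n. (1 / 2 :: real) ^ Suc (n + K)) sums (1 / 2) ^ K"
proof -
  have "(\<lambda>n. (1 / 2 :: real) ^ Suc K * (1 / 2) ^ n) sums ((1 / 2) ^ Suc K * (1 / (1 - 1 / 2)))"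
    by (intro sums_mult geometric_sums) auto
  then show ?thesis by (simp add: power_add mult.commute mult.left_commute)
qed

text \<open>The first \<open>K\<close> terms of the series sum to at most the supremum over \<open>[0,K]\<close>, which also bounds
  the distance at \<open>0\<close>; the remaining terms sum to at most \<open>(1/2)^K\<close>.\<close>

lemma path_dist_le:
  assumes "f \<in> path_space" "h \<in> path_space"
  shows "path_dist f h \<le> 2 * sup_dist (real K) f h + (1 / 2) ^ K"
proof -
  let ?S = "sup_dist (real K) f h"
  have S: "0 \<le> ?S" by (intro sup_dist_nonneg assms) simp
  have "(\<Sum>n. path_dist_term f h n) = (\<Sum>n. path_dist_term f h (n + K)) + (\<Sum>n<K. path_dist_term f h n)"
    by (intro suminf_split_initial_segment path_dist_term_summable assms)
  moreover have "(\<Sum>n. path_dist_term f h (n + K)) \<le> (\<Sum>n. (1 / 2) ^ Suc (n + K))"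
    using path_dist_term_summable[OF assms] half_powers_sum[of K]
    by (intro suminf_le path_dist_term_le assms) (auto simp: sums_iff summable_iff_shift)
  moreover have "(\<Sum>n. (1 / 2 :: real) ^ Suc (n + K)) = (1 / 2) ^ K"
    using half_powers_sum[of K] by (simp add: sums_iff)
  moreover have "(\<Sum>n<K. path_dist_term f h n) \<le> (\<Sum>n<K. (1 / 2) ^ Suc n * ?S)"
  proof (rule sum_mono)
    fix n assume "n \<in> {..<K}"
    then have "sup_dist (real (Suc n)) f h \<le> ?S" by (intro sup_dist_mono assms) auto
    then have "(1 / 2) ^ Suc n * sup_dist (real (Suc n)) f h \<le> (1 / 2) ^ Suc n * ?S"
      by (intro mult_left_mono) auto
    then show "path_dist_term f h n \<le> (1 / 2) ^ Suc n * ?S"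
      using path_dist_term_le(2)[OF assms, of n] by linarith
  qed
  moreover have "(\<Sum>n<K. (1 / 2) ^ Suc n * ?S) \<le> ?S"
  proof -
    have "(\<Sum>n<K. (1 / 2 :: real) ^ Suc n) \<le> (\<Sum>n. (1 / 2) ^ Suc n)"
      using half_powers_sum[of 0] by (intro sum_le_suminf) (auto simp: sums_iff)
    also have "\<dots> = 1" using half_powers_sum[of 0] by (simp add: sums_iff)
    finally have "(\<Sum>n<K. (1 / 2 :: real) ^ Suc n) * ?S \<le> 1 * ?S"
      by (rule mult_right_mono) (rule S)
    then show ?thesis by (simp only: sum_distrib_right mult_1_left)
  qed
  moreover have "norm (f 0 - h 0) \<le> ?S" by (intro sup_dist_upper assms) auto
  ultimately show ?thesis unfolding path_dist_alt[OF assms] by linarith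
qed

lemma sup_dist_less_if_path_dist_small:
  assumes "f \<in> path_space" "h \<in> path_space" "0 < e"
    and "path_dist f h < (1 / 2) ^ Suc n * (e / (1 + e))"
  shows "sup_dist (real (Suc n)) f h < e"
proof (rule ccontr)
  let ?s = "sup_dist (real (Suc n)) f h"
  assume "\<not> ?s < e"
  then have "e / (1 + e) \<le> ?s / (1 + ?s)" using assms by (intro frac_mono) auto
  then have "1 / 2 ^ Suc n * (e / (1 + e)) \<le> path_dist_term f h n"
    unfolding path_dist_term_def by (intro mult_left_mono) auto
  then have 1: "(1 / 2) ^ Suc n * (e / (1 + e)) \<le> path_dist_term f h n"
    by (simp only: power_one_over)
  have "(\<Sum>k\<in>{n}. path_dist_term f h k) \<le> (\<Sum>k. path_dist_term f h k)"
    using assms by (intro sum_le_suminf path_dist_term_summable path_dist_term_nonneg) auto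
  then have "path_dist_term f h n \<le> path_dist f h"
    using norm_ge_zero[of "f 0 - h 0"] path_dist_alt[OF assms(1,2)] by (simp del: norm_ge_zero)
  then show False using assms 1 by linarith
qed

lemma path_dist_tendsto_iff:
  assumes F: "\<And>n. F n \<in> path_space" and f: "f \<in> path_space"
  shows "(\<lambda>n. path_dist (F n) f) \<longlonglongrightarrow> 0 \<longleftrightarrow> (\<forall>T. uniform_limit {0..T} F f sequentially)"
proof
  assume lim: "(\<lambda>n. path_dist (F n) f) \<longlonglongrightarrow> 0"
  show "\<forall>T. uniform_limit {0..T} F f sequentially"
  proof (intro allI uniform_limitI)
    fix T e :: real assume e: "0 < e"
    obtain m where "T \<le> real m" using real_arch_simple by blast
    then have m: "T \<le> real (Suc m)" by simp
    have "\<forall>\<^sub>F n in sequentially. path_dist (F n) f < (1 / 2) ^ Suc m * (e / (1 + e))"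
      using lim e by (intro order_tendstoD) auto
    then show "\<forall>\<^sub>F n in sequentially. \<forall>\<theta>\<in>{0..T}. dist (F n \<theta>) (f \<theta>) < e"
    proof eventually_elim
      case (elim n)
      have *: "sup_dist (real (Suc m)) (F n) f < e"
        by (rule sup_dist_less_if_path_dist_small[OF F f e elim])
      show ?case
      proof
        fix \<theta> assume "\<theta> \<in> {0..T}"
        then have "norm (F n \<theta> - f \<theta>) \<le> sup_dist (real (Suc m)) (F n) f"
          using m by (intro sup_dist_upper F f) auto
        then show "dist (F n \<theta>) (f \<theta>) < e" using * by (simp add: dist_norm)
      qed
    qed
  qed
next
  assume ul: "\<forall>T. uniform_limit {0..T} F f sequentially"
  show "(\<lambda>n. path_dist (F n) f) \<longlonglongrightarrow> 0"
  proof (rule LIMSEQ_I)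
    fix r :: real assume r: "0 < r"
    obtain K where K: "(1 / 2) ^ K < r / 2"
      using r real_arch_pow_inv[of "r / 2" "1 / 2"] by auto
    have "\<forall>\<^sub>F n in sequentially. \<forall>\<theta>\<in>{0..real K}. dist (F n \<theta>) (f \<theta>) < r / 8"
      using r by (intro uniform_limitD[OF ul[rule_format]]) auto
    then obtain N where N: "\<And>n \<theta>. n \<ge> N \<Longrightarrow> \<theta> \<in> {0..real K} \<Longrightarrow> dist (F n \<theta>) (f \<theta>) < r / 8"
      unfolding eventually_sequentially by blast
    show "\<exists>N. \<forall>n\<ge>N. norm (path_dist (F n) f - 0) < r"
    proof (intro exI[of _ N] allI impI)
      fix n assume "N \<le> n"
      then have "sup_dist (real K) (F n) f \<le> r / 8"
        by (intro sup_dist_le) (use N[of n] in \<open>auto simp: dist_norm less_imp_le\<close>)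
      then have "path_dist (F n) f < r" using path_dist_le[OF F f, of n K] K r by simp
      moreover have "0 \<le> path_dist (F n) f"
        by (rule Metric_space.nonneg[OF Metric_space_path])
      ultimately show "norm (path_dist (F n) f - 0) < r" by simp
    qed
  qed
qed

text \<open>Compact sets of paths: the bound at \<open>0\<close> and the Holder condition together bound the paths on
  every compact interval.\<close>

definition holder_paths :: "real \<Rightarrow> real \<Rightarrow> real \<Rightarrow> (real \<Rightarrow> real ^ 'd) set" where
  "holder_paths \<alpha> M C = {f \<in> path_space. norm (f 0) \<le> M \<and>
     (\<forall>s t. 0 \<le> s \<longrightarrow> s \<le> t \<longrightarrow> norm (f t - f s) \<le> C * (t - s) powr \<alpha>)}"

lemma holder_paths_bound:
  assumes "f \<in> holder_paths \<alpha> M C" "0 \<le> t" "t \<le> T" "0 < \<alpha>" "0 \<le> C"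
  shows "norm (f t) \<le> M + C * T powr \<alpha>"
proof -
  have "norm (f t - f 0) \<le> C * (t - 0) powr \<alpha>" "norm (f 0) \<le> M"
    using assms unfolding holder_paths_def by blast+
  moreover have "C * (t - 0) powr \<alpha> \<le> C * T powr \<alpha>"
    using assms by (intro mult_left_mono powr_mono2) auto
  moreover have "norm (f t) \<le> norm (f t - f 0) + norm (f 0)"
    using norm_triangle_ineq[of "f t - f 0" "f 0"] by simp
  ultimately show ?thesis by linarith
qed

lemma holder_paths_uniform_subsequence:
  fixes F :: "nat \<Rightarrow> real \<Rightarrow> real ^ 'd"
  assumes F: "\<And>n. F n \<in> holder_paths \<alpha> M C" and "0 < \<alpha>" "0 \<le> C"
  shows "\<exists>r g. strict_mono (r :: nat \<Rightarrow> nat) \<and> uniform_limit {0..T} (\<lambda>n. F (r n)) g sequentially"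
proof -
  have eq: "\<exists>d>0. \<forall>n y. y \<in> {0..T} \<and> norm (x - y) < d \<longrightarrow> norm (F n x - F n y) < e"
    if x: "x \<in> {0..T}" and e: "0 < e" for x e
  proof (intro exI[of _ "(e / (C + 1)) powr (1 / \<alpha>)"] conjI allI impI)
    show "0 < (e / (C + 1)) powr (1 / \<alpha>)" using e assms by simp
    fix n y assume y: "y \<in> {0..T} \<and> norm (x - y) < (e / (C + 1)) powr (1 / \<alpha>)"
    have "norm (F n x - F n y) \<le> C * \<bar>x - y\<bar> powr \<alpha>"
    proof (cases "x \<le> y")
      case True
      then have "norm (F n y - F n x) \<le> C * (y - x) powr \<alpha>"
        using F[of n] x unfolding holder_paths_def by auto
      then show ?thesis using True by (simp add: norm_minus_commute abs_minus_commute)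
    next
      case False
      then have "norm (F n x - F n y) \<le> C * (x - y) powr \<alpha>"
        using F[of n] y unfolding holder_paths_def by auto
      then show ?thesis using False by simp
    qed
    also have "\<bar>x - y\<bar> powr \<alpha> \<le> ((e / (C + 1)) powr (1 / \<alpha>)) powr \<alpha>"
      using y assms by (intro powr_mono2) auto
    then have "C * \<bar>x - y\<bar> powr \<alpha> \<le> C * (e / (C + 1))"
      using assms e by (intro mult_left_mono) (auto simp: powr_powr)
    also have "\<dots> < e" using assms e by (simp add: field_simps)
    finally show "norm (F n x - F n y) < e" .
  qed
  have bd: "norm (F n x) \<le> M + C * T powr \<alpha>" if "x \<in> {0..T}" for n x
    using that assms by (intro holder_paths_bound[OF F]) auto
  obtain g and r :: "nat \<Rightarrow> nat" where "strict_mono r"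
      "\<And>e. 0 < e \<Longrightarrow> \<exists>N. \<forall>n x. n \<ge> N \<and> x \<in> {0..T} \<longrightarrow> norm (F (r n) x - g x) < e"
    by (rule Arzela_Ascoli[of "{0..T}" F, OF compact_Icc bd eq]) auto
  then show ?thesis
    by (intro exI[of _ r] exI[of _ g] conjI uniform_limitI)
       (auto simp only: eventually_sequentially dist_norm Ball_def, meson)
qed

text \<open>The theorem of Arzela and Ascoli on the intervals \<open>[0,k]\<close>, combined by a diagonal argument. Both
  defining bounds survive pointwise limits.\<close>

lemma holder_paths_subsequence:
  fixes F :: "nat \<Rightarrow> real \<Rightarrow> real ^ 'd"
  assumes F: "\<And>n. F n \<in> holder_paths \<alpha> M C" and "0 < \<alpha>" "0 \<le> C"
  obtains f r where "f \<in> holder_paths \<alpha> M C" "strict_mono (r :: nat \<Rightarrow> nat)"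
    "(\<lambda>n. path_dist (F (r n)) f) \<longlonglongrightarrow> 0"
proof -
  define P where "P = (\<lambda>(k::nat) s. \<exists>g. uniform_limit {0..real k} (\<lambda>n. F (s n)) g sequentially)"
  interpret subseqs P
  proof
    fix n :: nat and s :: "nat \<Rightarrow> nat" assume "strict_mono s"
    show "\<exists>r'. strict_mono r' \<and> P n (s \<circ> r')"
      using holder_paths_uniform_subsequence[of "\<lambda>n. F (s n)" \<alpha> M C "real n"] assms
      unfolding P_def by auto
  qed
  have "P k (diagseq \<circ> (+) (Suc k))" for k
  proof (rule diagseq_holds)
    fix r s :: "nat \<Rightarrow> nat" and n assume "strict_mono r" "P n s"
    then show "P n (s \<circ> r)"
      unfolding P_def o_def using filterlim_compose[of "\<lambda>n. F (s n)" _ sequentially r] filterlim_subseq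
      by blast
  qed
  then have "\<exists>g. uniform_limit {0..real k} (\<lambda>n. F (diagseq (Suc k + n))) g sequentially" for k
    by (simp add: P_def)
  then obtain g where g: "\<And>k. uniform_limit {0..real k} (\<lambda>n. F (diagseq (Suc k + n))) (g k) sequentially"
    by metis
  have g: "uniform_limit {0..real k} (\<lambda>n. F (diagseq n)) (g k) sequentially" for k
  proof (rule uniform_limitI)
    fix e :: real assume "0 < e"
    then have "\<forall>\<^sub>F n in sequentially. \<forall>x\<in>{0..real k}. dist (F (diagseq (n + Suc k)) x) (g k x) < e"
      using g[of k] unfolding uniform_limit_iff by (simp add: add.commute)
    then show "\<forall>\<^sub>F n in sequentially. \<forall>x\<in>{0..real k}. dist (F (diagseq n) x) (g k x) < e"
      by (simp only: eventually_sequentially_seg[of "\<lambda>n. \<forall>x\<in>{0..real k}. dist (F (diagseq n) x) (g k x) < e"])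
  qed
  define f where "f = (\<lambda>\<theta>\<in>{0..}. g (nat \<lceil>\<theta>\<rceil>) \<theta>)"
  have pt: "(\<lambda>n. F (diagseq n) \<theta>) \<longlonglongrightarrow> f \<theta>" if "0 \<le> \<theta>" for \<theta>
    using tendsto_uniform_limitI[OF g[of "nat \<lceil>\<theta>\<rceil>"], of \<theta>] that by (simp add: f_def)
  have ul: "uniform_limit {0..T} (\<lambda>n. F (diagseq n)) f sequentially" for T
  proof -
    obtain k where k: "T \<le> real k" using real_arch_simple by blast
    have "g k \<theta> = f \<theta>" if "\<theta> \<in> {0..real k}" for \<theta>
      using LIMSEQ_unique[OF tendsto_uniform_limitI[OF g that] pt] that by simp
    then have "uniform_limit {0..real k} (\<lambda>n. F (diagseq n)) f sequentially"
      using g[of k] by (subst uniform_limit_cong'[where g = "\<lambda>n. F (diagseq n)" and i = "g k"]) auto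
    then show ?thesis by (rule uniform_limit_on_subset) (use k in auto)
  qed
  have Fp: "F n \<in> path_space" for n using F[of n] by (simp add: holder_paths_def)
  have Fc: "continuous_on {0..T} (F n)" for n T
    using Fp[of n] continuous_on_subset[of "{0..}" "F n" "{0..T}"] by (simp add: path_space_def)
  have "continuous_on {0..T} f" for T
    by (rule uniform_limit_theorem[OF always_eventually ul]) (simp_all add: Fc)
  then have fc: "continuous_on {0..} f" by (rule continuous_on_halflineI)
  have fp: "f \<in> path_space" using fc by (simp add: path_space_def f_def)
  have "f \<in> holder_paths \<alpha> M C"
    unfolding holder_paths_def
  proof (intro CollectI conjI allI impI fp)
    show "norm (f 0) \<le> M"
      using F by (intro tendsto_le[OF _ tendsto_const tendsto_norm[OF pt[of 0]]]) (auto simp: holder_paths_def)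
    fix s t :: real assume "0 \<le> s" "s \<le> t"
    then show "norm (f t - f s) \<le> C * (t - s) powr \<alpha>"
      using F by (intro tendsto_le[OF _ tendsto_const tendsto_norm[OF tendsto_diff[OF pt[of t] pt[of s]]]])
        (auto simp: holder_paths_def)
  qed
  moreover have "(\<lambda>n. path_dist (F (diagseq n)) f) \<longlonglongrightarrow> 0"
    using ul by (subst path_dist_tendsto_iff[OF Fp fp]) auto
  ultimately show ?thesis using that subseq_diagseq by blast
qed

lemma compactin_holder_paths:
  assumes "0 < \<alpha>" "0 \<le> C"
  shows "compactin path_topology (holder_paths \<alpha> M C :: (real \<Rightarrow> real ^ 'd) set)"
  unfolding Metric_space.compactin_sequentially[OF Metric_space_path]
proof (intro conjI allI impI)
  show sub: "holder_paths \<alpha> M C \<subseteq> (path_space :: (real \<Rightarrow> real ^ 'd) set)" by (auto simp: holder_paths_def)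
  fix F :: "nat \<Rightarrow> real \<Rightarrow> real ^ 'd" assume F: "range F \<subseteq> holder_paths \<alpha> M C"
  obtain f r where "f \<in> holder_paths \<alpha> M C" "strict_mono (r :: nat \<Rightarrow> nat)"
    "(\<lambda>n. path_dist (F (r n)) f) \<longlonglongrightarrow> 0"
    by (rule holder_paths_subsequence[of F \<alpha> M C]) (use F assms in auto)
  then show "\<exists>l r. l \<in> holder_paths \<alpha> M C \<and> strict_mono r \<and> limitin path_topology (F \<circ> r) l sequentially"
    using sub F unfolding Metric_space.limitin_metric_dist_null[OF Metric_space_path]
    by (intro exI[of _ f] exI[of _ r]) (auto simp: image_subset_iff subset_iff)
qed

section \<open>Volterra solutions and the semiflow\<close>

lemma lipschitz_on_cball:
  fixes g :: "'a::euclidean_space \<Rightarrow> 'b::metric_space"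
  assumes "\<And>x. \<exists>r>0. \<exists>L. L-lipschitz_on (ball x r) g"
  obtains L where "L-lipschitz_on (cball 0 R) g"
proof -
  have "local_lipschitz {0::real} (cball 0 R) (\<lambda>_. g)"
    unfolding local_lipschitz_def
  proof (intro ballI)
    fix x :: 'a and t :: real assume "x \<in> cball 0 R" "t \<in> {0}"
    obtain r L where r: "r > 0" and L: "L-lipschitz_on (ball x r) g" using assms by blast
    then have "L-lipschitz_on (cball x (r / 2) \<inter> cball 0 R) g"
      by (intro lipschitz_on_subset[OF L]) auto
    then show "\<exists>u>0. \<exists>L. \<forall>t\<in>cball t u \<inter> {0}. L-lipschitz_on (cball x u \<inter> cball 0 R) g"
      using r by (intro exI[of _ "r / 2"]) auto
  qed
  then show ?thesis
    by (rule local_lipschitz_compact_implies_lipschitz) (auto intro: that)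
qed

lemma continuous_on_if_locally_lipschitz:
  fixes g :: "'a::metric_space \<Rightarrow> 'b::metric_space"
  assumes "\<And>x. \<exists>r>0. \<exists>L. L-lipschitz_on (ball x r) g"
  shows "continuous_on A g"
proof -
  have "continuous (at x) g" for x
  proof -
    obtain r L where r: "r > 0" and L: "L-lipschitz_on (ball x r) g" using assms by blast
    then have "continuous_on (ball x r) g" by (intro lipschitz_on_continuous_on)
    then show ?thesis using r by (simp add: continuous_on_eq_continuous_at)
  qed
  then show ?thesis by (simp add: continuous_at_imp_continuous_on)
qed

lemma path_space_continuous_on:
  "f \<in> path_space \<Longrightarrow> A \<subseteq> {0..} \<Longrightarrow> continuous_on A f"
  by (auto simp: path_space_def elim: continuous_on_subset)

locale volterra =
  fixes \<alpha> :: real and g :: "real ^ 'd \<Rightarrow> real ^ 'd"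
  assumes \<alpha>: "0 < \<alpha>" "\<alpha> < 1"
    and locally_lipschitz: "\<And>x. \<exists>r>0. \<exists>L. L-lipschitz_on (ball x r) g"
begin

lemma Gamma_pos: "0 < Gamma \<alpha>" using \<alpha> by simp

lemmas g_continuous = continuous_on_if_locally_lipschitz[OF locally_lipschitz]

lemma g_path_continuous: "x \<in> path_space \<Longrightarrow> A \<subseteq> {0..} \<Longrightarrow> continuous_on A (\<lambda>s. g (x s))"
  by (intro continuous_on_compose2[OF g_continuous path_space_continuous_on]) auto

lemma solution_eq:
  assumes "is_volterra_solution \<alpha> g f x" "0 \<le> t"
  shows "x t = f t + (1 / Gamma \<alpha>) *\<^sub>R kernel_integral \<alpha> 0 t (\<lambda>s. g (x s)) t"
  using assms unfolding is_volterra_solution_def by blast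

text \<open>Solutions depend Lipschitz continuously on the forcing path as long as they stay in a common
  ball, where \<open>g\<close> is Lipschitz. The case \<open>\<epsilon> = 0\<close> is uniqueness; the uniform constant yields
  Cauchy sequences of solutions.\<close>

lemma solution_difference:
  "\<exists>K\<ge>0. \<forall>f h x y \<epsilon>. is_volterra_solution \<alpha> g f x \<and> is_volterra_solution \<alpha> g h y \<and> 0 \<le> \<epsilon> \<and>
     (\<forall>s\<in>{0..T}. norm (x s) \<le> M \<and> norm (y s) \<le> M \<and> norm (f s - h s) \<le> \<epsilon>)
     \<longrightarrow> (\<forall>t\<in>{0..T}. norm (x t - y t) \<le> K * \<epsilon>)"
proof -
  obtain L where L: "L-lipschitz_on (cball 0 M) g"
    using lipschitz_on_cball[OF locally_lipschitz] by blast
  have L0: "0 \<le> L" by (rule lipschitz_on_nonneg[OF L])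
  let ?C = "L / Gamma \<alpha>"
  have C: "0 \<le> ?C" using L0 Gamma_pos by simp
  obtain K where K: "0 \<le> K"
    "\<forall>u \<epsilon>. continuous_on {0..T} u \<and> 0 \<le> \<epsilon> \<and>
      (\<forall>t\<in>{0..T}. 0 \<le> u t \<and> u t \<le> \<epsilon> + ?C * integral {0..t} (\<lambda>s. (t - s) powr (\<alpha> - 1) * u s))
      \<longrightarrow> (\<forall>t\<in>{0..T}. u t \<le> K * \<epsilon>)"
    using singular_gronwall[OF \<alpha>(1) C] by blast
  show ?thesis
  proof (intro exI[of _ K] conjI allI impI ballI K(1), elim conjE)
    fix f h x y \<epsilon> t
    assume x: "is_volterra_solution \<alpha> g f x" and y: "is_volterra_solution \<alpha> g h y"
      and \<epsilon>: "0 \<le> \<epsilon>" and t: "t \<in> {0..T}"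
      and bounds: "\<forall>s\<in>{0..T}. norm (x s) \<le> M \<and> norm (y s) \<le> M \<and> norm (f s - h s) \<le> \<epsilon>"
    from bounds have xM: "\<And>s. s \<in> {0..T} \<Longrightarrow> norm (x s) \<le> M" and yM: "\<And>s. s \<in> {0..T} \<Longrightarrow> norm (y s) \<le> M"
      and fh: "\<And>s. s \<in> {0..T} \<Longrightarrow> norm (f s - h s) \<le> \<epsilon>" by blast+
    have p: "x \<in> path_space" "y \<in> path_space" using x y by (simp_all add: is_volterra_solution_def)
    have cu: "continuous_on {0..r} (\<lambda>s. norm (x s - y s))" for r
      by (intro continuous_intros path_space_continuous_on p) auto
    show "norm (x t - y t) \<le> K * \<epsilon>"
    proof (rule K(2)[rule_format, OF _ t], intro conjI ballI norm_ge_zero cu \<epsilon>)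
      fix t assume t: "t \<in> {0..T}"
      have c: "continuous_on {0..t} (\<lambda>s. g (x s))" "continuous_on {0..t} (\<lambda>s. g (y s))"
        by (intro g_path_continuous p; simp)+
      let ?I = "\<lambda>y. kernel_integral \<alpha> 0 t y t"
      have "norm (?I (\<lambda>s. g (x s) - g (y s)))
          \<le> integral {0..t} (\<lambda>s. L * ((t - s) powr (\<alpha> - 1) * norm (x s - y s)))"
      proof (rule integral_norm_bound_integral)
        show "(\<lambda>s. ((t - s) powr (\<alpha> - 1)) *\<^sub>R (g (x s) - g (y s))) integrable_on {0..t}"
          by (rule kernel_scaleR_integrable[OF \<alpha>(1) order_refl continuous_on_diff[OF c]])
        show "(\<lambda>s. L * ((t - s) powr (\<alpha> - 1) * norm (x s - y s))) integrable_on {0..t}"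
          using kernel_scaleR_integrable[OF \<alpha>(1) order_refl cu[of t]]
          by (intro integrable_on_mult_right) simp
        fix s assume s: "s \<in> {0..t}"
        have "norm (g (x s) - g (y s)) \<le> L * norm (x s - y s)"
          using lipschitz_onD[OF L, of "x s" "y s"] xM[of s] yM[of s] s t by (simp add: dist_norm)
        then have "(t - s) powr (\<alpha> - 1) * norm (g (x s) - g (y s))
            \<le> (t - s) powr (\<alpha> - 1) * (L * norm (x s - y s))" by (intro mult_left_mono) auto
        then show "norm (((t - s) powr (\<alpha> - 1)) *\<^sub>R (g (x s) - g (y s)))
            \<le> L * ((t - s) powr (\<alpha> - 1) * norm (x s - y s))" by (simp add: mult_ac)
      qed
      also have "\<dots> = L * integral {0..t} (\<lambda>s. (t - s) powr (\<alpha> - 1) * norm (x s - y s))"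
        by (rule integral_mult_right)
      finally have I: "norm (?I (\<lambda>s. g (x s) - g (y s)))
        \<le> L * integral {0..t} (\<lambda>s. (t - s) powr (\<alpha> - 1) * norm (x s - y s))" .
      have "x t - y t = (f t - h t) + (1 / Gamma \<alpha>) *\<^sub>R (?I (\<lambda>s. g (x s)) - ?I (\<lambda>s. g (y s)))"
        using solution_eq[OF x, of t] solution_eq[OF y, of t] t by (simp add: scaleR_diff_right)
      also have "?I (\<lambda>s. g (x s)) - ?I (\<lambda>s. g (y s)) = ?I (\<lambda>s. g (x s) - g (y s))"
        by (rule kernel_integral_diff[OF \<alpha>(1) order_refl c])
      finally have "norm (x t - y t) \<le> norm (f t - h t)
          + norm ((1 / Gamma \<alpha>) *\<^sub>R ?I (\<lambda>s. g (x s) - g (y s)))"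
        by (simp only: norm_triangle_ineq)
      also have "norm ((1 / Gamma \<alpha>) *\<^sub>R ?I (\<lambda>s. g (x s) - g (y s)))
          = (1 / Gamma \<alpha>) * norm (?I (\<lambda>s. g (x s) - g (y s)))"
        using Gamma_pos by simp
      also have "norm (f t - h t) + (1 / Gamma \<alpha>) * norm (?I (\<lambda>s. g (x s) - g (y s)))
          \<le> \<epsilon> + (1 / Gamma \<alpha>) * (L * integral {0..t} (\<lambda>s. (t - s) powr (\<alpha> - 1) * norm (x s - y s)))"
        using Gamma_pos by (intro add_mono mult_left_mono I fh t) auto
      finally show "norm (x t - y t) \<le> \<epsilon> + ?C * integral {0..t} (\<lambda>s. (t - s) powr (\<alpha> - 1) * norm (x s - y s))"
        by (simp add: divide_inverse mult_ac)
    qed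
  qed
qed

lemma solution_unique:
  assumes x: "is_volterra_solution \<alpha> g f x" and y: "is_volterra_solution \<alpha> g f y"
  shows "x = y"
proof (rule extensionalityI[where A = "{0..}"])
  have p: "x \<in> path_space" "y \<in> path_space" using x y by (simp_all add: is_volterra_solution_def)
  then show "x \<in> extensional {0..}" "y \<in> extensional {0..}" by (simp_all add: path_space_def)
  fix t :: real assume t: "t \<in> {0..}"
  have "compact (x ` {0..t} \<union> y ` {0..t})"
    by (intro compact_Un compact_continuous_image path_space_continuous_on p) auto
  then obtain M where "\<forall>v \<in> x ` {0..t} \<union> y ` {0..t}. norm v \<le> M"
    using compact_imp_bounded bounded_iff by blast
  then have "\<forall>s\<in>{0..t}. norm (x s) \<le> M \<and> norm (y s) \<le> M \<and> norm (f s - f s) \<le> 0" by auto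
  then have prems: "is_volterra_solution \<alpha> g f x \<and> is_volterra_solution \<alpha> g f y \<and> 0 \<le> (0::real) \<and>
      (\<forall>s\<in>{0..t}. norm (x s) \<le> M \<and> norm (y s) \<le> M \<and> norm (f s - f s) \<le> 0)"
    using x y by simp
  obtain K where K: "\<forall>f h x y \<epsilon>. is_volterra_solution \<alpha> g f x \<and> is_volterra_solution \<alpha> g h y \<and> 0 \<le> \<epsilon> \<and>
        (\<forall>s\<in>{0..t}. norm (x s) \<le> M \<and> norm (y s) \<le> M \<and> norm (f s - h s) \<le> \<epsilon>)
        \<longrightarrow> (\<forall>r\<in>{0..t}. norm (x r - y r) \<le> K * \<epsilon>)"
    using solution_difference[of t M] by blast
  have "\<forall>r\<in>{0..t}. norm (x r - y r) \<le> K * 0"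
    using K[THEN spec, THEN spec, THEN spec, THEN spec, THEN spec, THEN mp, OF prems] .
  then have "norm (x t - y t) \<le> K * 0" using t by (intro bspec[where x = t]) auto
  then show "x t = y t" by simp
qed

lemma volterra_solution_eqI:
  assumes "is_volterra_solution \<alpha> g f x"
  shows "volterra_solution \<alpha> g f = x"
  unfolding volterra_solution_def
  by (rule the_equality[where P = "is_volterra_solution \<alpha> g f", OF assms solution_unique[OF _ assms]])

lemma semiflow_apply:
  assumes "is_volterra_solution \<alpha> g f x" "0 \<le> \<theta>"
  shows "volterra_semiflow \<alpha> g t f \<theta>
    = f (t + \<theta>) + (1 / Gamma \<alpha>) *\<^sub>R kernel_integral \<alpha> 0 t (\<lambda>s. g (x s)) (t + \<theta>)"
  using assms(2) by (simp add: volterra_semiflow_def volterra_solution_eqI[OF assms(1)])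

lemma semiflow_path_space:
  assumes x: "is_volterra_solution \<alpha> g f x" and f: "f \<in> path_space" and t: "0 \<le> t"
  shows "volterra_semiflow \<alpha> g t f \<in> path_space"
proof -
  have p: "x \<in> path_space" using x by (simp add: is_volterra_solution_def)
  have c: "continuous_on {0..t} (\<lambda>s. g (x s))" by (intro g_path_continuous p) auto
  obtain G where "\<forall>v\<in>(\<lambda>s. g (x s)) ` {0..t}. norm v \<le> G"
    using compact_imp_bounded[OF compact_continuous_image[OF c compact_Icc]] unfolding bounded_iff by blast
  then have G: "\<And>s. s \<in> {0..t} \<Longrightarrow> norm (g (x s)) \<le> G" by blast
  have "continuous_on {0..} (\<lambda>\<theta>. kernel_integral \<alpha> 0 t (\<lambda>s. g (x s)) (t + \<theta>))"
  proof (rule holder_imp_continuous_on[OF \<alpha>(1), where C = "G / \<alpha>"])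
    fix s u :: real assume "s \<in> {0..}" "u \<in> {0..}" "s \<le> u"
    then show "norm (kernel_integral \<alpha> 0 t (\<lambda>s. g (x s)) (t + u)
        - kernel_integral \<alpha> 0 t (\<lambda>s. g (x s)) (t + s)) \<le> G / \<alpha> * (u - s) powr \<alpha>"
      using kernel_increment_bound[OF \<alpha> t _ _ c G, of "t + s" "t + u"] by simp
  qed
  moreover have "continuous_on {0..} (\<lambda>\<theta>. f (t + \<theta>))"
    using t by (intro continuous_on_compose2[OF path_space_continuous_on[OF f order_refl]] continuous_on_add
      continuous_on_const continuous_on_id) auto
  ultimately have "continuous_on {0..} (\<lambda>\<theta>. f (t + \<theta>)
      + (1 / Gamma \<alpha>) *\<^sub>R kernel_integral \<alpha> 0 t (\<lambda>s. g (x s)) (t + \<theta>))"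
    by (intro continuous_on_add continuous_on_scaleR continuous_on_const)
  then have "continuous_on {0..} (volterra_semiflow \<alpha> g t f)"
    by (rule continuous_on_eq) (simp add: semiflow_apply[OF x])
  then show ?thesis by (simp add: path_space_def volterra_semiflow_def)
qed

lemma kernel_integral_combine:
  fixes y :: "real \<Rightarrow> real ^ 'd"
  assumes "a \<le> c" "c \<le> b" "b \<le> t" "continuous_on {a..b} y"
  shows "kernel_integral \<alpha> a c y t + kernel_integral \<alpha> c b y t = kernel_integral \<alpha> a b y t"
  using assms by (intro Henstock_Kurzweil_Integration.integral_combine kernel_scaleR_integrable \<alpha>(1))

text \<open>This is the translation property behind the semiflow: the path \<open>\<T>\<^sub>t f\<close> collects the forcing
  and the memory up to time \<open>t\<close>, so that its solution is the shifted solution of \<open>f\<close>.\<close>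

lemma semiflow_solution:
  assumes x: "is_volterra_solution \<alpha> g f x" and f: "f \<in> path_space" and t: "0 \<le> t"
  shows "is_volterra_solution \<alpha> g (volterra_semiflow \<alpha> g t f) (\<lambda>\<theta>\<in>{0..}. x (t + \<theta>))"
  unfolding is_volterra_solution_def
proof (intro conjI allI impI)
  have p: "x \<in> path_space" using x by (simp add: is_volterra_solution_def)
  have "continuous_on {0..} (\<lambda>\<theta>. x (t + \<theta>))"
    using t by (intro continuous_on_compose2[OF path_space_continuous_on[OF p order_refl]] continuous_on_add
      continuous_on_const continuous_on_id) auto
  then have "continuous_on {0..} (\<lambda>\<theta>\<in>{0..}. x (t + \<theta>))" by (rule continuous_on_eq) simp
  then show "(\<lambda>\<theta>\<in>{0..}. x (t + \<theta>)) \<in> path_space" by (simp add: path_space_def)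
  fix \<theta> :: real assume \<theta>: "0 \<le> \<theta>"
  have "kernel_integral \<alpha> 0 \<theta> (\<lambda>s. g ((\<lambda>\<theta>\<in>{0..}. x (t + \<theta>)) s)) \<theta>
      = kernel_integral \<alpha> 0 \<theta> (\<lambda>s. g (x (t + s))) \<theta>"
    by (intro integral_cong) auto
  also have "\<dots> = kernel_integral \<alpha> t (t + \<theta>) (\<lambda>s. g (x s)) (t + \<theta>)"
    using kernel_integral_shift[where \<alpha> = \<alpha> and c = 0 and d = \<theta> and y = "\<lambda>s. g (x s)" and r = t and t = \<theta>] by simp
  finally have 1: "kernel_integral \<alpha> 0 \<theta> (\<lambda>s. g ((\<lambda>\<theta>\<in>{0..}. x (t + \<theta>)) s)) \<theta>
      = kernel_integral \<alpha> t (t + \<theta>) (\<lambda>s. g (x s)) (t + \<theta>)" .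
  have "kernel_integral \<alpha> 0 t (\<lambda>s. g (x s)) (t + \<theta>) + kernel_integral \<alpha> t (t + \<theta>) (\<lambda>s. g (x s)) (t + \<theta>)
      = kernel_integral \<alpha> 0 (t + \<theta>) (\<lambda>s. g (x s)) (t + \<theta>)"
    using t \<theta> by (intro kernel_integral_combine g_path_continuous p) auto
  then show "(\<lambda>\<theta>\<in>{0..}. x (t + \<theta>)) \<theta> = volterra_semiflow \<alpha> g t f \<theta> + (1 / Gamma \<alpha>) *\<^sub>R
      kernel_integral \<alpha> 0 \<theta> (\<lambda>s. g ((\<lambda>\<theta>\<in>{0..}. x (t + \<theta>)) s)) \<theta>"
    unfolding 1 semiflow_apply[OF x \<theta>] using solution_eq[OF x, of "t + \<theta>"] t \<theta>
    by (simp add: scaleR_add_right[symmetric] add.assoc)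
qed

lemma semiflow_semigroup:
  assumes x: "is_volterra_solution \<alpha> g f x" and f: "f \<in> path_space" and "0 \<le> t" "0 \<le> r"
  shows "volterra_semiflow \<alpha> g r (volterra_semiflow \<alpha> g t f) = volterra_semiflow \<alpha> g (t + r) f"
proof (rule extensionalityI[of _ "{0..}"])
  show "volterra_semiflow \<alpha> g r (volterra_semiflow \<alpha> g t f) \<in> extensional {0..}"
    "volterra_semiflow \<alpha> g (t + r) f \<in> extensional {0..}" by (simp_all add: volterra_semiflow_def)
  fix \<theta> :: real assume "\<theta> \<in> {0..}"
  then have \<theta>: "0 \<le> \<theta>" by simp
  have p: "x \<in> path_space" using x by (simp add: is_volterra_solution_def)
  let ?x = "\<lambda>\<theta>\<in>{0..}. x (t + \<theta>)"
  have "kernel_integral \<alpha> 0 r (\<lambda>s. g (?x s)) (r + \<theta>) = kernel_integral \<alpha> 0 r (\<lambda>s. g (x (t + s))) (r + \<theta>)"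
    by (intro integral_cong) auto
  also have "\<dots> = kernel_integral \<alpha> t (t + r) (\<lambda>s. g (x s)) (t + r + \<theta>)"
    using kernel_integral_shift[where \<alpha> = \<alpha> and c = 0 and d = r and y = "\<lambda>s. g (x s)" and r = t and t = "r + \<theta>"] by (simp add: add.assoc)
  finally have 1: "kernel_integral \<alpha> 0 r (\<lambda>s. g (?x s)) (r + \<theta>)
      = kernel_integral \<alpha> t (t + r) (\<lambda>s. g (x s)) (t + r + \<theta>)" .
  have 2: "kernel_integral \<alpha> 0 t (\<lambda>s. g (x s)) (t + (r + \<theta>)) + kernel_integral \<alpha> 0 r (\<lambda>s. g (?x s)) (r + \<theta>)
      = kernel_integral \<alpha> 0 (t + r) (\<lambda>s. g (x s)) (t + r + \<theta>)"
    unfolding 1 add.assoc[symmetric] using assms \<theta> by (intro kernel_integral_combine g_path_continuous p) auto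
  have r\<theta>: "0 \<le> r + \<theta>" using assms \<theta> by simp
  show "volterra_semiflow \<alpha> g r (volterra_semiflow \<alpha> g t f) \<theta> = volterra_semiflow \<alpha> g (t + r) f \<theta>"
    unfolding semiflow_apply[OF semiflow_solution[OF x f \<open>0 \<le> t\<close>] \<theta>] semiflow_apply[OF x \<theta>]
      semiflow_apply[OF x r\<theta>] 2[symmetric]
    by (simp only: scaleR_add_right add.assoc)
qed

lemma g_uniform_limit:
  assumes lim: "uniform_limit A X x sequentially"
    and b: "\<And>n s. s \<in> A \<Longrightarrow> norm (X n s) \<le> M" "\<And>s. s \<in> A \<Longrightarrow> norm (x s) \<le> M"
  shows "uniform_limit A (\<lambda>n s. g (X n s)) (\<lambda>s. g (x s)) sequentially"
proof (rule uniform_limitI)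
  fix e :: real assume e: "0 < e"
  obtain L where L: "L-lipschitz_on (cball 0 M) g"
    using lipschitz_on_cball[OF locally_lipschitz] by blast
  have L0: "0 \<le> L" by (rule lipschitz_on_nonneg[OF L])
  have "\<forall>\<^sub>F n in sequentially. \<forall>s\<in>A. dist (X n s) (x s) < e / (L + 1)"
    using e L0 by (intro uniform_limitD[OF lim]) auto
  then show "\<forall>\<^sub>F n in sequentially. \<forall>s\<in>A. dist (g (X n s)) (g (x s)) < e"
  proof eventually_elim
    case (elim n)
    show ?case
    proof
      fix s assume s: "s \<in> A"
      have "dist (g (X n s)) (g (x s)) \<le> L * dist (X n s) (x s)"
        using b s by (intro lipschitz_onD[OF L]) auto
      also have "\<dots> \<le> L * (e / (L + 1))" using elim s L0 by (intro mult_left_mono) (auto simp: less_imp_le)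
      also have "\<dots> < e" using e L0 by (simp add: field_simps)
      finally show "dist (g (X n s)) (g (x s)) < e" .
    qed
  qed
qed

text \<open>Boundedness of the solutions substitutes for a global Lipschitz condition; it also makes a
  separate existence theorem for the limiting forcing path unnecessary.\<close>

lemma solution_limit:
  assumes X: "\<And>n. is_volterra_solution \<alpha> g (F n) (X n)"
    and M: "\<And>n s. 0 \<le> s \<Longrightarrow> norm (X n s) \<le> M"
    and lim: "\<And>T. uniform_limit {0..T} F f sequentially"
  obtains x where "is_volterra_solution \<alpha> g f x" "\<And>T. uniform_limit {0..T} X x sequentially"
proof -
  have uc: "uniformly_Cauchy_on {0..T} X" for T
  proof (rule uniformly_Cauchy_onI)
    fix e :: real assume e: "0 < e"
    obtain K where K: "0 \<le> K"
      "\<forall>f h x y \<epsilon>. is_volterra_solution \<alpha> g f x \<and> is_volterra_solution \<alpha> g h y \<and> 0 \<le> \<epsilon> \<and>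
        (\<forall>s\<in>{0..T}. norm (x s) \<le> M \<and> norm (y s) \<le> M \<and> norm (f s - h s) \<le> \<epsilon>)
        \<longrightarrow> (\<forall>t\<in>{0..T}. norm (x t - y t) \<le> K * \<epsilon>)"
      using solution_difference[of T M] by blast
    define \<epsilon> where "\<epsilon> = e / (K + 1)"
    have \<epsilon>: "0 < \<epsilon>" "K * \<epsilon> < e" using e K(1) by (auto simp: \<epsilon>_def field_simps)
    have "\<forall>\<^sub>F n in sequentially. \<forall>s\<in>{0..T}. dist (F n s) (f s) < \<epsilon> / 2"
      using \<epsilon> by (intro uniform_limitD[OF lim]) auto
    then obtain N where N: "\<And>n s. n \<ge> N \<Longrightarrow> s \<in> {0..T} \<Longrightarrow> dist (F n s) (f s) < \<epsilon> / 2"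
      unfolding eventually_sequentially by blast
    show "\<exists>N. \<forall>t\<in>{0..T}. \<forall>m\<ge>N. \<forall>n\<ge>N. dist (X m t) (X n t) < e"
    proof (intro exI[of _ N] ballI allI impI)
      fix t m n assume t: "t \<in> {0..T}" and mn: "N \<le> m" "N \<le> n"
      have "norm (F m s - F n s) \<le> \<epsilon>" if "s \<in> {0..T}" for s
        using dist_triangle_half_r[of "f s" "F m s" \<epsilon> "F n s"] N[OF mn(1) that] N[OF mn(2) that]
        by (simp add: dist_norm norm_minus_commute)
      then have "norm (X m t - X n t) \<le> K * \<epsilon>"
        using \<epsilon> M t by (intro K(2)[rule_format, of "F m" "X m" "F n" "X n"]) (auto intro: X)
      then show "dist (X m t) (X n t) < e" using \<epsilon> by (simp add: dist_norm)
    qed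
  qed
  define x where "x = (\<lambda>\<theta>\<in>{0..}. lim (\<lambda>n. X n \<theta>))"
  have ul: "uniform_limit {0..T} X x sequentially" for T
    using uc[of T, THEN Cauchy_uniformly_convergent]
    unfolding uniformly_convergent_uniform_limit_iff
    by (rule uniform_limit_cong'[THEN iffD1, rotated 2]) (auto simp: x_def)
  have Xp: "X n \<in> path_space" for n using X by (simp add: is_volterra_solution_def)
  have "continuous_on {0..T} x" for T
    by (rule uniform_limit_theorem[OF _ ul])
       (auto intro!: always_eventually path_space_continuous_on Xp)
  then have xp: "x \<in> path_space"
    by (auto simp: path_space_def x_def intro: continuous_on_halflineI)
  have pt: "(\<lambda>n. X n t) \<longlonglongrightarrow> x t" if "0 \<le> t" for t
    using tendsto_uniform_limitI[OF ul[of t], of t] that by simp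
  have xM: "norm (x s) \<le> M" if "0 \<le> s" for s
    using M that by (intro tendsto_le[OF _ tendsto_const tendsto_norm[OF pt]]) auto
  have "is_volterra_solution \<alpha> g f x"
    unfolding is_volterra_solution_def
  proof (intro conjI allI impI xp)
    fix t :: real assume t: "0 \<le> t"
    have "uniform_limit {t..} (\<lambda>n. kernel_integral \<alpha> 0 t (\<lambda>s. g (X n s)))
        (kernel_integral \<alpha> 0 t (\<lambda>s. g (x s))) sequentially"
      using M xM t by (intro kernel_integral_uniform_limit \<alpha> g_path_continuous Xp g_uniform_limit[of _ _ _ M] ul) auto
    then have "(\<lambda>n. kernel_integral \<alpha> 0 t (\<lambda>s. g (X n s)) t) \<longlonglongrightarrow> kernel_integral \<alpha> 0 t (\<lambda>s. g (x s)) t"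
      by (rule tendsto_uniform_limitI) simp
    moreover have "(\<lambda>n. F n t) \<longlonglongrightarrow> f t"
      using tendsto_uniform_limitI[OF lim[of t], of t] t by simp
    ultimately have "(\<lambda>n. F n t + (1 / Gamma \<alpha>) *\<^sub>R kernel_integral \<alpha> 0 t (\<lambda>s. g (X n s)) t)
        \<longlonglongrightarrow> f t + (1 / Gamma \<alpha>) *\<^sub>R kernel_integral \<alpha> 0 t (\<lambda>s. g (x s)) t"
      by (intro tendsto_intros)
    then have "(\<lambda>n. X n t) \<longlonglongrightarrow> f t + (1 / Gamma \<alpha>) *\<^sub>R kernel_integral \<alpha> 0 t (\<lambda>s. g (x s)) t"
      by (simp only: solution_eq[OF X t, symmetric])
    then show "x t = f t + (1 / Gamma \<alpha>) *\<^sub>R kernel_integral \<alpha> 0 t (\<lambda>s. g (x s)) t"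
      by (rule LIMSEQ_unique[OF pt[OF t]])
  qed
  then show ?thesis using ul that by blast
qed

text \<open>Continuity of \<open>\<T>\<^sub>t\<close> along sequences whose solutions are uniformly bounded.\<close>

lemma semiflow_limit:
  assumes X: "\<And>n. is_volterra_solution \<alpha> g (F n) (X n)" and F: "\<And>n. F n \<in> path_space"
    and f: "f \<in> path_space"
    and M: "\<And>n s. 0 \<le> s \<Longrightarrow> norm (X n s) \<le> M" and t: "0 \<le> t"
    and lim: "(\<lambda>n. path_dist (F n) f) \<longlonglongrightarrow> 0"
  shows "(\<lambda>n. path_dist (volterra_semiflow \<alpha> g t (F n)) (volterra_semiflow \<alpha> g t f)) \<longlonglongrightarrow> 0"
    and "volterra_semiflow \<alpha> g t f \<in> path_space"
proof -
  have ulF: "uniform_limit {0..T} F f sequentially" for T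
    using lim path_dist_tendsto_iff[of F f] F f by blast
  obtain x where x: "is_volterra_solution \<alpha> g f x" and ul: "\<And>T. uniform_limit {0..T} X x sequentially"
    using solution_limit[OF X M ulF] by blast
  show sp: "volterra_semiflow \<alpha> g t f \<in> path_space" by (rule semiflow_path_space[OF x f t])
  have Xp: "X n \<in> path_space" for n using X by (simp add: is_volterra_solution_def)
  have xM: "norm (x s) \<le> M" if "0 \<le> s" for s
    using M that tendsto_uniform_limitI[OF ul[of s], of s]
    by (intro tendsto_le[OF _ tendsto_const tendsto_norm]) auto
  have I: "uniform_limit {t..} (\<lambda>n. kernel_integral \<alpha> 0 t (\<lambda>s. g (X n s)))
      (kernel_integral \<alpha> 0 t (\<lambda>s. g (x s))) sequentially"
    using M xM t by (intro kernel_integral_uniform_limit \<alpha> g_path_continuous Xp g_uniform_limit[of _ _ _ M] ul) auto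
  have "uniform_limit {0..T} (\<lambda>n. volterra_semiflow \<alpha> g t (F n)) (volterra_semiflow \<alpha> g t f) sequentially" for T
  proof -
    have "uniform_limit {0..T} (\<lambda>n \<theta>. F n (t + \<theta>)) (\<lambda>\<theta>. f (t + \<theta>)) sequentially"
      by (rule uniform_limit_compose'[OF ulF[of "t + T"]]) (use t in auto)
    moreover have "uniform_limit {0..T} (\<lambda>n \<theta>. kernel_integral \<alpha> 0 t (\<lambda>s. g (X n s)) (t + \<theta>))
        (\<lambda>\<theta>. kernel_integral \<alpha> 0 t (\<lambda>s. g (x s)) (t + \<theta>)) sequentially"
      by (rule uniform_limit_compose'[OF I]) auto
    ultimately have "uniform_limit {0..T}
        (\<lambda>n \<theta>. F n (t + \<theta>) + (1 / Gamma \<alpha>) *\<^sub>R kernel_integral \<alpha> 0 t (\<lambda>s. g (X n s)) (t + \<theta>))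
        (\<lambda>\<theta>. f (t + \<theta>) + (1 / Gamma \<alpha>) *\<^sub>R kernel_integral \<alpha> 0 t (\<lambda>s. g (x s)) (t + \<theta>)) sequentially"
      by (intro uniform_limit_add bounded_linear.uniform_limit[OF bounded_linear_scaleR_right])
    then show ?thesis
      by (rule uniform_limit_cong'[THEN iffD1, rotated 2])
         (auto simp: semiflow_apply[OF X] semiflow_apply[OF x])
  qed
  then show "(\<lambda>n. path_dist (volterra_semiflow \<alpha> g t (F n)) (volterra_semiflow \<alpha> g t f)) \<longlonglongrightarrow> 0"
    by (subst path_dist_tendsto_iff) (auto intro: semiflow_path_space[OF X F t] sp)
qed

end

section \<open>The current value as an average of past values\<close>

lemma has_integral_reflect_about:
  fixes f :: "real \<Rightarrow> 'b::banach"
  assumes "(f has_integral I) {a..b}" "a \<le> b"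
  shows "((\<lambda>x. f (c - x)) has_integral I) {c - b..c - a}"
proof -
  have "((\<lambda>x. f (- 1 *\<^sub>R x + c)) has_integral (1 / \<bar>- 1\<bar> ^ DIM(real)) *\<^sub>R I)
      ((\<lambda>x. (1 / - 1) *\<^sub>R x + - ((1 / - 1) *\<^sub>R c)) ` cbox a b)"
    using assms by (intro has_integral_affinity) auto
  moreover have "(\<lambda>x. (1 / - 1) *\<^sub>R x + - ((1 / - 1) *\<^sub>R c)) ` cbox a b = {c - b..c - a}"
    using image_affinity_atLeastAtMost[of "-1" c a b] assms(2) by simp
  ultimately show ?thesis by simp
qed

text \<open>A bridge between the Henstock--Kurzweil integral of the equation and the Lebesgue integral for
  which Fubini's theorem is available.\<close>

lemma lborel_integral_eq_integral:
  fixes f :: "real \<Rightarrow> 'b::euclidean_space"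
  assumes "f absolutely_integrable_on S" "(\<lambda>x. indicator S x *\<^sub>R f x) \<in> borel_measurable borel"
  shows "integrable lborel (\<lambda>x. indicator S x *\<^sub>R f x)"
    and "(\<integral>x. indicator S x *\<^sub>R f x \<partial>lborel) = integral S f"
proof -
  have m: "(\<lambda>x. indicator S x *\<^sub>R f x) \<in> borel_measurable lborel" using assms(2) by simp
  show "integrable lborel (\<lambda>x. indicator S x *\<^sub>R f x)"
    using assms(1) integrable_completion[OF m] by (simp add: set_integrable_def)
  show "(\<integral>x. indicator S x *\<^sub>R f x \<partial>lborel) = integral S f"
    using integral_completion[OF m] set_lebesgue_integral_eq_integral(2)[OF assms(1)]
    by (simp add: set_lebesgue_integral_def)
qed

lemma absolutely_integrable_Ioo:
  fixes f :: "real \<Rightarrow> 'b::euclidean_space"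
  shows "f absolutely_integrable_on {a..b} \<Longrightarrow> f absolutely_integrable_on {a<..<b}"
  by (rule set_integrable_subset) auto

text \<open>The weight \<open>sin (\<pi> \<alpha>) / \<pi> \<cdot> h powr \<alpha> v powr (- \<alpha>) / (h + v)\<close>, with the constant written as
  \<open>1 / Beta (1 - \<alpha>) \<alpha>\<close>. It is chosen so that, for every \<open>w > 0\<close>, integrating the kernel values \<open>k(u)\<close>
  against \<open>q(w - u)\<close> over \<open>0 < u < w\<close> gives the kernel value \<open>k(w + h)\<close>.\<close>

definition prediction_density :: "real \<Rightarrow> real \<Rightarrow> real \<Rightarrow> real" where
  "prediction_density \<alpha> h v = h powr \<alpha> * v powr (- \<alpha>) / ((h + v) * Beta (1 - \<alpha>) \<alpha>)"

lemma prediction_density_nonneg: "0 < \<alpha> \<Longrightarrow> \<alpha> < 1 \<Longrightarrow> 0 < h \<Longrightarrow> 0 \<le> v \<Longrightarrow> 0 \<le> prediction_density \<alpha> h v"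
  by (auto simp: prediction_density_def Beta_def intro!: divide_nonneg_nonneg mult_nonneg_nonneg Gamma_real_nonneg)

lemma Beta_pos: "0 < a \<Longrightarrow> 0 < b \<Longrightarrow> 0 < Beta a (b::real)"
  by (simp add: Beta_def)

lemma beta_density:
  fixes \<alpha> :: real
  assumes "0 < \<alpha>" "\<alpha> < 1"
  shows "(\<lambda>u. u powr (- \<alpha>) * (1 - u) powr (\<alpha> - 1)) absolutely_integrable_on {0<..<1}"
    and "integral {0<..<1} (\<lambda>u. u powr (- \<alpha>) * (1 - u) powr (\<alpha> - 1)) = Beta (1 - \<alpha>) \<alpha>"
proof -
  have I: "((\<lambda>u. u powr (- \<alpha>) * (1 - u) powr (\<alpha> - 1)) has_integral Beta (1 - \<alpha>) \<alpha>) {0<..<1}"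
    using has_integral_Beta_real[of "1 - \<alpha>" \<alpha>] assms by (simp add: has_integral_Icc_iff_Ioo)
  then show "(\<lambda>u. u powr (- \<alpha>) * (1 - u) powr (\<alpha> - 1)) absolutely_integrable_on {0<..<1}"
    by (intro nonnegative_absolutely_integrable_1) (auto simp: integrable_on_def)
  show "integral {0<..<1} (\<lambda>u. u powr (- \<alpha>) * (1 - u) powr (\<alpha> - 1)) = Beta (1 - \<alpha>) \<alpha>"
    using I by (rule integral_unique)
qed

lemma moebius_has_field_derivative:
  fixes h v :: real
  assumes "0 < h" "0 < v"
  shows "((\<lambda>v. v / (v + h)) has_field_derivative h / (v + h)\<^sup>2) (at v within S)"
  using assms by (auto intro!: derivative_eq_intros simp: field_simps power2_eq_square)

text \<open>The Moebius map \<open>v \<mapsto> v (w + h) / (w (v + h))\<close> takes \<open>0, w, -h\<close> to \<open>0, 1, \<infinity>\<close> and therefore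
  turns the integrand, whose singularities are at these three points, into the Beta integrand.\<close>

lemma prediction_density_kernel:
  fixes \<alpha> h w :: real
  assumes \<alpha>: "0 < \<alpha>" "\<alpha> < 1" and h: "0 < h" and w: "0 < w"
  shows "((\<lambda>v. (w - v) powr (\<alpha> - 1) * prediction_density \<alpha> h v) has_integral (h + w) powr (\<alpha> - 1)) {0..w}"
proof -
  let ?f = "\<lambda>u::real. u powr (- \<alpha>) * (1 - u) powr (\<alpha> - 1)"
  let ?B = "Beta (1 - \<alpha>) \<alpha>"
  let ?k = "\<lambda>v. (w - v) powr (\<alpha> - 1) * prediction_density \<alpha> h v"
  have B: "0 < ?B" using \<alpha> by (intro Beta_pos) auto
  define u where "u v = v * (w + h) / (w * (v + h))" for v
  define u' where "u' v = (w + h) * h / (w * (v + h)\<^sup>2)" for v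
  \<comment> \<open>the inverse of \<open>u\<close>\<close>
  define r where "r z = h * w * z / (w + h - w * z)" for z
  have deriv: "(u has_field_derivative u' v) (at v within {0<..<w})" if "v \<in> {0<..<w}" for v
    using DERIV_cmult[OF moebius_has_field_derivative[OF h, of v], of "(w + h) / w" "{0<..<w}"] that
    by (simp add: u_def[abs_def] u'_def mult_ac)
  have ru: "r (u v) = v" if "v \<in> {0<..<w}" for v
  proof -
    have "w * u v = v * (w + h) / (v + h)" using w by (simp add: u_def)
    then have "w + h - w * u v = (w + h) * h / (v + h)" using that h by (simp add: field_simps)
    moreover have "h * w * u v = h * (v * (w + h) / (v + h))" using w by (simp add: u_def)
    ultimately show ?thesis using that h w by (simp add: r_def)
  qed
  have u1: "1 - u v = h * (w - v) / (w * (v + h))" if "v \<in> {0<..<w}" for v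
  proof -
    have "w * (v + h) \<noteq> 0" using that h w by auto
    then have "1 - u v = (w * (v + h) - v * (w + h)) / (w * (v + h))"
      by (simp add: u_def diff_divide_distrib)
    also have "w * (v + h) - v * (w + h) = h * (w - v)" by (simp add: algebra_simps)
    finally show ?thesis .
  qed
  have img: "u ` {0<..<w} = {0<..<1}"
  proof (intro equalityI subsetI)
    fix z assume "z \<in> u ` {0<..<w}"
    then obtain v where v: "v \<in> {0<..<w}" "z = u v" by blast
    have "0 < u v" using v h w by (simp add: u_def)
    moreover have "0 < 1 - u v" using u1[OF v(1)] v h w by simp
    ultimately show "z \<in> {0<..<1}" using v by simp
  next
    fix z :: real assume z: "z \<in> {0<..<1}"
    then have wz: "w * z < w" using w by simp
    have d: "0 < w + h - w * z" using wz h by linarith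
    have "r z < w"
    proof -
      have "h * w * z + w * (w * z) < w * (w + h)"
        using mult_strict_right_mono[of z 1 "h * w + w * w"] z add_pos_pos[of "h * w" "w * w"] h w
        by (simp add: algebra_simps)
      then have "h * w * z < w * (w + h - w * z)" by (simp add: algebra_simps)
      then show ?thesis using d unfolding r_def by (simp only: pos_divide_less_eq)
    qed
    moreover have "0 < r z" using d z h w by (simp add: r_def)
    moreover have "u (r z) = z"
    proof -
      have "r z + h = (h * w * z + h * (w + h - w * z)) / (w + h - w * z)"
        using d by (simp add: r_def add_divide_distrib)
      also have "h * w * z + h * (w + h - w * z) = h * (w + h)" by (simp add: algebra_simps)
      finally have "u (r z) = (h * w * z / (w + h - w * z)) * (w + h) / (w * (h * (w + h) / (w + h - w * z)))"
        by (simp only: u_def r_def)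
      also have "\<dots> = z" using d h w by simp
      finally show ?thesis .
    qed
    ultimately show "z \<in> u ` {0<..<w}" by (intro image_eqI[of _ _ "r z"]) auto
  qed
  have eq: "\<bar>u' v\<bar> * ?f (u v) = (?B * (h + w) powr (1 - \<alpha>)) * ?k v" if "v \<in> {0<..<w}" for v
  proof -
    have v: "0 < v" "v < w" using that by auto
    have a: "u v powr (- \<alpha>) = v powr (- \<alpha>) * (w + h) powr (- \<alpha>) * w powr \<alpha> * (v + h) powr \<alpha>"
      using v h w by (simp add: u_def powr_mult powr_divide powr_minus) (simp add: field_simps)
    have b: "(1 - u v) powr (\<alpha> - 1)
        = h powr (\<alpha> - 1) * (w - v) powr (\<alpha> - 1) * w powr (1 - \<alpha>) * (v + h) powr (1 - \<alpha>)"
      unfolding u1[OF that] using v h w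
      by (simp add: powr_mult powr_divide powr_diff mult_ac)
    have c: "\<bar>u' v\<bar> = (w + h) * h / (w * ((v + h) * (v + h)))"
      using v h w by (simp add: u'_def power2_eq_square)
    have p1: "h powr (\<alpha> - 1) = h powr \<alpha> / h" "w powr (1 - \<alpha>) = w / w powr \<alpha>"
      "(v + h) powr (1 - \<alpha>) = (v + h) / (v + h) powr \<alpha>"
      "(w + h) powr (- \<alpha>) = (h + w) powr (1 - \<alpha>) / (w + h)"
      using v h w by (simp_all add: powr_diff powr_minus divide_inverse add.commute)
    have "v + h \<noteq> 0" "w + h \<noteq> 0" "(v + h) powr \<alpha> \<noteq> 0" "w powr \<alpha> \<noteq> 0" using v h w by auto
    then show ?thesis
      unfolding a b c p1 prediction_density_def using h w B by (simp add: add.commute[of h v])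
  qed
  have "(\<lambda>v. \<bar>u' v\<bar> * ?f (u v)) absolutely_integrable_on {0<..<w} \<and>
      integral {0<..<w} (\<lambda>v. \<bar>u' v\<bar> * ?f (u v)) = ?B"
    using beta_density[OF \<alpha>]
    by (subst has_absolute_integral_change_of_variables_1'[OF _ deriv inj_on_inverseI[of _ r, OF ru]])
       (simp_all add: img)
  then have "((\<lambda>v. \<bar>u' v\<bar> * ?f (u v)) has_integral ?B) {0<..<w}"
    unfolding has_integral_iff using set_lebesgue_integral_eq_integral(1) by blast
  then have "((\<lambda>v. (?B * (h + w) powr (1 - \<alpha>)) * ?k v) has_integral ?B) {0<..<w}"
    by (rule has_integral_eq[rotated]) (rule eq)
  then have "((\<lambda>v. inverse (?B * (h + w) powr (1 - \<alpha>)) * ((?B * (h + w) powr (1 - \<alpha>)) * ?k v))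
      has_integral inverse (?B * (h + w) powr (1 - \<alpha>)) * ?B) {0<..<w}"
    by (rule has_integral_mult_right)
  moreover have "inverse (?B * (h + w) powr (1 - \<alpha>)) * ?B = (h + w) powr (\<alpha> - 1)"
    using B powr_minus[of "h + w" "1 - \<alpha>"] by simp
  moreover have "inverse (?B * (h + w) powr (1 - \<alpha>)) * ((?B * (h + w) powr (1 - \<alpha>)) * z) = z" for z
  proof -
    have "?B * (h + w) powr (1 - \<alpha>) \<noteq> 0" using B h w by simp
    moreover have "inverse c * (c * z) = z" if "c \<noteq> 0" for c :: real using that by simp
    ultimately show ?thesis by blast
  qed
  ultimately show ?thesis by (simp only: has_integral_Icc_iff_Ioo)
qed

text \<open>Here the substitution is \<open>u = v / (v + h)\<close>; the total mass on \<open>[0,\<infinity>)\<close> is the complete Beta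
  integral divided by itself.\<close>

lemma prediction_density_mass:
  fixes \<alpha> h w :: real
  assumes \<alpha>: "0 < \<alpha>" "\<alpha> < 1" and h: "0 < h" and w: "0 \<le> w"
  shows "(prediction_density \<alpha> h has_integral
     integral {0..w / (w + h)} (\<lambda>u. u powr (- \<alpha>) * (1 - u) powr (\<alpha> - 1)) / Beta (1 - \<alpha>) \<alpha>) {0..w}"
proof -
  let ?f = "\<lambda>u::real. u powr (- \<alpha>) * (1 - u) powr (\<alpha> - 1)"
  let ?B = "Beta (1 - \<alpha>) \<alpha>"
  let ?z = "w / (w + h)"
  have B: "0 < ?B" using \<alpha> by (intro Beta_pos) auto
  have z: "0 \<le> ?z" "?z < 1" using h w by auto
  define u where "u v = v / (v + h)" for v
  define u' where "u' v = h / (v + h)\<^sup>2" for v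
  have deriv: "(u has_field_derivative u' v) (at v within {0<..<w})" if "v \<in> {0<..<w}" for v
    using moebius_has_field_derivative[OF h, of v] that by (simp add: u_def[abs_def] u'_def)
  have ru: "h * u v / (1 - u v) = v" if "v \<in> {0<..<w}" for v
  proof -
    have "1 - u v = h / (v + h)" using that h by (simp add: u_def field_simps)
    then show ?thesis using that h by (simp add: u_def)
  qed
  have img: "u ` {0<..<w} = {0<..<?z}"
  proof (intro equalityI subsetI)
    fix y assume "y \<in> u ` {0<..<w}"
    then show "y \<in> {0<..<?z}" using h by (auto simp: u_def field_simps)
  next
    fix y assume y: "y \<in> {0<..<?z}"
    then have y1: "0 < y" "y < 1" using z by auto
    have "0 < w + h" using h w by simp
    then have yz: "y * (w + h) < w" using y by (simp add: pos_less_divide_eq)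
    have "h * y / (1 - y) + h = h / (1 - y)" using y1 by (simp add: field_simps)
    then have "u (h * y / (1 - y)) = y" using y1 h by (simp add: u_def)
    moreover have "h * y / (1 - y) < w" using y1 yz by (simp add: field_simps)
    ultimately show "y \<in> u ` {0<..<w}" using y1 h by (intro image_eqI[of _ _ "h * y / (1 - y)"]) auto
  qed
  have eq: "\<bar>u' v\<bar> * ?f (u v) = ?B * prediction_density \<alpha> h v" if "v \<in> {0<..<w}" for v
  proof -
    have v: "0 < v" using that by auto
    have 1: "1 - u v = h / (v + h)" using v h by (simp add: u_def field_simps)
    have a: "u v powr (- \<alpha>) = v powr (- \<alpha>) * (v + h) powr \<alpha>"
      using v h by (simp add: u_def powr_divide powr_minus) (simp add: field_simps)
    have b: "(1 - u v) powr (\<alpha> - 1) = h powr \<alpha> / h * ((v + h) / (v + h) powr \<alpha>)"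
      unfolding 1 using v h by (simp add: powr_divide powr_diff)
    have "v + h \<noteq> 0" "(v + h) powr \<alpha> \<noteq> 0" using v h by auto
    then show ?thesis
      unfolding a b prediction_density_def using v h B
      by (simp add: u'_def power2_eq_square add.commute[of h v])
  qed
  have "?f absolutely_integrable_on {0<..<?z}"
    by (rule set_integrable_subset[OF beta_density(1)[OF \<alpha>]]) (use z in auto)
  moreover have "integral {0<..<?z} ?f = integral {0..?z} ?f"
    by (rule integral_open_interval_real[symmetric])
  ultimately have "(\<lambda>v. \<bar>u' v\<bar> * ?f (u v)) absolutely_integrable_on {0<..<w} \<and>
      integral {0<..<w} (\<lambda>v. \<bar>u' v\<bar> * ?f (u v)) = integral {0..?z} ?f"
    by (subst has_absolute_integral_change_of_variables_1'
        [OF _ deriv inj_on_inverseI[of _ "\<lambda>y. h * y / (1 - y)", OF ru]])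
       (simp_all add: img)
  then have "((\<lambda>v. \<bar>u' v\<bar> * ?f (u v)) has_integral integral {0..?z} ?f) {0<..<w}"
    unfolding has_integral_iff using set_lebesgue_integral_eq_integral(1) by blast
  then have "((\<lambda>v. ?B * prediction_density \<alpha> h v) has_integral integral {0..?z} ?f) {0<..<w}"
    by (rule has_integral_eq[rotated]) (rule eq)
  then have "((\<lambda>v. inverse ?B * (?B * prediction_density \<alpha> h v)) has_integral
      inverse ?B * integral {0..?z} ?f) {0<..<w}"
    by (rule has_integral_mult_right)
  then show ?thesis using B by (simp add: has_integral_Icc_iff_Ioo field_simps)
qed

definition prediction_mass :: "real \<Rightarrow> real \<Rightarrow> real \<Rightarrow> real" where
  "prediction_mass \<alpha> h w = integral {0..w} (prediction_density \<alpha> h)"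

context
  fixes \<alpha> h :: real
  assumes \<alpha>: "0 < \<alpha>" "\<alpha> < 1" and h: "0 < h"
begin

lemma prediction_mass_has_integral:
  "0 \<le> w \<Longrightarrow> (prediction_density \<alpha> h has_integral prediction_mass \<alpha> h w) {0..w}"
  unfolding prediction_mass_def using prediction_density_mass[OF \<alpha> h] by (auto intro!: integrable_integral)

lemma prediction_mass_eq:
  "0 \<le> w \<Longrightarrow> prediction_mass \<alpha> h w =
     integral {0..w / (w + h)} (\<lambda>u. u powr (- \<alpha>) * (1 - u) powr (\<alpha> - 1)) / Beta (1 - \<alpha>) \<alpha>"
  unfolding prediction_mass_def by (rule integral_unique[OF prediction_density_mass[OF \<alpha> h]])

lemma beta_integrable: "(\<lambda>u. u powr (- \<alpha>) * (1 - u) powr (\<alpha> - 1)) integrable_on {0..1}"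
  using has_integral_Beta_real[of "1 - \<alpha>" \<alpha>] \<alpha> by (auto simp: integrable_on_def)

lemma prediction_mass_le_1: "0 \<le> w \<Longrightarrow> prediction_mass \<alpha> h w \<le> 1"
proof -
  assume w: "0 \<le> w"
  have "integral {0..w / (w + h)} (\<lambda>u. u powr (- \<alpha>) * (1 - u) powr (\<alpha> - 1))
      \<le> integral {0..1} (\<lambda>u. u powr (- \<alpha>) * (1 - u) powr (\<alpha> - 1))"
    using w h beta_integrable
    by (intro integral_subset_le integrable_on_subinterval[OF beta_integrable]) auto
  also have "\<dots> = Beta (1 - \<alpha>) \<alpha>"
    using integral_unique[OF has_integral_Beta_real[of "1 - \<alpha>" \<alpha>]] \<alpha> by simp
  finally show ?thesis using Beta_pos[of "1 - \<alpha>" \<alpha>] \<alpha> w by (simp add: prediction_mass_eq)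
qed

lemma prediction_mass_tendsto_1: "(prediction_mass \<alpha> h \<longlongrightarrow> 1) at_top"
proof -
  let ?f = "\<lambda>u. u powr (- \<alpha>) * (1 - u) powr (\<alpha> - 1)"
  have 1: "integral {0..1} ?f = Beta (1 - \<alpha>) \<alpha>"
    using integral_unique[OF has_integral_Beta_real[of "1 - \<alpha>" \<alpha>]] \<alpha> by simp
  have "continuous_on {0..1} (\<lambda>z. integral {0..z} ?f)"
    by (rule indefinite_integral_continuous_1[OF beta_integrable])
  then have "((\<lambda>z. integral {0..z} ?f) \<longlongrightarrow> Beta (1 - \<alpha>) \<alpha>) (at 1 within {0..1})"
    unfolding continuous_on_def 1[symmetric] by (rule bspec) simp
  moreover have "filterlim (\<lambda>w. w / (w + h)) (at 1 within {0..1}) at_top"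
  proof -
    have "filterlim (\<lambda>w. w + h) at_top at_top"
      using filterlim_tendsto_add_at_top[OF tendsto_const[of h] filterlim_ident] by (simp add: add.commute)
    then have "((\<lambda>w. h / (w + h)) \<longlongrightarrow> 0) at_top"
      by (intro tendsto_divide_0[OF tendsto_const] filterlim_at_top_imp_at_infinity)
    then have "((\<lambda>w. 1 - h / (w + h)) \<longlongrightarrow> 1 - 0) at_top"
      by (intro tendsto_diff tendsto_const)
    moreover have "\<forall>\<^sub>F w in at_top. 1 - h / (w + h) = w / (w + h)"
      using eventually_ge_at_top[of 0] by eventually_elim (use h in \<open>auto simp: field_simps\<close>)
    ultimately have "((\<lambda>w. w / (w + h)) \<longlongrightarrow> 1) at_top"
      using tendsto_cong[THEN iffD1, of "\<lambda>w. 1 - h / (w + h)"] by simp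
    moreover have "\<forall>\<^sub>F w in at_top. w / (w + h) \<in> {0..1} \<and> w / (w + h) \<noteq> 1"
      using eventually_ge_at_top[of 0] by eventually_elim (use h in \<open>auto simp: field_simps\<close>)
    ultimately show ?thesis unfolding filterlim_at
      by blast
  qed
  ultimately have "((\<lambda>w. integral {0..w / (w + h)} ?f) \<longlongrightarrow> Beta (1 - \<alpha>) \<alpha>) at_top"
    by (rule filterlim_compose)
  then have "((\<lambda>w. integral {0..w / (w + h)} ?f / Beta (1 - \<alpha>) \<alpha>) \<longlongrightarrow> Beta (1 - \<alpha>) \<alpha> / Beta (1 - \<alpha>) \<alpha>) at_top"
    using Beta_pos[of "1 - \<alpha>" \<alpha>] \<alpha> by (intro tendsto_intros) auto
  then have L: "((\<lambda>w. integral {0..w / (w + h)} ?f / Beta (1 - \<alpha>) \<alpha>) \<longlongrightarrow> 1) at_top"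
    using Beta_pos[of "1 - \<alpha>" \<alpha>] \<alpha> by simp
  have "\<forall>\<^sub>F w in at_top. integral {0..w / (w + h)} ?f / Beta (1 - \<alpha>) \<alpha> = prediction_mass \<alpha> h w"
    using eventually_ge_at_top[of 0] by eventually_elim (simp add: prediction_mass_eq)
  then show ?thesis by (rule Lim_transform_eventually[OF L])
qed

lemma past_density_has_integral:
  assumes "s \<le> W"
  shows "((\<lambda>\<tau>. prediction_density \<alpha> h (W - \<tau>)) has_integral prediction_mass \<alpha> h (W - s)) {s..W}"
  using has_integral_reflect_about[OF prediction_mass_has_integral[of "W - s"], of W] assms by simp

lemma past_density_absolutely_integrable:
  "(\<lambda>\<tau>. prediction_density \<alpha> h (W - \<tau>)) absolutely_integrable_on {s..W}"
proof (cases "s \<le> W")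
  case True
  then show ?thesis
    using past_density_has_integral[OF True] prediction_density_nonneg[OF \<alpha> h]
    by (intro nonnegative_absolutely_integrable_1) (auto simp: integrable_on_def)
qed auto

text \<open>main Fubini\<close>
text \<open>Averaging the fractional integral over the past with weights \<open>q(W - \<tau>)\<close> moves the evaluation
  time from \<open>W\<close> to \<open>W + h\<close>. After exchanging the integrals over the triangle \<open>0 < s < \<tau> < W\<close>, the
  inner integral in \<open>\<tau>\<close> is that of \<open>prediction_density_kernel\<close>.\<close>

lemma prediction_fubini:
  fixes y :: "real \<Rightarrow> 'b::euclidean_space"
  assumes W: "0 \<le> W" and y: "continuous_on {0..W} y"
  shows "((\<lambda>\<tau>. prediction_density \<alpha> h (W - \<tau>) *\<^sub>R kernel_integral \<alpha> 0 \<tau> y \<tau>)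
    has_integral kernel_integral \<alpha> 0 W y (W + h)) {0..W}"
proof -
  let ?q = "prediction_density \<alpha> h"
  let ?k = "\<lambda>t s. (t - s) powr (\<alpha> - 1)"
  define Y where "Y s = indicator {0..W} s *\<^sub>R y s" for s
  have Ym [measurable]: "Y \<in> borel_measurable borel"
    unfolding Y_def by (intro borel_measurable_continuous_on_indicator y) auto
  have qm [measurable]: "?q \<in> borel_measurable borel"
    unfolding prediction_density_def[abs_def] by measurable
  obtain G where "\<forall>v\<in>y ` {0..W}. norm v \<le> G"
    using compact_imp_bounded[OF compact_continuous_image[OF y compact_Icc]] unfolding bounded_iff by blast
  then have G: "\<And>s. s \<in> {0..W} \<Longrightarrow> norm (y s) \<le> G" by blast
  have G0: "0 \<le> G" using order_trans[OF norm_ge_zero G[of 0]] W by simp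
  \<comment> \<open>The open triangle avoids the end points, where the kernel and the density take default values.\<close>
  define \<Phi> where "\<Phi> \<tau> s = (if 0 < s \<and> s < \<tau> \<and> \<tau> < W then ?q (W - \<tau>) * ?k \<tau> s else 0) *\<^sub>R Y s" for \<tau> s
  have \<Phi>m: "case_prod \<Phi> \<in> borel_measurable (lborel \<Otimes>\<^sub>M lborel)"
    unfolding \<Phi>_def case_prod_beta' by measurable
  have q0: "0 \<le> ?q (W - \<tau>)" if "\<tau> \<le> W" for \<tau>
    using that by (intro prediction_density_nonneg \<alpha> h) auto
  \<comment> \<open>The inner integral over \<open>s\<close>, with an integrable bound in \<open>\<tau>\<close>, for Fubini's theorem.\<close>
  have yc: "continuous_on {0..\<tau>} y" if "\<tau> \<le> W" for \<tau>
    by (rule continuous_on_subset[OF y]) (use that in auto)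
  have inner1: "integrable lborel (\<Phi> \<tau>)"
    "(\<integral>s. \<Phi> \<tau> s \<partial>lborel) = indicator {0<..<W} \<tau> *\<^sub>R (?q (W - \<tau>) *\<^sub>R kernel_integral \<alpha> 0 \<tau> y \<tau>)"
    "(\<integral>s. norm (\<Phi> \<tau> s) \<partial>lborel) \<le> indicator {0<..<W} \<tau> *\<^sub>R (G * W powr \<alpha> / \<alpha> * ?q (W - \<tau>))" for \<tau>
  proof -
    have "integrable lborel (\<Phi> \<tau>) \<and>
      (\<integral>s. \<Phi> \<tau> s \<partial>lborel) = indicator {0<..<W} \<tau> *\<^sub>R (?q (W - \<tau>) *\<^sub>R kernel_integral \<alpha> 0 \<tau> y \<tau>) \<and>
      (\<integral>s. norm (\<Phi> \<tau> s) \<partial>lborel) \<le> indicator {0<..<W} \<tau> *\<^sub>R (G * W powr \<alpha> / \<alpha> * ?q (W - \<tau>))"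
    proof (cases "0 < \<tau> \<and> \<tau> < W")
      case False
      then have "\<Phi> \<tau> = (\<lambda>_. 0)" by (auto simp: \<Phi>_def)
      then show ?thesis using False by auto
    next
      case True
      have k: "(\<lambda>s. ?k \<tau> s *\<^sub>R y s) absolutely_integrable_on {0<..<\<tau>}"
        by (intro absolutely_integrable_Ioo kernel_scaleR_absolutely_integrable \<alpha>(1) yc) (use True in auto)
      have eqY: "indicator {0<..<\<tau>} s *\<^sub>R (?k \<tau> s *\<^sub>R y s) = (indicator {0<..<\<tau>} s * ?k \<tau> s) *\<^sub>R Y s" for s
        using True by (auto simp: Y_def indicator_def)
      have m: "(\<lambda>s. indicator {0<..<\<tau>} s *\<^sub>R (?k \<tau> s *\<^sub>R y s)) \<in> borel_measurable borel"
        unfolding eqY by measurable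
      have eq\<Phi>: "\<Phi> \<tau> s = ?q (W - \<tau>) *\<^sub>R (indicator {0<..<\<tau>} s *\<^sub>R (?k \<tau> s *\<^sub>R y s))" for s
        unfolding eqY using True by (auto simp: \<Phi>_def indicator_def)
      note L = lborel_integral_eq_integral[OF k m]
      have 1: "integrable lborel (\<Phi> \<tau>)" unfolding eq\<Phi>[abs_def] by (intro integrable_scaleR_right L)
      have 2: "(\<integral>s. \<Phi> \<tau> s \<partial>lborel) = ?q (W - \<tau>) *\<^sub>R kernel_integral \<alpha> 0 \<tau> y \<tau>"
        unfolding eq\<Phi>[abs_def] integral_open_interval_real[of 0 \<tau>] L(2)[symmetric]
        by (rule Bochner_Integration.integral_scaleR_right)
      have k1: "(\<lambda>s. ?k \<tau> s) absolutely_integrable_on {0<..<\<tau>}"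
        by (rule absolutely_integrable_Ioo[OF kernel_absolutely_integrable[OF \<alpha>(1) order_refl]])
      have m1: "(\<lambda>s. indicator {0<..<\<tau>} s *\<^sub>R ?k \<tau> s) \<in> borel_measurable borel" by measurable
      note L1 = lborel_integral_eq_integral[OF k1 m1]
      have "(\<integral>s. norm (\<Phi> \<tau> s) \<partial>lborel) \<le> (\<integral>s. (?q (W - \<tau>) * G) * (indicator {0<..<\<tau>} s *\<^sub>R ?k \<tau> s) \<partial>lborel)"
      proof (rule integral_mono)
        show "integrable lborel (\<lambda>s. norm (\<Phi> \<tau> s))" using 1 by (rule integrable_norm)
        show "integrable lborel (\<lambda>s. (?q (W - \<tau>) * G) * (indicator {0<..<\<tau>} s *\<^sub>R ?k \<tau> s))"
          by (intro integrable_mult_right L1)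
        fix s
        show "norm (\<Phi> \<tau> s) \<le> (?q (W - \<tau>) * G) * (indicator {0<..<\<tau>} s *\<^sub>R ?k \<tau> s)"
        proof (cases "s \<in> {0<..<\<tau>}")
          case s: True
          then have "norm (y s) \<le> G" using True by (intro G) auto
          then have "(?q (W - \<tau>) * ?k \<tau> s) * norm (y s) \<le> (?q (W - \<tau>) * ?k \<tau> s) * G"
            using True q0[of \<tau>] by (intro mult_left_mono mult_nonneg_nonneg) auto
          then show ?thesis unfolding eq\<Phi> using s True q0[of \<tau>] by (simp add: mult_ac)
        qed (simp add: eq\<Phi>)
      qed
      also have "\<dots> = (?q (W - \<tau>) * G) * (\<tau> powr \<alpha> / \<alpha>)"
      proof -
        have "integral {0<..<\<tau>} (?k \<tau>) = \<tau> powr \<alpha> / \<alpha>"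
          using integral_unique[OF kernel_has_integral[OF \<alpha>(1), of 0 \<tau> \<tau>]] True
          by (simp add: integral_open_interval_real)
        then show ?thesis using L1(2) by (simp only: integral_mult_right_zero)
      qed
      also have "\<dots> \<le> (?q (W - \<tau>) * G) * (W powr \<alpha> / \<alpha>)"
        using True \<alpha> G0 q0[of \<tau>] by (intro mult_left_mono divide_right_mono powr_mono2 mult_nonneg_nonneg) auto
      finally have "(\<integral>s. norm (\<Phi> \<tau> s) \<partial>lborel) \<le> G * W powr \<alpha> / \<alpha> * ?q (W - \<tau>)" by (simp add: mult_ac)
      then show ?thesis using 1 2 True by simp
    qed
    then show "integrable lborel (\<Phi> \<tau>)"
      "(\<integral>s. \<Phi> \<tau> s \<partial>lborel) = indicator {0<..<W} \<tau> *\<^sub>R (?q (W - \<tau>) *\<^sub>R kernel_integral \<alpha> 0 \<tau> y \<tau>)"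
      "(\<integral>s. norm (\<Phi> \<tau> s) \<partial>lborel) \<le> indicator {0<..<W} \<tau> *\<^sub>R (G * W powr \<alpha> / \<alpha> * ?q (W - \<tau>))"
      by blast+
  qed
  have int\<Phi>: "integrable (lborel \<Otimes>\<^sub>M lborel) (case_prod \<Phi>)"
  proof (rule lborel_pair.Fubini_integrable[OF \<Phi>m])
    have "(\<lambda>\<tau>. ?q (W - \<tau>)) absolutely_integrable_on {0<..<W}"
      using past_density_absolutely_integrable[where W = W and s = 0] by (rule absolutely_integrable_Ioo)
    moreover have "(\<lambda>\<tau>. indicator {0<..<W} \<tau> *\<^sub>R ?q (W - \<tau>)) \<in> borel_measurable borel" by measurable
    ultimately have "integrable lborel (\<lambda>\<tau>. indicator {0<..<W} \<tau> *\<^sub>R ?q (W - \<tau>))"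
      by (rule lborel_integral_eq_integral)
    then have B: "integrable lborel (\<lambda>\<tau>. G * W powr \<alpha> / \<alpha> * (indicator {0<..<W} \<tau> *\<^sub>R ?q (W - \<tau>)))"
      by (rule integrable_mult_right)
    show "integrable lborel (\<lambda>\<tau>. \<integral>s. norm (case (\<tau>, s) of (\<tau>, s) \<Rightarrow> \<Phi> \<tau> s) \<partial>lborel)"
    proof (rule Bochner_Integration.integrable_bound[OF B])
      have "(\<lambda>\<tau>. \<integral>s. norm (\<Phi> \<tau> s) \<partial>lborel) \<in> borel_measurable lborel"
        using \<Phi>m by (intro lborel.borel_measurable_lebesgue_integral) (simp add: case_prod_beta')
      then show "(\<lambda>\<tau>. \<integral>s. norm (case (\<tau>, s) of (\<tau>, s) \<Rightarrow> \<Phi> \<tau> s) \<partial>lborel) \<in> borel_measurable lborel"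
        by simp
      show "AE \<tau> in lborel. norm (\<integral>s. norm (case (\<tau>, s) of (\<tau>, s) \<Rightarrow> \<Phi> \<tau> s) \<partial>lborel)
          \<le> norm (G * W powr \<alpha> / \<alpha> * (indicator {0<..<W} \<tau> *\<^sub>R ?q (W - \<tau>)))"
      proof (rule AE_I2)
        fix \<tau>
        have "norm (\<integral>s. norm (\<Phi> \<tau> s) \<partial>lborel) = (\<integral>s. norm (\<Phi> \<tau> s) \<partial>lborel)"
          by (simp add: integral_nonneg_AE)
        also have "\<dots> \<le> \<bar>indicator {0<..<W} \<tau> *\<^sub>R (G * W powr \<alpha> / \<alpha> * ?q (W - \<tau>))\<bar>"
          using inner1(3)[of \<tau>] by (rule order_trans) (rule abs_ge_self)
        finally show "norm (\<integral>s. norm (case (\<tau>, s) of (\<tau>, s) \<Rightarrow> \<Phi> \<tau> s) \<partial>lborel)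
          \<le> norm (G * W powr \<alpha> / \<alpha> * (indicator {0<..<W} \<tau> *\<^sub>R ?q (W - \<tau>)))"
          by (simp add: mult_ac)
      qed
    qed
    show "AE \<tau> in lborel. integrable lborel (\<lambda>s. case (\<tau>, s) of (\<tau>, s) \<Rightarrow> \<Phi> \<tau> s)"
      using inner1(1) by simp
  qed
  \<comment> \<open>The inner integral over \<open>\<tau>\<close> is the shifted kernel.\<close>
  have inner2: "(\<integral>\<tau>. \<Phi> \<tau> s \<partial>lborel) = indicator {0<..<W} s *\<^sub>R (?k (W + h) s *\<^sub>R y s)" for s
  proof (cases "0 < s \<and> s < W")
    case False
    then have "\<Phi> \<tau> s = 0" for \<tau> by (auto simp: \<Phi>_def)
    then show ?thesis using False by auto
  next
    case True
    have "((\<lambda>\<tau>. ?k (W - s) (W - \<tau>) * ?q (W - \<tau>)) has_integral ?k (W + h) s) {s..W}"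
      using has_integral_reflect_about[OF prediction_density_kernel[OF \<alpha> h, of "W - s"], of W] True
      by (simp add: add_diff_eq add.commute)
    then have I: "((\<lambda>\<tau>. ?k \<tau> s * ?q (W - \<tau>)) has_integral ?k (W + h) s) {s<..<W}"
      by (simp add: has_integral_Icc_iff_Ioo)
    then have a: "(\<lambda>\<tau>. ?k \<tau> s * ?q (W - \<tau>)) absolutely_integrable_on {s<..<W}"
      using q0 by (intro nonnegative_absolutely_integrable_1) (auto simp: integrable_on_def)
    have m: "(\<lambda>\<tau>. indicator {s<..<W} \<tau> *\<^sub>R (?k \<tau> s * ?q (W - \<tau>))) \<in> borel_measurable borel" by measurable
    have "\<Phi> \<tau> s = (indicator {s<..<W} \<tau> *\<^sub>R (?k \<tau> s * ?q (W - \<tau>))) *\<^sub>R y s" for \<tau>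
      using True by (auto simp: \<Phi>_def Y_def indicator_def)
    then have "(\<integral>\<tau>. \<Phi> \<tau> s \<partial>lborel)
        = (\<integral>\<tau>. indicator {s<..<W} \<tau> *\<^sub>R (?k \<tau> s * ?q (W - \<tau>)) \<partial>lborel) *\<^sub>R y s"
      using lborel_integral_eq_integral(1)[OF a m] by simp
    also have "\<dots> = ?k (W + h) s *\<^sub>R y s"
      using lborel_integral_eq_integral(2)[OF a m] integral_unique[OF I] by simp
    finally show ?thesis using True by simp
  qed
  have "(\<integral>\<tau>. (\<integral>s. \<Phi> \<tau> s \<partial>lborel) \<partial>lborel) = (\<integral>s. (\<integral>\<tau>. \<Phi> \<tau> s \<partial>lborel) \<partial>lborel)"
    using lborel_pair.Fubini_integral[OF int\<Phi>] by simp
  also have "\<dots> = integral {0<..<W} (\<lambda>s. ?k (W + h) s *\<^sub>R y s)"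
    unfolding inner2
  proof (rule lborel_integral_eq_integral(2))
    show "(\<lambda>s. ?k (W + h) s *\<^sub>R y s) absolutely_integrable_on {0<..<W}"
      by (intro absolutely_integrable_Ioo kernel_scaleR_absolutely_integrable \<alpha>(1) y) (use h in auto)
    have eqY: "indicator {0<..<W} s *\<^sub>R (?k (W + h) s *\<^sub>R y s) = (indicator {0<..<W} s * ?k (W + h) s) *\<^sub>R Y s" for s
      by (auto simp: Y_def indicator_def)
    show "(\<lambda>s. indicator {0<..<W} s *\<^sub>R (?k (W + h) s *\<^sub>R y s)) \<in> borel_measurable borel"
      unfolding eqY by measurable
  qed
  also have "\<dots> = kernel_integral \<alpha> 0 W y (W + h)" by (rule integral_open_interval_real[symmetric])
  finally have I: "(\<integral>\<tau>. (\<integral>s. \<Phi> \<tau> s \<partial>lborel) \<partial>lborel) = kernel_integral \<alpha> 0 W y (W + h)" .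
  have "integrable lborel (\<lambda>\<tau>. \<integral>s. \<Phi> \<tau> s \<partial>lborel)"
    using lborel_pair.integrable_fst'[OF int\<Phi>] by simp
  from has_integral_integral_lborel[OF this]
  have U: "((\<lambda>\<tau>. indicator {0<..<W} \<tau> *\<^sub>R (?q (W - \<tau>) *\<^sub>R kernel_integral \<alpha> 0 \<tau> y \<tau>))
      has_integral kernel_integral \<alpha> 0 W y (W + h)) UNIV"
    unfolding I unfolding inner1(2) .
  then have "((\<lambda>\<tau>. ?q (W - \<tau>) *\<^sub>R kernel_integral \<alpha> 0 \<tau> y \<tau>)
      has_integral kernel_integral \<alpha> 0 W y (W + h)) {0<..<W}"
  proof -
    have "(\<lambda>\<tau>. indicator {0<..<W} \<tau> *\<^sub>R (?q (W - \<tau>) *\<^sub>R kernel_integral \<alpha> 0 \<tau> y \<tau>))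
      = (\<lambda>\<tau>. if \<tau> \<in> {0<..<W} then ?q (W - \<tau>) *\<^sub>R kernel_integral \<alpha> 0 \<tau> y \<tau> else 0)"
      by (auto simp: indicator_def)
    with U show ?thesis by (simp only: has_integral_restrict_UNIV)
  qed
  then show ?thesis by (simp add: has_integral_Icc_iff_Ioo)
qed

end

section \<open>Energy inequality and maximum principle\<close>

text \<open>With \<open>p = x(W + h)\<close>, the averaging identity for \<open>x\<close> is paired with \<open>p\<close>, and the products
  \<open>x\<^sub>0 \<bullet> p\<close> and \<open>x(\<tau>) \<bullet> p\<close> are split by \<open>2 v \<bullet> w \<le> |v|\<^sup>2 + |w|\<^sup>2\<close>. Their weights add up to \<open>1\<close>, so
  that half of \<open>|p|\<^sup>2\<close> remains on the left.\<close>

lemma fractional_energy_inequality: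
  fixes x y :: "real \<Rightarrow> 'b::euclidean_space"
  assumes \<alpha>: "0 < \<alpha>" "\<alpha> < 1" and h: "0 < h" and W: "0 \<le> W"
    and y: "continuous_on {0..W + h} y"
    and x: "\<And>\<tau>. \<tau> \<in> {0..W + h} \<Longrightarrow> x \<tau> = x\<^sub>0 + (1 / Gamma \<alpha>) *\<^sub>R kernel_integral \<alpha> 0 \<tau> y \<tau>"
  shows "(norm (x (W + h)))\<^sup>2 \<le> (1 - prediction_mass \<alpha> h W) * (norm x\<^sub>0)\<^sup>2
    + integral {0..W} (\<lambda>\<tau>. prediction_density \<alpha> h (W - \<tau>) * (norm (x \<tau>))\<^sup>2)
    + 2 / Gamma \<alpha> * integral {W..W + h} (\<lambda>s. (W + h - s) powr (\<alpha> - 1) * (x (W + h) \<bullet> y s))"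
proof -
  let ?q = "\<lambda>\<tau>. prediction_density \<alpha> h (W - \<tau>)"
  define c where "c = 1 / Gamma \<alpha>"
  define p where "p = x (W + h)"
  define Q where "Q = prediction_mass \<alpha> h W"
  define A where "A = kernel_integral \<alpha> 0 W y (W + h)"
  define D where "D = kernel_integral \<alpha> W (W + h) y (W + h)"
  define I where "I = integral {0..W} (\<lambda>\<tau>. ?q \<tau> * (norm (x \<tau>))\<^sup>2)"
  have yW: "continuous_on {0..W} y" "continuous_on {W..W + h} y"
    using W h by (auto intro: continuous_on_subset[OF y])
  have xc: "continuous_on {0..W} x"
  proof (rule continuous_on_eq)
    show "continuous_on {0..W} (\<lambda>\<tau>. x\<^sub>0 + (1 / Gamma \<alpha>) *\<^sub>R kernel_integral \<alpha> 0 \<tau> y \<tau>)"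
      by (intro continuous_on_add continuous_on_const continuous_on_scaleR kernel_integral_continuous \<alpha> yW)
  qed (use x h in auto)
  have 1: "((\<lambda>\<tau>. ?q \<tau> *\<^sub>R kernel_integral \<alpha> 0 \<tau> y \<tau>) has_integral A) {0..W}"
    unfolding A_def by (rule prediction_fubini[OF \<alpha> h W yW(1)])
  have "((\<lambda>\<tau>. (c *\<^sub>R (?q \<tau> *\<^sub>R kernel_integral \<alpha> 0 \<tau> y \<tau>)) \<bullet> p) has_integral (c *\<^sub>R A) \<bullet> p) {0..W}"
    using has_integral_linear[OF has_integral_cmul[OF 1, of c] bounded_linear_inner_left[of p]]
    by (simp add: o_def)
  moreover have "((\<lambda>\<tau>. ?q \<tau> * (x\<^sub>0 \<bullet> p)) has_integral Q * (x\<^sub>0 \<bullet> p)) {0..W}"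
    unfolding Q_def using past_density_has_integral[OF \<alpha> h, of 0 W] W
    by (intro has_integral_mult_left) simp
  ultimately have "((\<lambda>\<tau>. (c *\<^sub>R (?q \<tau> *\<^sub>R kernel_integral \<alpha> 0 \<tau> y \<tau>)) \<bullet> p + ?q \<tau> * (x\<^sub>0 \<bullet> p))
      has_integral (c *\<^sub>R A) \<bullet> p + Q * (x\<^sub>0 \<bullet> p)) {0..W}"
    by (rule has_integral_add)
  then have I1: "((\<lambda>\<tau>. ?q \<tau> * (x \<tau> \<bullet> p)) has_integral c * (A \<bullet> p) + Q * (x\<^sub>0 \<bullet> p)) {0..W}"
    by (rule has_integral_eq_rhs[OF has_integral_eq[rotated]])
       (use x h in \<open>auto simp: c_def inner_add_left algebra_simps\<close>)
  have "(\<lambda>\<tau>. ?q \<tau> *\<^sub>R (norm (x \<tau>))\<^sup>2) absolutely_integrable_on {0..W}"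
    by (intro abs_integrable_scaleR_continuous past_density_absolutely_integrable \<alpha> h continuous_on_power
        continuous_on_norm xc)
  then have I2: "((\<lambda>\<tau>. ?q \<tau> * (norm (x \<tau>))\<^sup>2) has_integral I) {0..W}"
    unfolding I_def using set_lebesgue_integral_eq_integral(1) by (fastforce intro: integrable_integral)
  have "((\<lambda>\<tau>. ?q \<tau> * (norm p)\<^sup>2) has_integral Q * (norm p)\<^sup>2) {0..W}"
    unfolding Q_def using past_density_has_integral[OF \<alpha> h, of 0 W] W
    by (intro has_integral_mult_left) simp
  from has_integral_mult_left[OF has_integral_add[OF I2 this], of "1 / 2"]
  have I3: "((\<lambda>\<tau>. (?q \<tau> * (norm (x \<tau>))\<^sup>2 + ?q \<tau> * (norm p)\<^sup>2) * (1 / 2)) has_integral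
      (I + Q * (norm p)\<^sup>2) * (1 / 2)) {0..W}" .
  have young: "v \<bullet> w \<le> ((norm v)\<^sup>2 + (norm w)\<^sup>2) * (1 / 2)" for v w :: 'b
  proof -
    have "0 \<le> (norm (v - w))\<^sup>2" by simp
    then show ?thesis by (simp add: power2_norm_eq_inner inner_diff_left inner_diff_right inner_commute)
  qed
  have le1: "c * (A \<bullet> p) + Q * (x\<^sub>0 \<bullet> p) \<le> (I + Q * (norm p)\<^sup>2) * (1 / 2)"
  proof (rule has_integral_le[OF I1 I3])
    fix \<tau> assume "\<tau> \<in> {0..W}"
    then have "?q \<tau> * (x \<tau> \<bullet> p) \<le> ?q \<tau> * (((norm (x \<tau>))\<^sup>2 + (norm p)\<^sup>2) * (1 / 2))"
      by (intro mult_left_mono young prediction_density_nonneg \<alpha> h) auto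
    then show "?q \<tau> * (x \<tau> \<bullet> p) \<le> (?q \<tau> * (norm (x \<tau>))\<^sup>2 + ?q \<tau> * (norm p)\<^sup>2) * (1 / 2)"
      by (simp only: distrib_left distrib_right mult.assoc)
  qed
  have "Q \<le> 1" unfolding Q_def by (rule prediction_mass_le_1[OF \<alpha> h W])
  then have le2: "(1 - Q) * (x\<^sub>0 \<bullet> p) \<le> (1 - Q) * (((norm x\<^sub>0)\<^sup>2 + (norm p)\<^sup>2) * (1 / 2))"
    by (intro mult_left_mono young) auto
  have "kernel_integral \<alpha> 0 (W + h) y (W + h) = A + D"
    unfolding A_def D_def
    using W h y by (intro Henstock_Kurzweil_Integration.integral_combine[symmetric] kernel_scaleR_integrable \<alpha>(1)) auto
  then have p: "p = x\<^sub>0 + c *\<^sub>R (A + D)" unfolding p_def c_def using x[of "W + h"] W h by simp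
  have "p \<bullet> p = (x\<^sub>0 + c *\<^sub>R (A + D)) \<bullet> p" using p by simp
  then have pp: "(norm p)\<^sup>2 = x\<^sub>0 \<bullet> p + c * (A \<bullet> p) + c * (D \<bullet> p)"
    by (simp add: power2_norm_eq_inner inner_add_left algebra_simps)
  have Dp: "D \<bullet> p = integral {W..W + h} (\<lambda>s. (W + h - s) powr (\<alpha> - 1) * (p \<bullet> y s))"
    unfolding D_def using integral_linear[OF kernel_scaleR_integrable[OF \<alpha>(1) order_refl yW(2)]
        bounded_linear_inner_left[of p]]
    by (simp add: o_def inner_commute)
  have "(norm p)\<^sup>2 \<le> (1 - Q) * (norm x\<^sub>0)\<^sup>2 + I + 2 * c * (D \<bullet> p)"
  proof -
    have "x\<^sub>0 \<bullet> p - Q * (x\<^sub>0 \<bullet> p)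
        \<le> ((norm x\<^sub>0)\<^sup>2 + (norm p)\<^sup>2 - Q * (norm x\<^sub>0)\<^sup>2 - Q * (norm p)\<^sup>2) * (1 / 2)"
      using le2 by (simp add: algebra_simps add_divide_distrib diff_divide_distrib)
    moreover have "n \<le> N - QN + I + 2 * d"
      if "z - Qz \<le> (N + n - QN - Qn) * (1 / 2)" "m + Qz \<le> (I + Qn) * (1 / 2)" "n = z + m + d"
      for n N QN Qn z Qz m d :: real using that by (simp add: field_simps)
    ultimately have "(norm p)\<^sup>2 \<le> (norm x\<^sub>0)\<^sup>2 - Q * (norm x\<^sub>0)\<^sup>2 + I + 2 * (c * (D \<bullet> p))"
      using le1 pp by blast
    then show ?thesis by (simp only: left_diff_distrib mult_1_left mult.assoc)
  qed
  then show ?thesis unfolding Dp by (simp add: p_def Q_def I_def c_def)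
qed

text \<open>Let \<open>|x|\<close> have a maximum over \<open>[0,t]\<close> at \<open>r\<close>, with value greater than \<open>\<rho>\<close>. In the energy inequality
  at time \<open>r\<close> the average of past values is at most that maximum, while for small \<open>h\<close> the drift over
  \<open>[r - h, r]\<close> is strictly negative.\<close>

lemma inward_field_norm_bound:
  fixes x :: "real \<Rightarrow> 'b::euclidean_space"
  assumes \<alpha>: "0 < \<alpha>" "\<alpha> < 1" and F: "continuous_on UNIV F" and x: "continuous_on {0..} x"
    and eq: "\<And>t. 0 \<le> t \<Longrightarrow> x t = x\<^sub>0 + (1 / Gamma \<alpha>) *\<^sub>R kernel_integral \<alpha> 0 t (\<lambda>s. F (x s)) t"
    and inward: "\<And>z. \<rho> < norm z \<Longrightarrow> z \<bullet> F z < 0" and x0: "norm x\<^sub>0 \<le> \<rho>" and t: "0 \<le> t"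
  shows "norm (x t) \<le> \<rho>"
proof (rule ccontr)
  assume "\<not> norm (x t) \<le> \<rho>"
  have "\<exists>r\<in>{0..t}. \<forall>s\<in>{0..t}. norm (x s) \<le> norm (x r)"
    using t by (intro continuous_attains_sup continuous_on_norm continuous_on_subset[OF x]) auto
  then obtain r where r: "r \<in> {0..t}" and max: "\<And>s. s \<in> {0..t} \<Longrightarrow> norm (x s) \<le> norm (x r)" by blast
  define p where "p = x r"
  have "norm (x t) \<le> norm p" using max[of t] t by (simp add: p_def)
  then have p: "\<rho> < norm p" using \<open>\<not> norm (x t) \<le> \<rho>\<close> by simp
  have "x 0 = x\<^sub>0" using eq[of 0] by simp
  then have "r \<noteq> 0" using p x0 by (auto simp: p_def)
  then have r0: "0 < r" using r by simp
  have Fx: "continuous_on {0..} (\<lambda>s. F (x s))" by (rule continuous_on_compose2[OF F x]) auto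
  define \<delta> where "\<delta> = - (p \<bullet> F p) / 2"
  have \<delta>: "0 < \<delta>" using inward[OF p] by (simp add: \<delta>_def)
  have "continuous_on {0..} (\<lambda>s. p \<bullet> F (x s))" by (intro continuous_on_inner continuous_on_const Fx)
  then obtain d where d: "d > 0" "\<And>s. s \<in> {0..} \<Longrightarrow> dist s r < d \<Longrightarrow> dist (p \<bullet> F (x s)) (p \<bullet> F (x r)) < \<delta>"
    using \<delta> r0 unfolding continuous_on_iff by (metis atLeast_iff less_imp_le)
  \<comment> \<open>The window of length \<open>h\<close> lies in \<open>[0,r]\<close> and within the range where the drift is negative.\<close>
  define h where "h = min (d / 2) r"
  define W where "W = r - h"
  have h: "0 < h" "h < d" "0 \<le> W" "W + h = r" using d r0 by (auto simp: h_def W_def)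
  have neg: "p \<bullet> F (x s) \<le> - \<delta>" if "s \<in> {W..W + h}" for s
    using d(2)[of s] that h by (auto simp: dist_real_def \<delta>_def p_def abs_less_iff)
  let ?q = "\<lambda>\<tau>. prediction_density \<alpha> h (W - \<tau>)"
  let ?Q = "prediction_mass \<alpha> h W"
  have E: "(norm (x (W + h)))\<^sup>2 \<le> (1 - ?Q) * (norm x\<^sub>0)\<^sup>2
    + integral {0..W} (\<lambda>\<tau>. ?q \<tau> * (norm (x \<tau>))\<^sup>2)
    + 2 / Gamma \<alpha> * integral {W..W + h} (\<lambda>s. (W + h - s) powr (\<alpha> - 1) * (x (W + h) \<bullet> F (x s)))"
    by (rule fractional_energy_inequality[OF \<alpha> h(1,3)]) (auto intro: eq continuous_on_subset[OF Fx])
  have "integral {0..W} (\<lambda>\<tau>. ?q \<tau> * (norm (x \<tau>))\<^sup>2) \<le> ?Q * (norm p)\<^sup>2"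
  proof (rule has_integral_le)
    have "(\<lambda>\<tau>. ?q \<tau> *\<^sub>R (norm (x \<tau>))\<^sup>2) absolutely_integrable_on {0..W}"
      by (intro abs_integrable_scaleR_continuous past_density_absolutely_integrable \<alpha> h continuous_on_power
          continuous_on_norm continuous_on_subset[OF x]) auto
    from set_lebesgue_integral_eq_integral(1)[OF this]
    show "((\<lambda>\<tau>. ?q \<tau> * (norm (x \<tau>))\<^sup>2) has_integral
        integral {0..W} (\<lambda>\<tau>. ?q \<tau> * (norm (x \<tau>))\<^sup>2)) {0..W}" by (simp add: integrable_integral)
    show "((\<lambda>\<tau>. ?q \<tau> * (norm p)\<^sup>2) has_integral ?Q * (norm p)\<^sup>2) {0..W}"
      using past_density_has_integral[OF \<alpha> h(1), of 0 W] h by (intro has_integral_mult_left) simp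
    fix \<tau> assume \<tau>: "\<tau> \<in> {0..W}"
    then have "norm (x \<tau>) \<le> norm p" using max[of \<tau>] r h by (simp add: p_def)
    then show "?q \<tau> * (norm (x \<tau>))\<^sup>2 \<le> ?q \<tau> * (norm p)\<^sup>2"
      using \<tau> by (intro mult_left_mono power_mono prediction_density_nonneg \<alpha> h) auto
  qed
  moreover have "(1 - ?Q) * (norm x\<^sub>0)\<^sup>2 \<le> (1 - ?Q) * (norm p)\<^sup>2"
    using x0 p prediction_mass_le_1[OF \<alpha> h(1,3)] by (intro mult_left_mono power_mono) auto
  moreover have "2 / Gamma \<alpha> * integral {W..W + h} (\<lambda>s. (W + h - s) powr (\<alpha> - 1) * (p \<bullet> F (x s)))
      \<le> 2 / Gamma \<alpha> * (- \<delta> * ((W + h - W) powr \<alpha> / \<alpha>))"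
    using \<alpha> h neg by (intro mult_left_mono kernel_integral_le continuous_on_inner continuous_on_const
        continuous_on_subset[OF Fx]) auto
  moreover have "2 / Gamma \<alpha> * (- \<delta> * ((W + h - W) powr \<alpha> / \<alpha>)) < 0"
    using \<alpha> h \<delta> by (intro mult_pos_neg mult_neg_pos) auto
  moreover have "(norm p)\<^sup>2 < (1 - ?Q) * (norm p)\<^sup>2 + ?Q * (norm p)\<^sup>2"
  proof -
    have "x (W + h) = p" by (simp add: h(4) p_def)
    from E[unfolded this] show ?thesis using calculation by linarith
  qed
  ultimately show False by (simp add: algebra_simps)
qed

section \<open>Global solutions from constant paths\<close>

text \<open>Banach's theorem is applied to \<open>y(t) = exp (- l t) x(t)\<close> among bounded continuous functions on
  the whole line, where \<open>max 0 t\<close> extends the functions to negative times. In this norm the integral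
  operator contracts for large \<open>l\<close>, and a single fixed point is a solution for all times.\<close>

lemma bounded_lipschitz_solution_exists:
  fixes F :: "real ^ 'd \<Rightarrow> real ^ 'd"
  assumes \<alpha>: "0 < \<alpha>" "\<alpha> < 1" and L: "L-lipschitz_on UNIV F" and B: "\<And>z. norm (F z) \<le> B"
  shows "\<exists>x. continuous_on {0..} x \<and>
    (\<forall>t\<ge>0. x t = x\<^sub>0 + (1 / Gamma \<alpha>) *\<^sub>R kernel_integral \<alpha> 0 t (\<lambda>s. F (x s)) t)"
proof -
  have G: "0 < Gamma \<alpha>" using \<alpha> by simp
  have L0: "0 \<le> L" by (rule lipschitz_on_nonneg[OF L])
  have Fc: "continuous_on UNIV F" by (rule lipschitz_on_continuous_on[OF L])
  \<comment> \<open>With this rate the contraction factor \<open>L / l powr \<alpha>\<close> is below \<open>1/2\<close>.\<close>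
  define l where "l = (2 * L + 1) powr (1 / \<alpha>)"
  have l: "0 < l" using L0 by (simp add: l_def)
  have l\<alpha>: "l powr \<alpha> = 2 * L + 1" using L0 \<alpha> by (simp add: l_def powr_powr)
  define u where "u y s = F (exp (l * s) *\<^sub>R apply_bcontfun y s)" for y :: "real \<Rightarrow>\<^sub>C (real ^ 'd)" and s
  have uc: "continuous_on A (u y)" for y A
    unfolding u_def
    by (rule continuous_on_compose2[OF Fc]) (auto intro!: continuous_intros)
  define z where "z y t = exp (- l * t) *\<^sub>R (x\<^sub>0 + (1 / Gamma \<alpha>) *\<^sub>R kernel_integral \<alpha> 0 t (u y) t)" for y t
  define \<Psi> where "\<Psi> y = Bcontfun (\<lambda>t. z y (max 0 t))" for y
  have zc: "continuous_on {0..} (z y)" for y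
    unfolding z_def
    by (intro continuous_on_halflineI continuous_on_scaleR continuous_on_add continuous_on_const
        kernel_integral_continuous \<alpha> uc continuous_on_exp continuous_on_mult continuous_on_id)
  have B0: "0 \<le> B" using order_trans[OF norm_ge_zero B] .
  have zb: "norm (z y t) \<le> norm x\<^sub>0 + (1 / Gamma \<alpha>) * (B * (Gamma \<alpha> / l powr \<alpha>))" if t: "0 \<le> t" for y t
  proof -
    have "norm (u y s) \<le> B * exp (l * s)" if "s \<in> {0..t}" for s
      using mult_left_mono[of 1 "exp (l * s)" B] B[of "exp (l * s) *\<^sub>R apply_bcontfun y s"] B0 l that
      by (simp add: u_def)
    then have K: "exp (- l * t) * norm (kernel_integral \<alpha> 0 t (u y) t) \<le> B * (Gamma \<alpha> / l powr \<alpha>)"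
      by (intro weighted_kernel_bound \<alpha> l t uc)
    have "norm (z y t) \<le> exp (- l * t) * (norm x\<^sub>0 + (1 / Gamma \<alpha>) * norm (kernel_integral \<alpha> 0 t (u y) t))"
      unfolding z_def using G by (auto intro!: mult_left_mono order_trans[OF norm_triangle_ineq])
    also have "\<dots> = exp (- l * t) * norm x\<^sub>0
        + (1 / Gamma \<alpha>) * (exp (- l * t) * norm (kernel_integral \<alpha> 0 t (u y) t))"
      by (simp only: distrib_left mult.left_commute)
    also have "\<dots> \<le> 1 * norm x\<^sub>0 + (1 / Gamma \<alpha>) * (B * (Gamma \<alpha> / l powr \<alpha>))"
      using G l t by (intro add_mono mult_left_mono K mult_right_mono) auto
    finally show ?thesis by simp
  qed
  have mem: "(\<lambda>t. z y (max 0 t)) \<in> bcontfun" for y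
    unfolding bcontfun_def
  proof (intro CollectI conjI)
    show "continuous_on UNIV (\<lambda>t. z y (max 0 t))"
      by (rule continuous_on_compose2[OF zc]) (auto intro!: continuous_intros)
    show "bounded (range (\<lambda>t. z y (max 0 t)))"
      unfolding bounded_iff
      by (intro exI[of _ "norm x\<^sub>0 + (1 / Gamma \<alpha>) * (B * (Gamma \<alpha> / l powr \<alpha>))"] ballI)
         (elim rangeE, simp only:, rule zb, simp)
  qed
  have app: "apply_bcontfun (\<Psi> y) t = z y (max 0 t)" for y t
    unfolding \<Psi>_def Bcontfun_inverse[OF mem] ..
  have "dist (\<Psi> v) (\<Psi> w) \<le> 1 / 2 * dist v w" for v w
  proof (rule dist_bound)
    fix t' :: real
    define t where "t = max 0 t'"
    have t: "0 \<le> t" by (simp add: t_def)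
    have ud: "norm (u v s - u w s) \<le> (L * dist v w) * exp (l * s)" for s
    proof -
      have "norm (u v s - u w s) \<le> L * dist (exp (l * s) *\<^sub>R apply_bcontfun v s) (exp (l * s) *\<^sub>R apply_bcontfun w s)"
        unfolding u_def dist_norm[of "F _", symmetric] by (rule lipschitz_onD[OF L]) auto
      also have "\<dots> = (L * exp (l * s)) * dist (apply_bcontfun v s) (apply_bcontfun w s)"
        by (simp add: dist_norm scaleR_diff_right[symmetric])
      also have "\<dots> \<le> (L * exp (l * s)) * dist v w"
        using L0 by (intro mult_left_mono dist_bounded) auto
      finally show ?thesis by (simp add: mult_ac)
    qed
    have K: "exp (- l * t) * norm (kernel_integral \<alpha> 0 t (\<lambda>s. u v s - u w s) t)
        \<le> (L * dist v w) * (Gamma \<alpha> / l powr \<alpha>)"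
      by (intro weighted_kernel_bound \<alpha> l t continuous_on_diff uc ud)
    have "z v t - z w t = exp (- l * t) *\<^sub>R ((1 / Gamma \<alpha>) *\<^sub>R
        (kernel_integral \<alpha> 0 t (u v) t - kernel_integral \<alpha> 0 t (u w) t))"
      unfolding z_def by (simp add: scaleR_diff_right[symmetric])
    also have "kernel_integral \<alpha> 0 t (u v) t - kernel_integral \<alpha> 0 t (u w) t
        = kernel_integral \<alpha> 0 t (\<lambda>s. u v s - u w s) t"
      by (rule kernel_integral_diff[OF \<alpha>(1) order_refl uc uc])
    finally have "norm (z v t - z w t) = (1 / Gamma \<alpha>) *
        (exp (- l * t) * norm (kernel_integral \<alpha> 0 t (\<lambda>s. u v s - u w s) t))"
      using G by simp
    also have "\<dots> \<le> (1 / Gamma \<alpha>) * ((L * dist v w) * (Gamma \<alpha> / l powr \<alpha>))"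
      using G by (intro mult_left_mono K) auto
    also have "\<dots> = L / (2 * L + 1) * dist v w" using G unfolding l\<alpha> by simp
    also have "\<dots> \<le> 1 / 2 * dist v w"
      using L0 by (intro mult_right_mono) (auto simp: field_simps)
    finally show "dist (apply_bcontfun (\<Psi> v) t') (apply_bcontfun (\<Psi> w) t') \<le> 1 / 2 * dist v w"
      by (simp only: app t_def dist_norm)
  qed
  then have "\<exists>!y. \<Psi> y = y" by (intro banach_fix_type[of "1 / 2"]) auto
  then obtain y where y: "\<Psi> y = y" by blast
  have yz: "apply_bcontfun y t = z y t" if "0 \<le> t" for t
    using app[of y t] that by (simp add: y)
  define x where "x t = exp (l * t) *\<^sub>R apply_bcontfun y t" for t
  have "x t = x\<^sub>0 + (1 / Gamma \<alpha>) *\<^sub>R kernel_integral \<alpha> 0 t (\<lambda>s. F (x s)) t" if "0 \<le> t" for t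
  proof -
    have "x t = (exp (l * t) * exp (- l * t)) *\<^sub>R (x\<^sub>0 + (1 / Gamma \<alpha>) *\<^sub>R kernel_integral \<alpha> 0 t (u y) t)"
      by (simp only: x_def yz[OF that] z_def scaleR_scaleR)
    also have "exp (l * t) * exp (- l * t) = 1" by (simp add: exp_add[symmetric])
    also have "u y = (\<lambda>s. F (x s))" by (simp add: u_def x_def fun_eq_iff)
    finally show ?thesis by simp
  qed
  moreover have "continuous_on {0..} x" unfolding x_def by (auto intro!: continuous_intros)
  ultimately show ?thesis by blast
qed

lemma closest_point_cball_outside:
  fixes z :: "'a::euclidean_space"
  assumes "0 < R" "R < norm z"
  shows "closest_point (cball 0 R) z = (R / norm z) *\<^sub>R z"
proof (rule closest_point_unique[symmetric])
  show "(R / norm z) *\<^sub>R z \<in> cball 0 R" using assms by simp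
  show "\<forall>w\<in>cball 0 R. dist z ((R / norm z) *\<^sub>R z) \<le> dist z w"
  proof
    fix w :: 'a assume w: "w \<in> cball 0 R"
    have "z - (R / norm z) *\<^sub>R z = (1 - R / norm z) *\<^sub>R z" by (simp add: scaleR_left_diff_distrib)
    then have "dist z ((R / norm z) *\<^sub>R z) = \<bar>1 - R / norm z\<bar> * norm z" by (simp add: dist_norm)
    also have "\<dots> = norm z - R"
    proof -
      have nz: "0 < norm z" using assms by linarith
      then have "R / norm z \<le> 1" using assms by simp
      then have "\<bar>1 - R / norm z\<bar> * norm z = norm z - R / norm z * norm z"
        by (simp only: abs_of_nonneg left_diff_distrib mult_1_left diff_ge_0_iff_ge)
      then show ?thesis using nz by simp
    qed
    also have "\<dots> \<le> dist z w" using w norm_triangle_ineq2[of z w] by (simp add: dist_norm)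
    finally show "dist z ((R / norm z) *\<^sub>R z) \<le> dist z w" .
  qed
qed auto

locale dissipative_volterra = volterra \<alpha> g
  for \<alpha> :: real and g :: "real ^ 'd \<Rightarrow> real ^ 'd" +
  fixes a b :: real
  assumes ab: "0 < a" "0 < b"
    and dissipative: "\<And>x. x \<bullet> g x \<le> a - b * (norm x)\<^sup>2"
begin

text \<open>Any radius that is at least \<open>R\<close> and whose square exceeds \<open>a/b\<close> would do: the field points inward
  outside such a ball.\<close>

definition invariant_radius :: "real \<Rightarrow> real" where
  "invariant_radius R = sqrt (R\<^sup>2 + a / b + 1)"

lemma invariant_radius:
  "0 < invariant_radius R" "\<bar>R\<bar> \<le> invariant_radius R" "a - b * (invariant_radius R)\<^sup>2 < 0"
proof -
  have ab': "0 < a / b" using ab by simp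
  have sq: "(invariant_radius R)\<^sup>2 = R\<^sup>2 + a / b + 1"
    unfolding invariant_radius_def using ab' by (intro real_sqrt_pow2) (simp add: add_nonneg_nonneg)
  show "0 < invariant_radius R"
    unfolding invariant_radius_def using ab' by (simp add: add_nonneg_pos add_pos_pos)
  have "sqrt (R\<^sup>2) \<le> invariant_radius R"
    unfolding invariant_radius_def using ab' by (intro real_sqrt_le_mono) simp
  then show "\<bar>R\<bar> \<le> invariant_radius R" by simp
  have "b * (R\<^sup>2 + a / b + 1) = b * R\<^sup>2 + a + b" using ab by (simp add: distrib_left)
  then show "a - b * (invariant_radius R)\<^sup>2 < 0" unfolding sq
    using ab mult_nonneg_nonneg[of b "R\<^sup>2"] zero_le_power2[of R] by linarith
qed

lemma const_path_path_space: "const_path x\<^sub>0 \<in> path_space"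
  unfolding path_space_def const_path_def by (auto intro: continuous_on_eq[OF continuous_on_const])

text \<open>Composition with the projection onto the ball of this radius makes \<open>g\<close> bounded and globally
  Lipschitz and keeps it pointing inward outside the ball. The solution of the truncated equation
  therefore stays in the ball, where the two fields agree.\<close>

lemma const_path_solution_exists:
  assumes x0: "norm x\<^sub>0 \<le> R"
  shows "\<exists>x. is_volterra_solution \<alpha> g (const_path x\<^sub>0) x \<and> (\<forall>t\<ge>0. norm (x t) \<le> invariant_radius R)"
proof -
  let ?M = "invariant_radius R"
  let ?P = "closest_point (cball (0 :: real ^ 'd) ?M)"
  note M = invariant_radius[of R]
  obtain L where L: "L-lipschitz_on (cball 0 ?M) g"
    using lipschitz_on_cball[OF locally_lipschitz] by blast
  have ne: "cball (0 :: real ^ 'd) ?M \<noteq> {}" using M by simp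
  have P: "?P z \<in> cball 0 ?M" for z by (rule closest_point_in_set[OF closed_cball ne])
  have "1-lipschitz_on UNIV ?P"
    using closest_point_lipschitz[OF convex_cball closed_cball ne] by (intro lipschitz_onI) auto
  moreover have "L-lipschitz_on (?P ` UNIV) g" using P by (intro lipschitz_on_subset[OF L]) blast
  ultimately have FL: "(L * 1)-lipschitz_on UNIV (\<lambda>z. g (?P z))" by (rule lipschitz_on_compose2)
  have "compact (g ` cball 0 ?M)" by (intro compact_continuous_image g_continuous) auto
  then obtain B where "\<forall>v\<in>g ` cball 0 ?M. norm v \<le> B" using compact_imp_bounded bounded_iff by blast
  then have B: "norm (g (?P z)) \<le> B" for z using P by blast
  obtain x where x: "continuous_on {0..} x"
    "\<And>t. 0 \<le> t \<Longrightarrow> x t = x\<^sub>0 + (1 / Gamma \<alpha>) *\<^sub>R kernel_integral \<alpha> 0 t (\<lambda>s. g (?P (x s))) t"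
    using bounded_lipschitz_solution_exists[OF \<alpha> FL B] by blast
  have xM: "norm (x t) \<le> ?M" if "0 \<le> t" for t
  proof (rule inward_field_norm_bound[OF \<alpha> lipschitz_on_continuous_on[OF FL] x _ _ that])
    show "norm x\<^sub>0 \<le> ?M" using x0 M by simp
    fix z :: "real ^ 'd" assume z: "?M < norm z"
    have Pz: "?P z = (?M / norm z) *\<^sub>R z" by (rule closest_point_cball_outside[OF M(1) z])
    have nz: "0 < norm z" using z M(1) by linarith
    have "norm (?P z) = ?M" unfolding Pz using M nz by simp
    then have neg: "?P z \<bullet> g (?P z) < 0" using dissipative[of "?P z"] M(3) by simp
    have "z = (norm z / ?M) *\<^sub>R ?P z" unfolding Pz using M nz by simp
    then have "z \<bullet> g (?P z) = (norm z / ?M) * (?P z \<bullet> g (?P z))"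
      by (metis inner_scaleR_left)
    also have "\<dots> < 0" using neg M nz by (intro mult_pos_neg) auto
    finally show "z \<bullet> g (?P z) < 0" .
  qed
  have Pid: "?P (x s) = x s" if "0 \<le> s" for s using xM[OF that] by (intro closest_point_self) simp
  define X where "X = (\<lambda>t\<in>{0..}. x t)"
  have "is_volterra_solution \<alpha> g (const_path x\<^sub>0) X"
    unfolding is_volterra_solution_def
  proof (intro conjI allI impI)
    have "continuous_on {0..} X" by (rule continuous_on_eq[OF x(1)]) (simp add: X_def)
    then show "X \<in> path_space" by (simp add: path_space_def X_def)
    fix t :: real assume t: "0 \<le> t"
    have "kernel_integral \<alpha> 0 t (\<lambda>s. g (X s)) t = kernel_integral \<alpha> 0 t (\<lambda>s. g (?P (x s))) t"
      by (intro integral_cong) (simp add: X_def Pid)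
    then show "X t = const_path x\<^sub>0 t + (1 / Gamma \<alpha>) *\<^sub>R kernel_integral \<alpha> 0 t (\<lambda>s. g (X s)) t"
      using x(2)[OF t] t by (simp add: X_def const_path_def)
  qed
  moreover have "\<forall>t\<ge>0. norm (X t) \<le> ?M" using xM by (simp add: X_def)
  ultimately show ?thesis by blast
qed

text \<open>The solution from a constant path, that is, of the Caputo equation of order \<open>\<alpha>\<close> with initial
  value \<open>x\<^sub>0\<close>.\<close>

definition sol :: "real ^ 'd \<Rightarrow> real \<Rightarrow> real ^ 'd" where
  "sol x\<^sub>0 = volterra_solution \<alpha> g (const_path x\<^sub>0)"

lemma sol: "is_volterra_solution \<alpha> g (const_path x\<^sub>0) (sol x\<^sub>0)"
  using const_path_solution_exists[OF order_refl, of x\<^sub>0] volterra_solution_eqI unfolding sol_def by auto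

lemma sol_bound: 
  assumes "norm x\<^sub>0 \<le> R" "0 \<le> t"
  shows "norm (sol x\<^sub>0 t) \<le> invariant_radius R"
proof -
  obtain x where "is_volterra_solution \<alpha> g (const_path x\<^sub>0) x" "\<forall>t\<ge>0. norm (x t) \<le> invariant_radius R"
    using const_path_solution_exists[OF assms(1)] by blast
  then show ?thesis using solution_unique[OF sol] assms(2) by blast
qed

lemma sol_path_space: "sol x\<^sub>0 \<in> path_space" using sol by (simp add: is_volterra_solution_def)

lemma sol_eq: "0 \<le> t \<Longrightarrow> sol x\<^sub>0 t = x\<^sub>0 + (1 / Gamma \<alpha>) *\<^sub>R kernel_integral \<alpha> 0 t (\<lambda>s. g (sol x\<^sub>0 s)) t"
  using solution_eq[OF sol] by (simp add: const_path_def)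

lemma g_bounded_on_cball:
  "\<exists>G\<ge>0. \<forall>z. norm z \<le> M \<longrightarrow> norm (g z) \<le> G"
proof -
  have "compact (g ` cball 0 M)" by (intro compact_continuous_image g_continuous) auto
  then obtain B where "\<forall>v\<in>g ` cball 0 M. norm v \<le> B" using compact_imp_bounded bounded_iff by blast
  then have "norm (g z) \<le> max 0 B" if "norm z \<le> M" for z using that by (force simp: le_max_iff_disj)
  then show ?thesis by (intro exI[of _ "max 0 B"]) auto
qed

lemma sol_holder:
  assumes G: "\<And>z. norm z \<le> invariant_radius R \<Longrightarrow> norm (g z) \<le> G"
    and x0: "norm x\<^sub>0 \<le> R" and st: "0 \<le> s" "s \<le> t"
  shows "norm (sol x\<^sub>0 t - sol x\<^sub>0 s) \<le> 2 * G / (\<alpha> * Gamma \<alpha>) * (t - s) powr \<alpha>"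
proof -
  let ?y = "\<lambda>s. g (sol x\<^sub>0 s)"
  have "norm (kernel_integral \<alpha> 0 t ?y t - kernel_integral \<alpha> 0 s ?y s) \<le> 2 * G * ((t - s) powr \<alpha> / \<alpha>)"
    using st by (intro fractional_integral_holder \<alpha> g_path_continuous sol_path_space G sol_bound x0) auto
  then have "(1 / Gamma \<alpha>) * norm (kernel_integral \<alpha> 0 t ?y t - kernel_integral \<alpha> 0 s ?y s)
      \<le> (1 / Gamma \<alpha>) * (2 * G * ((t - s) powr \<alpha> / \<alpha>))"
    using Gamma_pos by (intro mult_left_mono) auto
  moreover have "sol x\<^sub>0 t - sol x\<^sub>0 s = (1 / Gamma \<alpha>) *\<^sub>R (kernel_integral \<alpha> 0 t ?y t - kernel_integral \<alpha> 0 s ?y s)"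
    using st by (simp add: sol_eq scaleR_diff_right)
  ultimately show ?thesis using Gamma_pos by (simp add: mult_ac)
qed

end

section \<open>Ultimate boundedness\<close>

context dissipative_volterra
begin

text \<open>Over the last \<open>h\<close> units of time the solution moves so little that \<open>x(W + h) \<bullet> g(x(s))\<close> exceeds
  \<open>a - b |x(W + h)|\<^sup>2\<close> by at most \<open>1\<close>; this is the smallness condition on \<open>h\<close>. The term with
  \<open>|x(W + h)|\<^sup>2\<close> is then moved to the left.\<close>

lemma sol_energy:
  assumes G: "0 \<le> G" "\<And>z. norm z \<le> invariant_radius R \<Longrightarrow> norm (g z) \<le> G"
    and h: "0 < h" "2 * G / (\<alpha> * Gamma \<alpha>) * h powr \<alpha> * (G + 2 * b * invariant_radius R) \<le> 1"
    and W: "0 \<le> W" and x0: "norm x\<^sub>0 \<le> R"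
  shows "(1 + 2 * b * h powr \<alpha> / (\<alpha> * Gamma \<alpha>)) * (norm (sol x\<^sub>0 (W + h)))\<^sup>2
    \<le> (1 - prediction_mass \<alpha> h W) * (norm x\<^sub>0)\<^sup>2
      + integral {0..W} (\<lambda>\<tau>. prediction_density \<alpha> h (W - \<tau>) * (norm (sol x\<^sub>0 \<tau>))\<^sup>2)
      + 2 * b * h powr \<alpha> / (\<alpha> * Gamma \<alpha>) * ((a + 1) / b)"
proof -
  define p where "p = sol x\<^sub>0 (W + h)"
  let ?M = "invariant_radius R" and ?C = "2 * G / (\<alpha> * Gamma \<alpha>)" and ?x = "sol x\<^sub>0"
  have C: "0 \<le> ?C" using G \<alpha> Gamma_pos by simp
  have M: "norm (?x s) \<le> ?M" if "0 \<le> s" for s by (rule sol_bound[OF x0 that])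
  have pM: "norm p \<le> ?M" unfolding p_def using M W h by simp
  have drift: "p \<bullet> g (?x s) \<le> a + 1 - b * (norm p)\<^sup>2" if s: "s \<in> {W..W + h}" for s
  proof -
    have s0: "0 \<le> s" using s W by simp
    define e where "e = norm (p - ?x s)"
    have "e \<le> ?C * (W + h - s) powr \<alpha>"
      unfolding e_def p_def using s W by (intro sol_holder[OF G(2) x0]) auto
    also have "\<dots> \<le> ?C * h powr \<alpha>"
      using s \<alpha> h C by (intro mult_left_mono powr_mono2) auto
    finally have "e * (G + 2 * b * ?M) \<le> ?C * h powr \<alpha> * (G + 2 * b * ?M)"
      using G ab invariant_radius(1)[of R] by (intro mult_right_mono) auto
    then have e: "e * (G + 2 * b * ?M) \<le> 1" using h(2) by linarith
    have "(p - ?x s) \<bullet> g (?x s) \<le> e * norm (g (?x s))" unfolding e_def by (rule norm_cauchy_schwarz)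
    also have "\<dots> \<le> e * G" using G M s0 by (intro mult_left_mono) (auto simp: e_def)
    finally have 1: "(p - ?x s) \<bullet> g (?x s) \<le> e * G" .
    have "(norm p - norm (?x s)) * (norm p + norm (?x s)) \<le> e * (?M + ?M)"
    proof (rule mult_mono)
      show "norm p - norm (?x s) \<le> e" unfolding e_def by (rule norm_triangle_ineq2)
      show "norm p + norm (?x s) \<le> ?M + ?M" using pM M[OF s0] by simp
    qed (auto simp: e_def)
    then have "(norm p)\<^sup>2 - (norm (?x s))\<^sup>2 \<le> e * (2 * ?M)"
      by (simp add: power2_eq_square algebra_simps)
    then have "b * ((norm p)\<^sup>2 - (norm (?x s))\<^sup>2) \<le> b * (e * (2 * ?M))"
      using ab by (intro mult_left_mono) auto
    then have 2: "b * (norm p)\<^sup>2 - b * (norm (?x s))\<^sup>2 \<le> e * (2 * b * ?M)"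
      by (simp add: right_diff_distrib mult_ac)
    have "p \<bullet> g (?x s) = ?x s \<bullet> g (?x s) + (p - ?x s) \<bullet> g (?x s)" by (simp add: inner_diff_left)
    then show ?thesis using dissipative[of "?x s"] 1 2 e by (simp only: distrib_left)
  qed
  have gc: "continuous_on {0..W + h} (\<lambda>s. g (?x s))" by (intro g_path_continuous sol_path_space) auto
  have E: "(norm (?x (W + h)))\<^sup>2 \<le> (1 - prediction_mass \<alpha> h W) * (norm x\<^sub>0)\<^sup>2
    + integral {0..W} (\<lambda>\<tau>. prediction_density \<alpha> h (W - \<tau>) * (norm (?x \<tau>))\<^sup>2)
    + 2 / Gamma \<alpha> * integral {W..W + h} (\<lambda>s. (W + h - s) powr (\<alpha> - 1) * (?x (W + h) \<bullet> g (?x s)))"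
    by (rule fractional_energy_inequality[OF \<alpha> h(1) W gc]) (auto intro: sol_eq)
  have "integral {W..W + h} (\<lambda>s. (W + h - s) powr (\<alpha> - 1) * (p \<bullet> g (?x s)))
      \<le> (a + 1 - b * (norm p)\<^sup>2) * ((W + h - W) powr \<alpha> / \<alpha>)"
    using h W by (intro kernel_integral_le \<alpha> drift continuous_on_inner continuous_on_const
        continuous_on_subset[OF gc]) auto
  then have "2 / Gamma \<alpha> * integral {W..W + h} (\<lambda>s. (W + h - s) powr (\<alpha> - 1) * (p \<bullet> g (?x s)))
      \<le> 2 / Gamma \<alpha> * ((a + 1 - b * (norm p)\<^sup>2) * (h powr \<alpha> / \<alpha>))"
    using Gamma_pos by (intro mult_left_mono) auto
  also have "\<dots> = 2 * b * h powr \<alpha> / (\<alpha> * Gamma \<alpha>) * ((a + 1) / b - (norm p)\<^sup>2)"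
  proof -
    have "(a + 1) / b - (norm p)\<^sup>2 = (a + 1 - b * (norm p)\<^sup>2) / b" using ab by (simp add: diff_divide_distrib)
    then show ?thesis using ab by (simp only:) (simp add: mult_ac)
  qed
  finally show ?thesis using E by (simp only: p_def distrib_right right_diff_distrib mult_1_left)
qed

text \<open>The time \<open>T\<close> has to be uniform over the initial values in the ball, because a point of the
  attractor is a limit along varying initial values.\<close>

definition ultimately_bounded_by :: "real \<Rightarrow> real \<Rightarrow> bool" where
  "ultimately_bounded_by R p \<longleftrightarrow>
     (\<exists>T\<ge>0. \<forall>x\<^sub>0 t. norm x\<^sub>0 \<le> R \<longrightarrow> T \<le> t \<longrightarrow> (norm (sol x\<^sub>0 t))\<^sup>2 \<le> p)"

text \<open>An asymptotic bound \<open>p\<close> improves to a weighted mean of \<open>p\<close> and \<open>(a + 1)/b\<close>, up to \<open>e\<close>. For large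
  times the initial value and the history before \<open>T\<close> carry together the weight
  \<open>1 - Q(W - T)\<close>, which tends to \<open>0\<close>.\<close>

lemma ultimate_bound_step:
  assumes G: "0 \<le> G" "\<And>z. norm z \<le> invariant_radius R \<Longrightarrow> norm (g z) \<le> G"
    and h: "0 < h" "2 * G / (\<alpha> * Gamma \<alpha>) * h powr \<alpha> * (G + 2 * b * invariant_radius R) \<le> 1"
    and p: "ultimately_bounded_by R p" "0 \<le> p" and e: "0 < e"
    and \<gamma>: "\<gamma> = 2 * b * h powr \<alpha> / (\<alpha> * Gamma \<alpha>)"
  shows "ultimately_bounded_by R ((p + e + \<gamma> * ((a + 1) / b)) / (1 + \<gamma>))"
proof -
  let ?M = "invariant_radius R" and ?Q = "prediction_mass \<alpha> h"
  have \<gamma>0: "0 \<le> \<gamma>" unfolding \<gamma> using ab \<alpha> Gamma_pos by simp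
  obtain T where T: "0 \<le> T" "\<And>x\<^sub>0 t. norm x\<^sub>0 \<le> R \<Longrightarrow> T \<le> t \<Longrightarrow> (norm (sol x\<^sub>0 t))\<^sup>2 \<le> p"
    using p(1) unfolding ultimately_bounded_by_def by blast
  have "((\<lambda>w. ?M\<^sup>2 * (1 - ?Q w)) \<longlongrightarrow> ?M\<^sup>2 * (1 - 1)) at_top"
    by (intro tendsto_intros prediction_mass_tendsto_1 \<alpha> h)
  then have "\<forall>\<^sub>F w in at_top. ?M\<^sup>2 * (1 - ?Q w) < e" using e by (intro order_tendstoD(2)) auto
  then obtain S where S: "\<And>w. S \<le> w \<Longrightarrow> ?M\<^sup>2 * (1 - ?Q w) < e"
    unfolding eventually_at_top_linorder by blast
  show ?thesis
    unfolding ultimately_bounded_by_def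
  proof (intro exI[of _ "T + max 0 S + h"] conjI allI impI)
    show "0 \<le> T + max 0 S + h" using T h by simp
    fix x\<^sub>0 :: "real ^ 'd" and t assume x0: "norm x\<^sub>0 \<le> R" and t: "T + max 0 S + h \<le> t"
    define W where "W = t - h"
    have W: "0 \<le> T" "T \<le> W" "0 \<le> W" "0 \<le> W - T" "S \<le> W - T" "W + h = t" using T t by (auto simp: W_def)
    let ?q = "\<lambda>\<tau>. prediction_density \<alpha> h (W - \<tau>)"
    let ?u = "\<lambda>\<tau>. (norm (sol x\<^sub>0 \<tau>))\<^sup>2"
    have q0: "0 \<le> ?q \<tau>" if "\<tau> \<le> W" for \<tau> using that by (intro prediction_density_nonneg \<alpha> h) auto
    have M: "?u s \<le> ?M\<^sup>2" if "0 \<le> s" for s by (intro power_mono sol_bound[OF x0 that]) auto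
    have i: "(\<lambda>\<tau>. ?q \<tau> * ?u \<tau>) integrable_on {c..d}" if "0 \<le> c" "d = W" for c d
    proof -
      have "(\<lambda>\<tau>. ?q \<tau> *\<^sub>R ?u \<tau>) absolutely_integrable_on {c..W}"
        using that by (intro abs_integrable_scaleR_continuous past_density_absolutely_integrable \<alpha> h
            continuous_on_power continuous_on_norm path_space_continuous_on sol_path_space) auto
      from set_lebesgue_integral_eq_integral(1)[OF this] show ?thesis using that by simp
    qed
    have i0: "(\<lambda>\<tau>. ?q \<tau> * ?u \<tau>) integrable_on {0..T}"
      by (rule integrable_on_subinterval[OF i[OF order_refl refl]]) (use W in auto)
    have q1: "(?q has_integral ?Q W) {0..W}" "(?q has_integral ?Q (W - T)) {T..W}"
      using past_density_has_integral[OF \<alpha> h(1), of 0 W] past_density_has_integral[OF \<alpha> h(1), of T W] W by auto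
    have q2: "?q integrable_on {0..T}"
      by (rule integrable_on_subinterval[of ?q "{0..W}"]) (use q1(1) W in \<open>auto simp: integrable_on_def\<close>)
    have "integral {0..T} ?q + integral {T..W} ?q = integral {0..W} ?q"
      using W q1(1) by (intro Henstock_Kurzweil_Integration.integral_combine) (auto simp: integrable_on_def)
    then have q3: "integral {0..T} ?q = ?Q W - ?Q (W - T)"
      using integral_unique[OF q1(1)] integral_unique[OF q1(2)] by simp
    have "integral {0..T} (\<lambda>\<tau>. ?q \<tau> * ?u \<tau>) \<le> integral {0..T} (\<lambda>\<tau>. ?q \<tau> * ?M\<^sup>2)"
      using W by (intro integral_le i0 integrable_on_mult_left q2 mult_left_mono M q0) auto
    also have "\<dots> = (?Q W - ?Q (W - T)) * ?M\<^sup>2" by (simp only: integral_mult_left q3)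
    finally have I1: "integral {0..T} (\<lambda>\<tau>. ?q \<tau> * ?u \<tau>) \<le> (?Q W - ?Q (W - T)) * ?M\<^sup>2" .
    have q4: "?q integrable_on {T..W}" using q1(2) by (auto simp: integrable_on_def)
    have "integral {T..W} (\<lambda>\<tau>. ?q \<tau> * ?u \<tau>) \<le> integral {T..W} (\<lambda>\<tau>. ?q \<tau> * p)"
      using W T(2)[OF x0] by (intro integral_le i integrable_on_mult_left q4 mult_left_mono q0) auto
    also have "\<dots> = ?Q (W - T) * p" using integral_unique[OF q1(2)] by (simp only: integral_mult_left)
    also have "\<dots> \<le> 1 * p" using p(2) prediction_mass_le_1[OF \<alpha> h(1) W(4)] by (intro mult_right_mono)
    finally have I2: "integral {T..W} (\<lambda>\<tau>. ?q \<tau> * ?u \<tau>) \<le> p" by simp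
    have I: "integral {0..W} (\<lambda>\<tau>. ?q \<tau> * ?u \<tau>)
        = integral {0..T} (\<lambda>\<tau>. ?q \<tau> * ?u \<tau>) + integral {T..W} (\<lambda>\<tau>. ?q \<tau> * ?u \<tau>)"
      using W by (intro Henstock_Kurzweil_Integration.integral_combine[symmetric] i) auto
    have "(norm x\<^sub>0)\<^sup>2 \<le> ?M\<^sup>2" using M[of 0] sol_eq[of 0 x\<^sub>0] by simp
    then have I0: "(1 - ?Q W) * (norm x\<^sub>0)\<^sup>2 \<le> (1 - ?Q W) * ?M\<^sup>2"
      using prediction_mass_le_1[OF \<alpha> h(1) W(3)] by (intro mult_left_mono) auto
    have "(1 + \<gamma>) * ?u t \<le> (1 - ?Q W) * (norm x\<^sub>0)\<^sup>2 + integral {0..W} (\<lambda>\<tau>. ?q \<tau> * ?u \<tau>) + \<gamma> * ((a + 1) / b)"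
      using sol_energy[OF G h W(3) x0] unfolding \<gamma> W(6) .
    also have "\<dots> \<le> ?M\<^sup>2 * (1 - ?Q (W - T)) + p + \<gamma> * ((a + 1) / b)"
      using I0 I1 I2 unfolding I by (simp add: algebra_simps)
    also have "\<dots> \<le> p + e + \<gamma> * ((a + 1) / b)" using S[OF W(5)] by simp
    finally show "?u t \<le> (p + e + \<gamma> * ((a + 1) / b)) / (1 + \<gamma>)"
      using \<gamma>0 by (simp add: pos_le_divide_eq mult.commute)
  qed
qed

definition ultimate_radius :: real where
  "ultimate_radius = sqrt ((a + 1) / b + 1)"

text \<open>By the preceding lemma the infimum of all asymptotic bounds is at most \<open>(a + 1)/b\<close>.\<close>

lemma ultimate_bound: "ultimately_bounded_by R (ultimate_radius\<^sup>2)"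
proof -
  let ?M = "invariant_radius R"
  define \<beta> where "\<beta> = (a + 1) / b"
  have \<beta>0: "0 < \<beta>" using ab by (simp add: \<beta>_def)
  obtain G where G: "0 \<le> G" "\<And>z. norm z \<le> ?M \<Longrightarrow> norm (g z) \<le> G"
    using g_bounded_on_cball[of ?M] by blast
  define D where "D = 2 * G / (\<alpha> * Gamma \<alpha>) * (G + 2 * b * ?M)"
  have D0: "0 \<le> D" unfolding D_def using G ab \<alpha> Gamma_pos invariant_radius(1)[of R] by simp
  \<comment> \<open>chosen so that \<open>D * h powr \<alpha> \<le> 1\<close>, the condition on \<open>h\<close> of the energy estimate\<close>
  define h where "h = (1 / (D + 1)) powr (1 / \<alpha>)"
  have h: "0 < h" using D0 by (simp add: h_def)
  have "h powr \<alpha> = 1 / (D + 1)" using D0 \<alpha> by (simp add: h_def powr_powr)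
  then have "D * h powr \<alpha> = D / (D + 1)" by simp
  also have "\<dots> \<le> 1" using D0 by simp
  finally have "D * h powr \<alpha> \<le> 1" .
  then have h1: "2 * G / (\<alpha> * Gamma \<alpha>) * h powr \<alpha> * (G + 2 * b * ?M) \<le> 1"
    unfolding D_def by (simp only: mult_ac)
  define \<gamma> where "\<gamma> = 2 * b * h powr \<alpha> / (\<alpha> * Gamma \<alpha>)"
  have \<gamma>0: "0 < \<gamma>" unfolding \<gamma>_def using ab \<alpha> Gamma_pos h by simp
  define P where "P = {p. 0 \<le> p \<and> ultimately_bounded_by R p}"
  have "?M\<^sup>2 \<in> P"
    unfolding P_def ultimately_bounded_by_def by (auto intro!: exI[of _ 0] power_mono sol_bound)
  then have ne: "P \<noteq> {}" by blast
  have bdd: "bdd_below P" by (rule bdd_belowI[of _ 0]) (simp add: P_def)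
  have step: "Inf P \<le> (p + e + \<gamma> * \<beta>) / (1 + \<gamma>)" if "p \<in> P" "0 < e" for p e
  proof (rule cInf_lower[OF _ bdd])
    have "0 \<le> (p + e + \<gamma> * \<beta>) / (1 + \<gamma>)" using that \<gamma>0 \<beta>0 by (simp add: P_def)
    then show "(p + e + \<gamma> * \<beta>) / (1 + \<gamma>) \<in> P"
      using ultimate_bound_step[OF G h h1, of p e \<gamma>] that by (simp add: P_def \<gamma>_def \<beta>_def)
  qed
  have "\<gamma> * Inf P \<le> \<gamma> * \<beta> + e" if e: "0 < e" for e
  proof -
    have "Inf P * (1 + \<gamma>) - e - \<gamma> * \<beta> \<le> Inf P"
    proof (rule cInf_greatest[OF ne])
      fix p assume "p \<in> P"
      from step[OF this e] show "Inf P * (1 + \<gamma>) - e - \<gamma> * \<beta> \<le> p"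
        using \<gamma>0 by (simp add: pos_le_divide_eq)
    qed
    then show ?thesis by (simp add: algebra_simps)
  qed
  then have "\<gamma> * Inf P \<le> \<gamma> * \<beta>" by (rule field_le_epsilon)
  then have "Inf P < \<beta> + 1" using \<gamma>0 by simp
  then obtain p where "p \<in> P" "p < \<beta> + 1" using cInf_lessD[OF ne] by blast
  moreover have "ultimate_radius\<^sup>2 = \<beta> + 1" unfolding ultimate_radius_def \<beta>_def using \<beta>0 ab by simp
  ultimately show ?thesis unfolding P_def ultimately_bounded_by_def by fastforce
qed

lemma ultimate_bound_norm:
  obtains T where "0 \<le> T" "\<And>x\<^sub>0 t. norm x\<^sub>0 \<le> R \<Longrightarrow> T \<le> t \<Longrightarrow> norm (sol x\<^sub>0 t) \<le> ultimate_radius"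
proof -
  have r: "0 \<le> ultimate_radius" unfolding ultimate_radius_def using ab by simp
  obtain T where T: "0 \<le> T" "\<forall>x\<^sub>0 t. norm x\<^sub>0 \<le> R \<longrightarrow> T \<le> t \<longrightarrow> (norm (sol x\<^sub>0 t))\<^sup>2 \<le> ultimate_radius\<^sup>2"
    using ultimate_bound[of R] unfolding ultimately_bounded_by_def by blast
  then show ?thesis using that[OF T(1)] power2_le_imp_le[OF _ r] by blast
qed

end

section \<open>The attractor\<close>

context dissipative_volterra
begin

abbreviation orbit :: "real \<Rightarrow> real ^ 'd \<Rightarrow> real \<Rightarrow> real ^ 'd" where
  "orbit t x\<^sub>0 \<equiv> volterra_semiflow \<alpha> g t (const_path x\<^sub>0)"

lemma orbit_path_space: "0 \<le> t \<Longrightarrow> orbit t x\<^sub>0 \<in> path_space"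
  by (rule semiflow_path_space[OF sol const_path_path_space])

lemma orbit_apply:
  "0 \<le> t \<Longrightarrow> 0 \<le> \<theta> \<Longrightarrow> orbit t x\<^sub>0 \<theta>
    = x\<^sub>0 + (1 / Gamma \<alpha>) *\<^sub>R kernel_integral \<alpha> 0 t (\<lambda>s. g (sol x\<^sub>0 s)) (t + \<theta>)"
  using semiflow_apply[OF sol] by (simp add: const_path_def)

lemma orbit_0: "0 \<le> t \<Longrightarrow> orbit t x\<^sub>0 0 = sol x\<^sub>0 t"
  by (simp add: orbit_apply sol_eq)

lemma orbit_add: "0 \<le> t \<Longrightarrow> 0 \<le> r \<Longrightarrow> volterra_semiflow \<alpha> g r (orbit t x\<^sub>0) = orbit (t + r) x\<^sub>0"
  by (rule semiflow_semigroup[OF sol const_path_path_space])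

lemma orbit_solution:
  "0 \<le> t \<Longrightarrow> is_volterra_solution \<alpha> g (orbit t x\<^sub>0) (\<lambda>\<theta>\<in>{0..}. sol x\<^sub>0 (t + \<theta>))"
  by (rule semiflow_solution[OF sol const_path_path_space])

text \<open>The constants depend on \<open>R\<close> but not on \<open>t\<close>, because the bound on kernel increments does not
  depend on the length of the history.\<close>

lemma orbit_holder:
  assumes G: "\<And>z. norm z \<le> invariant_radius R \<Longrightarrow> norm (g z) \<le> G"
    and x0: "norm x\<^sub>0 \<le> R" and t: "0 \<le> t"
  shows "orbit t x\<^sub>0 \<in> holder_paths \<alpha> (invariant_radius R) (G / (\<alpha> * Gamma \<alpha>))"
  unfolding holder_paths_def
proof (intro CollectI conjI allI impI orbit_path_space t)
  show "norm (orbit t x\<^sub>0 0) \<le> invariant_radius R" using t sol_bound[OF x0 t] by (simp add: orbit_0)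
  fix s u :: real assume su: "0 \<le> s" "s \<le> u"
  let ?I = "\<lambda>r. kernel_integral \<alpha> 0 t (\<lambda>s. g (sol x\<^sub>0 s)) (t + r)"
  have "norm (?I u - ?I s) \<le> G * ((t + u - (t + s)) powr \<alpha> / \<alpha>)"
    using su t by (intro kernel_increment_bound \<alpha> g_path_continuous sol_path_space G sol_bound[OF x0]) auto
  then have "(1 / Gamma \<alpha>) * norm (?I u - ?I s) \<le> (1 / Gamma \<alpha>) * (G * ((u - s) powr \<alpha> / \<alpha>))"
    using Gamma_pos by (intro mult_left_mono) auto
  moreover have "orbit t x\<^sub>0 u - orbit t x\<^sub>0 s = (1 / Gamma \<alpha>) *\<^sub>R (?I u - ?I s)"
    using su t by (simp add: orbit_apply scaleR_diff_right)
  ultimately show "norm (orbit t x\<^sub>0 u - orbit t x\<^sub>0 s) \<le> G / (\<alpha> * Gamma \<alpha>) * (u - s) powr \<alpha>"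
    using Gamma_pos by (simp add: mult_ac)
qed

text \<open>The Holder constant that comes from the ultimate ball does not depend on the initial value. The
  history before \<open>T\<close>, when the solution may still be outside that ball, contributes only an error that
  vanishes as \<open>t\<close> grows because the kernel decays.\<close>

lemma orbit_late_increment:
  assumes G: "\<And>z. norm z \<le> invariant_radius R \<Longrightarrow> norm (g z) \<le> G"
    and G': "\<And>z. norm z \<le> ultimate_radius \<Longrightarrow> norm (g z) \<le> G'"
    and T: "0 \<le> T" "\<And>s. T \<le> s \<Longrightarrow> norm (sol x\<^sub>0 s) \<le> ultimate_radius"
    and x0: "norm x\<^sub>0 \<le> R" and t: "T < t" and su: "0 \<le> s" "s \<le> u"
  shows "norm (orbit t x\<^sub>0 u - orbit t x\<^sub>0 s)
    \<le> G' / (\<alpha> * Gamma \<alpha>) * (u - s) powr \<alpha> + 2 * G * T / Gamma \<alpha> * (t - T) powr (\<alpha> - 1)"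
proof -
  let ?y = "\<lambda>s. g (sol x\<^sub>0 s)"
  let ?I = "\<lambda>c d r. kernel_integral \<alpha> c d ?y (t + r)"
  have t0: "0 \<le> t" using t T by simp
  have G0: "0 \<le> G" using order_trans[OF norm_ge_zero G[of 0]] invariant_radius(1)[of R] by simp
  have split: "?I 0 t r = ?I 0 T r + ?I T t r" if "0 \<le> r" for r
    using that t T by (intro kernel_integral_combine[symmetric] g_path_continuous sol_path_space) auto
  have early: "norm (?I 0 T r) \<le> (t - T) powr (\<alpha> - 1) * G * T" if "0 \<le> r" for r
  proof -
    have "(\<lambda>v. ((t + r - v) powr (\<alpha> - 1)) *\<^sub>R ?y v) integrable_on {0..T}"
      using that t by (intro kernel_scaleR_integrable \<alpha> g_path_continuous sol_path_space) auto
    then have "((\<lambda>v. ((t + r - v) powr (\<alpha> - 1)) *\<^sub>R ?y v) has_integral ?I 0 T r) (cbox 0 T)"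
      by (simp add: integrable_integral)
    then have "norm (?I 0 T r) \<le> ((t - T) powr (\<alpha> - 1) * G) * measure lborel (cbox 0 T)"
    proof (rule has_integral_bound[rotated])
      show "0 \<le> (t - T) powr (\<alpha> - 1) * G" using G0 by simp
      fix v assume v: "v \<in> cbox 0 T"
      have "(t + r - v) powr (\<alpha> - 1) \<le> (t - T) powr (\<alpha> - 1)"
        using v t that \<alpha> by (intro powr_mono2') auto
      moreover have "norm (?y v) \<le> G" using v by (intro G sol_bound[OF x0]) auto
      ultimately show "norm (((t + r - v) powr (\<alpha> - 1)) *\<^sub>R ?y v) \<le> (t - T) powr (\<alpha> - 1) * G"
        by (simp add: mult_mono)
    qed
    then show ?thesis using T by simp
  qed
  have "norm (?I T t u - ?I T t s) \<le> G' * ((t + u - (t + s)) powr \<alpha> / \<alpha>)"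
    using su t T by (intro kernel_increment_bound \<alpha> g_path_continuous sol_path_space G' T(2)) auto
  moreover have "norm (?I 0 T u - ?I 0 T s) \<le> 2 * ((t - T) powr (\<alpha> - 1) * G * T)"
    using norm_triangle_ineq4[of "?I 0 T u" "?I 0 T s"] early[of u] early[of s] su by simp
  moreover have "?I 0 t u - ?I 0 t s = (?I T t u - ?I T t s) + (?I 0 T u - ?I 0 T s)"
    using split[of u] split[of s] su by simp
  ultimately have "norm (?I 0 t u - ?I 0 t s) \<le> G' * ((u - s) powr \<alpha> / \<alpha>) + 2 * ((t - T) powr (\<alpha> - 1) * G * T)"
    using norm_triangle_ineq[of "?I T t u - ?I T t s" "?I 0 T u - ?I 0 T s"] by simp
  then have "(1 / Gamma \<alpha>) * norm (?I 0 t u - ?I 0 t s)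
      \<le> (1 / Gamma \<alpha>) * (G' * ((u - s) powr \<alpha> / \<alpha>) + 2 * ((t - T) powr (\<alpha> - 1) * G * T))"
    using Gamma_pos by (intro mult_left_mono) auto
  also have "\<dots> = G' / (\<alpha> * Gamma \<alpha>) * (u - s) powr \<alpha> + 2 * G * T / Gamma \<alpha> * (t - T) powr (\<alpha> - 1)"
    by (simp add: add_divide_distrib mult_ac)
  finally have "(1 / Gamma \<alpha>) * norm (?I 0 t u - ?I 0 t s)
      \<le> G' / (\<alpha> * Gamma \<alpha>) * (u - s) powr \<alpha> + 2 * G * T / Gamma \<alpha> * (t - T) powr (\<alpha> - 1)" .
  moreover have "orbit t x\<^sub>0 u - orbit t x\<^sub>0 s = (1 / Gamma \<alpha>) *\<^sub>R (?I 0 t u - ?I 0 t s)"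
    using su t0 by (simp add: orbit_apply scaleR_diff_right)
  ultimately show ?thesis using Gamma_pos by simp
qed

lemma attractorE:
  assumes "f \<in> volterra_attractor \<alpha> g"
  obtains x :: "nat \<Rightarrow> real ^ 'd" and \<tau> R where "f \<in> path_space" "\<forall>n. norm (x n) \<le> R" "\<forall>n. 0 \<le> \<tau> n"
    "filterlim \<tau> at_top sequentially" "(\<lambda>n. path_dist (orbit (\<tau> n) (x n)) f) \<longlonglongrightarrow> 0"
proof -
  obtain x :: "nat \<Rightarrow> real ^ 'd" and \<tau> where *: "f \<in> path_space" "bounded (range x)" "\<forall>n. 0 \<le> \<tau> n"
    "filterlim \<tau> at_top sequentially" "(\<lambda>n. path_dist (orbit (\<tau> n) (x n)) f) \<longlonglongrightarrow> 0"
    using assms unfolding volterra_attractor_def by blast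
  moreover obtain R where "\<forall>n. norm (x n) \<le> R" using *(2) unfolding bounded_iff by blast
  ultimately show ?thesis using that by blast
qed

lemma attractorI:
  fixes x :: "nat \<Rightarrow> real ^ 'd"
  assumes "f \<in> path_space" "\<And>n. norm (x n) \<le> R" "\<And>n. 0 \<le> \<tau> n"
    "filterlim \<tau> at_top sequentially" "(\<lambda>n. path_dist (orbit (\<tau> n) (x n)) f) \<longlonglongrightarrow> 0"
  shows "f \<in> volterra_attractor \<alpha> g"
proof -
  have "bounded (range x)" using assms(2) unfolding bounded_iff by blast
  then show ?thesis unfolding volterra_attractor_def using assms by blast
qed

lemma orbit_limit_pointwise:
  assumes f: "f \<in> path_space" and \<tau>: "\<And>n. 0 \<le> \<tau> n"
    and lim: "(\<lambda>n. path_dist (orbit (\<tau> n) (x n)) f) \<longlonglongrightarrow> 0" and \<theta>: "0 \<le> \<theta>"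
  shows "(\<lambda>n. orbit (\<tau> n) (x n) \<theta>) \<longlonglongrightarrow> f \<theta>"
proof -
  have "uniform_limit {0..\<theta>} (\<lambda>n. orbit (\<tau> n) (x n)) f sequentially"
    using path_dist_tendsto_iff[of "\<lambda>n. orbit (\<tau> n) (x n)" f] orbit_path_space \<tau> f lim by blast
  then show ?thesis by (rule tendsto_uniform_limitI) (use \<theta> in simp)
qed

text \<open>The bounds at late times pass to the limit, where the error from the early history has vanished.\<close>

lemma attractor_subset_holder_paths:
  "\<exists>C\<ge>0. volterra_attractor \<alpha> g \<subseteq> holder_paths \<alpha> ultimate_radius C"
proof -
  obtain G' where G': "0 \<le> G'" "\<And>z. norm z \<le> ultimate_radius \<Longrightarrow> norm (g z) \<le> G'"
    using g_bounded_on_cball[of ultimate_radius] by blast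
  let ?C = "G' / (\<alpha> * Gamma \<alpha>)"
  have "f \<in> holder_paths \<alpha> ultimate_radius ?C" if A: "f \<in> volterra_attractor \<alpha> g" for f
  proof -
    obtain x :: "nat \<Rightarrow> real ^ 'd" and \<tau> R where f: "f \<in> path_space" and x: "\<forall>n. norm (x n) \<le> R" and \<tau>0: "\<forall>n. 0 \<le> \<tau> n"
      and \<tau>: "filterlim \<tau> at_top sequentially" and lim: "(\<lambda>n. path_dist (orbit (\<tau> n) (x n)) f) \<longlonglongrightarrow> 0"
      by (rule attractorE[OF A])
    obtain G where G: "0 \<le> G" "\<And>z. norm z \<le> invariant_radius R \<Longrightarrow> norm (g z) \<le> G"
      using g_bounded_on_cball[of "invariant_radius R"] by blast
    obtain T where T: "0 \<le> T" "\<And>x\<^sub>0 t. norm x\<^sub>0 \<le> R \<Longrightarrow> T \<le> t \<Longrightarrow> norm (sol x\<^sub>0 t) \<le> ultimate_radius"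
      using ultimate_bound_norm by blast
    have late: "\<forall>\<^sub>F n in sequentially. T < \<tau> n" using \<tau> by (simp add: filterlim_at_top_dense)
    have pt: "(\<lambda>n. orbit (\<tau> n) (x n) \<theta>) \<longlonglongrightarrow> f \<theta>" if "0 \<le> \<theta>" for \<theta>
      using \<tau>0 by (intro orbit_limit_pointwise f lim that) auto
    show ?thesis
      unfolding holder_paths_def
    proof (intro CollectI conjI allI impI f)
      show "norm (f 0) \<le> ultimate_radius"
      proof (rule tendsto_upperbound[OF tendsto_norm[OF pt[OF order_refl]]])
        show "\<forall>\<^sub>F n in sequentially. norm (orbit (\<tau> n) (x n) 0) \<le> ultimate_radius"
          using late by eventually_elim (use T x \<tau>0 in \<open>simp add: orbit_0\<close>)
      qed simp
      fix s u :: real assume su: "0 \<le> s" "s \<le> u"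
      have u: "0 \<le> u" using su by simp
      have "filterlim (\<lambda>n. \<tau> n - T) at_top sequentially"
        using filterlim_tendsto_add_at_top[OF tendsto_const[of "- T"] \<tau>] by simp
      then have "(\<lambda>n. (\<tau> n - T) powr (\<alpha> - 1)) \<longlonglongrightarrow> 0"
        using \<alpha> by (intro tendsto_neg_powr) auto
      then have "(\<lambda>n. ?C * (u - s) powr \<alpha> + 2 * G * T / Gamma \<alpha> * (\<tau> n - T) powr (\<alpha> - 1))
          \<longlonglongrightarrow> ?C * (u - s) powr \<alpha> + 2 * G * T / Gamma \<alpha> * 0"
        by (intro tendsto_add tendsto_mult tendsto_const)
      then have "(\<lambda>n. ?C * (u - s) powr \<alpha> + 2 * G * T / Gamma \<alpha> * (\<tau> n - T) powr (\<alpha> - 1))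
          \<longlonglongrightarrow> ?C * (u - s) powr \<alpha>" by simp
      moreover have "\<forall>\<^sub>F n in sequentially. norm (orbit (\<tau> n) (x n) u - orbit (\<tau> n) (x n) s)
          \<le> ?C * (u - s) powr \<alpha> + 2 * G * T / Gamma \<alpha> * (\<tau> n - T) powr (\<alpha> - 1)"
        using late
      proof eventually_elim
        case (elim n)
        show ?case
          by (rule orbit_late_increment[OF G(2) G'(2) T(1) T(2) _ elim su]) (use x in auto)
      qed
      ultimately show "norm (f u - f s) \<le> ?C * (u - s) powr \<alpha>"
        by (rule tendsto_le[OF sequentially_bot _ tendsto_norm[OF tendsto_diff[OF pt[OF u] pt[OF su(1)]]]])
    qed
  qed
  moreover have "0 \<le> ?C" using G' \<alpha> Gamma_pos by simp
  ultimately show ?thesis by blast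
qed

lemma attractor_precompact: "precompact_in path_topology (volterra_attractor \<alpha> g)"
proof -
  obtain C where C: "0 \<le> C" "volterra_attractor \<alpha> g \<subseteq> holder_paths \<alpha> ultimate_radius C"
    using attractor_subset_holder_paths by blast
  let ?K = "holder_paths \<alpha> ultimate_radius C :: (real \<Rightarrow> real ^ 'd) set"
  interpret M: Metric_space "path_space :: (real \<Rightarrow> real ^ 'd) set" path_dist by (rule Metric_space_path)
  have K: "compactin M.mtopology ?K" by (rule compactin_holder_paths[OF \<alpha>(1) C(1)])
  then have "closedin M.mtopology ?K" by (rule compactin_imp_closedin[OF M.Hausdorff_space_mtopology])
  then have "M.mtopology closure_of (volterra_attractor \<alpha> g) \<subseteq> ?K"
    using C(2) by (rule closure_of_minimal[rotated])
  then have "compactin M.mtopology (M.mtopology closure_of (volterra_attractor \<alpha> g))"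
    by (rule closed_compactin[OF K]) simp
  then show ?thesis unfolding precompact_in_def by (auto simp: volterra_attractor_def)
qed

lemma orbit_subsequence:
  fixes x :: "nat \<Rightarrow> real ^ 'd"
  assumes x: "\<And>n. norm (x n) \<le> R" and \<tau>0: "\<And>n. 0 \<le> \<tau> n" and \<tau>: "filterlim \<tau> at_top sequentially"
  obtains f r where "f \<in> volterra_attractor \<alpha> g" "strict_mono (r :: nat \<Rightarrow> nat)"
    "(\<lambda>n. path_dist (orbit (\<tau> (r n)) (x (r n))) f) \<longlonglongrightarrow> 0"
proof -
  obtain G where G: "0 \<le> G" "\<And>z. norm z \<le> invariant_radius R \<Longrightarrow> norm (g z) \<le> G"
    using g_bounded_on_cball[of "invariant_radius R"] by blast
  have C: "0 \<le> G / (\<alpha> * Gamma \<alpha>)" using G \<alpha> Gamma_pos by simp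
  obtain f and r :: "nat \<Rightarrow> nat" where f: "f \<in> holder_paths \<alpha> (invariant_radius R) (G / (\<alpha> * Gamma \<alpha>))"
    and r: "strict_mono r" and lim: "(\<lambda>n. path_dist (orbit (\<tau> (r n)) (x (r n))) f) \<longlonglongrightarrow> 0"
    by (rule holder_paths_subsequence[of "\<lambda>n. orbit (\<tau> n) (x n)", OF orbit_holder[OF G(2) x \<tau>0] \<alpha>(1) C])
  have "f \<in> volterra_attractor \<alpha> g"
  proof (rule attractorI[OF _ _ _ _ lim])
    show "f \<in> path_space" using f by (simp add: holder_paths_def)
    show "filterlim (\<lambda>n. \<tau> (r n)) at_top sequentially"
      by (rule filterlim_compose[OF \<tau> filterlim_subseq[OF r]])
  qed (use x \<tau>0 in auto)
  then show ?thesis using r lim by (rule that)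
qed

lemma orbit_image_limit:
  fixes x :: "nat \<Rightarrow> real ^ 'd"
  assumes f: "f \<in> path_space" and x: "\<And>n. norm (x n) \<le> R" and \<tau>0: "\<And>n. 0 \<le> \<tau> n"
    and lim: "(\<lambda>n. path_dist (orbit (\<tau> n) (x n)) f) \<longlonglongrightarrow> 0" and t: "0 \<le> t"
  shows "(\<lambda>n. path_dist (orbit (\<tau> n + t) (x n)) (volterra_semiflow \<alpha> g t f)) \<longlonglongrightarrow> 0"
    and "volterra_semiflow \<alpha> g t f \<in> path_space"
proof -
  have M: "norm ((\<lambda>\<theta>\<in>{0..}. sol (x n) (\<tau> n + \<theta>)) s) \<le> invariant_radius R" if "0 \<le> s" for n s
    using sol_bound[OF x, of "\<tau> n + s" n] \<tau>0[of n] that by simp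
  note L = semiflow_limit[OF orbit_solution[OF \<tau>0] orbit_path_space[OF \<tau>0] f M t lim]
  show "volterra_semiflow \<alpha> g t f \<in> path_space" by (rule L(2))
  show "(\<lambda>n. path_dist (orbit (\<tau> n + t) (x n)) (volterra_semiflow \<alpha> g t f)) \<longlonglongrightarrow> 0"
    using L(1) by (simp only: orbit_add[OF \<tau>0 t])
qed

lemma attractor_forward_invariant:
  assumes A: "f \<in> volterra_attractor \<alpha> g" and t: "0 \<le> t"
  shows "volterra_semiflow \<alpha> g t f \<in> volterra_attractor \<alpha> g"
proof -
  obtain x :: "nat \<Rightarrow> real ^ 'd" and \<tau> R where f: "f \<in> path_space" and x: "\<forall>n. norm (x n) \<le> R" and \<tau>0: "\<forall>n. 0 \<le> \<tau> n"
    and \<tau>: "filterlim \<tau> at_top sequentially" and lim: "(\<lambda>n. path_dist (orbit (\<tau> n) (x n)) f) \<longlonglongrightarrow> 0"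
    by (rule attractorE[OF A])
  note L = orbit_image_limit[OF f x[rule_format] \<tau>0[rule_format] lim t]
  show ?thesis
  proof (rule attractorI[OF L(2) _ _ _ L(1)])
    show "filterlim (\<lambda>n. \<tau> n + t) at_top sequentially"
      using filterlim_tendsto_add_at_top[OF tendsto_const[of t] \<tau>] by (simp add: add.commute)
  qed (use x \<tau>0 t in auto)
qed

text \<open>If \<open>f\<close> is the limit of \<open>\<T>\<^sub>t\<^sub>n id\<^sub>x\<^sub>n\<close>, then a limit point \<open>h\<close> of \<open>\<T>\<^sub>t\<^sub>n\<^sub>-\<^sub>t id\<^sub>x\<^sub>n\<close>, which
  exists by compactness, satisfies \<open>\<T>\<^sub>t h = f\<close>.\<close>

lemma attractor_backward_invariant:
  assumes A: "f \<in> volterra_attractor \<alpha> g" and t: "0 \<le> t"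
  shows "\<exists>h\<in>volterra_attractor \<alpha> g. volterra_semiflow \<alpha> g t h = f"
proof -
  interpret M: Metric_space "path_space :: (real \<Rightarrow> real ^ 'd) set" path_dist by (rule Metric_space_path)
  obtain x :: "nat \<Rightarrow> real ^ 'd" and \<tau> R where f: "f \<in> path_space" and x: "\<forall>n. norm (x n) \<le> R" and \<tau>0: "\<forall>n. 0 \<le> \<tau> n"
    and \<tau>: "filterlim \<tau> at_top sequentially" and lim: "(\<lambda>n. path_dist (orbit (\<tau> n) (x n)) f) \<longlonglongrightarrow> 0"
    by (rule attractorE[OF A])
  have "\<forall>\<^sub>F n in sequentially. t \<le> \<tau> n" using \<tau> by (simp add: filterlim_at_top)
  then obtain N where N: "\<And>n. N \<le> n \<Longrightarrow> t \<le> \<tau> n" unfolding eventually_sequentially by blast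
  \<comment> \<open>Dropping the first \<open>N\<close> terms makes all shifted times \<open>\<sigma> n\<close> non-negative.\<close>
  define x' where "x' n = x (n + N)" for n
  define \<sigma> where "\<sigma> n = \<tau> (n + N) - t" for n
  have \<sigma>0: "0 \<le> \<sigma> n" for n using N[of "n + N"] by (simp add: \<sigma>_def)
  have x': "norm (x' n) \<le> R" for n using x by (simp add: x'_def)
  have "filterlim (\<lambda>n. \<tau> (n + N)) at_top sequentially"
    by (rule filterlim_compose[OF \<tau> filterlim_add_const_nat_at_top])
  then have \<sigma>: "filterlim \<sigma> at_top sequentially"
    using filterlim_tendsto_add_at_top[OF tendsto_const[of "- t"]] by (simp add: \<sigma>_def[abs_def])
  obtain h and r :: "nat \<Rightarrow> nat" where h: "h \<in> volterra_attractor \<alpha> g" and r: "strict_mono r"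
    and hlim: "(\<lambda>n. path_dist (orbit (\<sigma> (r n)) (x' (r n))) h) \<longlonglongrightarrow> 0"
    by (rule orbit_subsequence[OF x' \<sigma>0 \<sigma>])
  have hp: "h \<in> path_space" using h by (simp add: volterra_attractor_def)
  note L = orbit_image_limit[OF hp x' \<sigma>0 hlim t]
  have eq: "orbit (\<sigma> (r n) + t) (x' (r n)) = orbit (\<tau> (r n + N)) (x (r n + N))" for n
    by (simp add: \<sigma>_def x'_def)
  have "(\<lambda>n. path_dist (orbit (\<tau> (r n + N)) (x (r n + N))) f) \<longlonglongrightarrow> 0"
    by (rule filterlim_compose[OF lim]) (rule filterlim_compose[OF filterlim_add_const_nat_at_top filterlim_subseq[OF r]])
  then have "limitin M.mtopology (\<lambda>n. orbit (\<tau> (r n + N)) (x (r n + N))) f sequentially"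
    unfolding M.limitin_metric_dist_null using f \<tau>0 by (simp add: orbit_path_space)
  moreover have "limitin M.mtopology (\<lambda>n. orbit (\<tau> (r n + N)) (x (r n + N))) (volterra_semiflow \<alpha> g t h) sequentially"
    unfolding M.limitin_metric_dist_null using L \<tau>0 by (simp add: orbit_path_space eq)
  ultimately have "volterra_semiflow \<alpha> g t h = f"
    by (intro M.limitin_metric_unique) auto
  then show ?thesis using h by blast
qed

text \<open>Otherwise some points of \<open>\<T>\<^sub>t\<^sub>n\<close> applied to the set of initial paths, with \<open>t\<^sub>n \<rightarrow> \<infinity>\<close>, would stay at
  distance \<open>e\<close> from the attractor, although a subsequence of them converges to one of its points.\<close>

lemma attractor_close:
  assumes R: "\<And>x\<^sub>0. x\<^sub>0 \<in> D\<^sub>0 \<Longrightarrow> norm x\<^sub>0 \<le> R" and e: "0 < e"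
  shows "\<exists>T. \<forall>t\<ge>T. \<forall>x\<^sub>0\<in>D\<^sub>0. \<exists>v\<in>volterra_attractor \<alpha> g. path_dist (orbit t x\<^sub>0) v < e"
proof (rule ccontr)
  assume "\<not> ?thesis"
  then have "\<forall>n::nat. \<exists>t x\<^sub>0. real n \<le> t \<and> x\<^sub>0 \<in> D\<^sub>0 \<and>
      (\<forall>v\<in>volterra_attractor \<alpha> g. e \<le> path_dist (orbit t x\<^sub>0) v)"
    by (simp add: not_less) blast
  then obtain \<tau> x where \<tau>: "\<And>n. real n \<le> \<tau> n" and x: "\<And>n. x n \<in> D\<^sub>0"
    and far: "\<And>n v. v \<in> volterra_attractor \<alpha> g \<Longrightarrow> e \<le> path_dist (orbit (\<tau> n) (x n)) v"
    by metis
  have \<tau>0: "0 \<le> \<tau> n" for n using order_trans[OF of_nat_0_le_iff \<tau>] .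
  have \<tau>lim: "filterlim \<tau> at_top sequentially"
    by (rule filterlim_at_top_mono[OF filterlim_real_sequentially]) (simp add: \<tau>)
  obtain f and r :: "nat \<Rightarrow> nat" where f: "f \<in> volterra_attractor \<alpha> g" and "strict_mono r"
    and lim: "(\<lambda>n. path_dist (orbit (\<tau> (r n)) (x (r n))) f) \<longlonglongrightarrow> 0"
    by (rule orbit_subsequence[OF R[OF x] \<tau>0 \<tau>lim])
  have "\<forall>\<^sub>F n in sequentially. path_dist (orbit (\<tau> (r n)) (x (r n))) f < e"
    using e by (rule order_tendstoD(2)[OF lim])
  then obtain n where "path_dist (orbit (\<tau> (r n)) (x (r n))) f < e"
    unfolding eventually_sequentially by blast
  then show False using far[OF f, of "r n"] by simp
qed

lemma attractor_attracts: "attracts_universe \<alpha> g (volterra_attractor \<alpha> g)"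
  unfolding attracts_universe_def
proof
  fix D :: "(real \<Rightarrow> real ^ 'd) set" assume "D \<in> attraction_universe"
  then obtain D\<^sub>0 where D: "D = const_path ` D\<^sub>0" "bounded D\<^sub>0" unfolding attraction_universe_def by blast
  then obtain R where R: "\<And>x\<^sub>0. x\<^sub>0 \<in> D\<^sub>0 \<Longrightarrow> norm x\<^sub>0 \<le> R" unfolding bounded_iff by blast
  show "((\<lambda>t. hausdorff_semidist (volterra_semiflow \<alpha> g t ` D) (volterra_attractor \<alpha> g)) \<longlongrightarrow> 0) at_top"
  proof (rule order_tendstoI)
    fix c :: ennreal assume c: "0 < c"
    obtain d where d: "0 < d" "d < c" using dense[OF c] by blast
    define e where "e = enn2real d"
    have "d < top" using d(2) by (rule order_less_le_trans) simp
    then have e: "0 < e" "ennreal e < c"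
      unfolding e_def using d by (simp_all add: enn2real_positive_iff)
    have "\<exists>T. \<forall>t\<ge>T. \<forall>x\<^sub>0\<in>D\<^sub>0. \<exists>v\<in>volterra_attractor \<alpha> g. path_dist (orbit t x\<^sub>0) v < e"
      by (rule attractor_close[OF R e(1)])
    then obtain T where T: "\<forall>t\<ge>T. \<forall>x\<^sub>0\<in>D\<^sub>0. \<exists>v\<in>volterra_attractor \<alpha> g. path_dist (orbit t x\<^sub>0) v < e" ..
    have "hausdorff_semidist (volterra_semiflow \<alpha> g t ` D) (volterra_attractor \<alpha> g) \<le> ennreal e" if "T \<le> t" for t
      unfolding hausdorff_semidist_def
    proof (rule SUP_least)
      fix u assume "u \<in> volterra_semiflow \<alpha> g t ` D"
      then obtain x\<^sub>0 where x0: "x\<^sub>0 \<in> D\<^sub>0" "u = orbit t x\<^sub>0" unfolding D by blast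
      obtain v where v: "v \<in> volterra_attractor \<alpha> g" "path_dist u v < e"
        using T[rule_format, OF \<open>T \<le> t\<close> x0(1)] x0(2) by blast
      then show "(INF v\<in>volterra_attractor \<alpha> g. ennreal (path_dist u v)) \<le> ennreal e"
        by (intro INF_lower2[OF v(1)] ennreal_leI) simp
    qed
    then show "\<forall>\<^sub>F t in at_top. hausdorff_semidist (volterra_semiflow \<alpha> g t ` D) (volterra_attractor \<alpha> g) < c"
      using e(2) unfolding eventually_at_top_linorder by (blast intro: le_less_trans)
  qed simp
qed

text \<open>The initial values \<open>x\<^sub>n\<close> that approximate a point \<open>f\<close> of the attractor form one bounded set, so
  \<open>A'\<close> attracts all \<open>\<T>\<^sub>t\<^sub>n id\<^sub>x\<^sub>n\<close> uniformly, and \<open>f\<close> is at distance \<open>0\<close> from \<open>A'\<close>.\<close>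

lemma attractor_minimal:
  assumes cl: "closedin path_topology A'" and att: "attracts_universe \<alpha> g A'"
  shows "volterra_attractor \<alpha> g \<subseteq> A'"
proof
  fix f assume A: "f \<in> volterra_attractor \<alpha> g"
  interpret M: Metric_space "path_space :: (real \<Rightarrow> real ^ 'd) set" path_dist by (rule Metric_space_path)
  have sub: "A' \<subseteq> path_space" using closedin_subset[OF cl] by simp
  obtain x :: "nat \<Rightarrow> real ^ 'd" and \<tau> R where f: "f \<in> path_space" and x: "\<forall>n. norm (x n) \<le> R" and \<tau>0: "\<forall>n. 0 \<le> \<tau> n"
    and \<tau>: "filterlim \<tau> at_top sequentially" and lim: "(\<lambda>n. path_dist (orbit (\<tau> n) (x n)) f) \<longlonglongrightarrow> 0"
    by (rule attractorE[OF A])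
  define D where "D = const_path ` range x"
  have "bounded (range x)" using x unfolding bounded_iff by blast
  then have "D \<in> attraction_universe" unfolding attraction_universe_def D_def by blast
  then have "((\<lambda>t. hausdorff_semidist (volterra_semiflow \<alpha> g t ` D) A') \<longlongrightarrow> 0) at_top"
    using att unfolding attracts_universe_def by blast
  from filterlim_compose[OF this \<tau>]
  have H: "(\<lambda>n. hausdorff_semidist (volterra_semiflow \<alpha> g (\<tau> n) ` D) A') \<longlonglongrightarrow> 0" .
  have near: "\<exists>v\<in>A'. path_dist f v < e" if e: "0 < e" for e
  proof -
    have "\<forall>\<^sub>F n in sequentially. hausdorff_semidist (volterra_semiflow \<alpha> g (\<tau> n) ` D) A' < ennreal (e / 2)"
      using e by (intro order_tendstoD(2)[OF H]) (simp add: ennreal_zero_less_divide)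
    moreover have "\<forall>\<^sub>F n in sequentially. path_dist (orbit (\<tau> n) (x n)) f < e / 2"
      using e by (intro order_tendstoD(2)[OF lim]) simp
    ultimately have "\<forall>\<^sub>F n in sequentially. hausdorff_semidist (volterra_semiflow \<alpha> g (\<tau> n) ` D) A' < ennreal (e / 2)
        \<and> path_dist (orbit (\<tau> n) (x n)) f < e / 2" by (rule eventually_conj)
    then obtain n where n: "hausdorff_semidist (volterra_semiflow \<alpha> g (\<tau> n) ` D) A' < ennreal (e / 2)"
      "path_dist (orbit (\<tau> n) (x n)) f < e / 2" unfolding eventually_sequentially by blast
    let ?u = "orbit (\<tau> n) (x n)"
    have "(INF v\<in>A'. ennreal (path_dist ?u v)) \<le> hausdorff_semidist (volterra_semiflow \<alpha> g (\<tau> n) ` D) A'"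
      unfolding hausdorff_semidist_def by (rule SUP_upper) (simp add: D_def)
    then have "(INF v\<in>A'. ennreal (path_dist ?u v)) < ennreal (e / 2)" using n(1) by (rule le_less_trans)
    then obtain v where v: "v \<in> A'" "ennreal (path_dist ?u v) < ennreal (e / 2)" unfolding INF_less_iff by blast
    then have uv: "path_dist ?u v < e / 2" by (simp add: ennreal_less_iff)
    have "?u \<in> path_space" using \<tau>0 by (simp add: orbit_path_space)
    then have "path_dist f v \<le> path_dist f ?u + path_dist ?u v"
      using f v(1) sub by (intro M.triangle) auto
    then have "path_dist f v < e" using uv n(2) M.commute[of f ?u] by simp
    then show ?thesis using v(1) by blast
  qed
  have "f \<in> M.mtopology closure_of A'"
    unfolding M.metric_closure_of using f near sub by (auto simp: M.in_mball)
  then show "f \<in> A'" using cl by (simp add: closure_of_closedin)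
qed

end

theorem theorem4p6:
  fixes \<alpha> a b :: real and g :: "real ^ 'd \<Rightarrow> real ^ 'd"
  assumes "0 < \<alpha>" "\<alpha> < 1"
    and "\<And>x. \<exists>r>0. \<exists>L. L-lipschitz_on (ball x r) g"
    and "0 < a" "0 < b"
    and "\<And>x. x \<bullet> g x \<le> a - b * (norm x)\<^sup>2"
  shows "precompact_in path_topology (volterra_attractor \<alpha> g) \<and>
    (\<forall>t\<ge>0. volterra_semiflow \<alpha> g t ` volterra_attractor \<alpha> g = volterra_attractor \<alpha> g) \<and>
    attracts_universe \<alpha> g (volterra_attractor \<alpha> g) \<and>
    (\<forall>A' \<subseteq> path_space. closedin path_topology A' \<and> attracts_universe \<alpha> g A'
       \<longrightarrow> volterra_attractor \<alpha> g \<subseteq> A')"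
proof -
  interpret dissipative_volterra \<alpha> g a b
    by unfold_locales (use assms in auto)
  show ?thesis
  proof (intro conjI allI impI)
    show "precompact_in path_topology (volterra_attractor \<alpha> g)" by (rule attractor_precompact)
    show "attracts_universe \<alpha> g (volterra_attractor \<alpha> g)" by (rule attractor_attracts)
    fix t :: real assume t: "0 \<le> t"
    show "volterra_semiflow \<alpha> g t ` volterra_attractor \<alpha> g = volterra_attractor \<alpha> g"
      using attractor_forward_invariant[OF _ t] attractor_backward_invariant[OF _ t] by blast
  next
    fix A' :: "(real \<Rightarrow> real ^ 'd) set"
    assume "closedin path_topology A' \<and> attracts_universe \<alpha> g A'"
    then show "volterra_attractor \<alpha> g \<subseteq> A'" by (intro attractor_minimal) auto
  qed
qed

end
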